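(* (1) The map $W_0:\mathcal L_2(\mathcal F_\lambda)\to L^2(\mathbb C^n,\mu_\lambda)$ is a Stratonovich-Weyl correspondence for the triple $(G,\pi,\mathbb C^n)$ (with $\mathbb C^n$ equipped with the invariant measure $\mu_\lambda$). (2) The map $W_0':\mathcal L_2(\mathcal F_\lambda)\to L^2(\mathcal O(\xi_0),\nu_\lambda)$ defined by $W_0'(A)=W_0(A)\circ\psi^{-1}$ is a Stratonovich-Weyl correspondence for the triple $(G,\pi,\mathcal O(\xi_0))$ (with $\mathcal O(\xi_0)$ equipped with the coadjoint action and the measure $\nu_\lambda=\psi_*(\mu_\lambda)$).
   Context: Stratonovich-Weyl correspondence: let $\pi$ be a unitary representation of a Lie group $G$ on a Hilbert space $\mathcal H$, $M$ a homogeneous $G$-space with $G$-invariant measure $\mu$. A Stratonovich-Weyl correspondence for $(G,\pi,M)$ is an isomorphism $W$ from a vector space of operators on $\mathcal H$ onto a space of (generalized) functions on $M$ such that: (i) $W$ maps the identity operator to the constant function $1$; (ii) $W(A^* )=\overline{W(A)}$; (iii) $W(\pi(g)A\pi(g)^{-1})(x)=W(A)(g^{-1}\cdot x)$; (iv) $\int_MW(A)(x)W(B)(x)\,d\mu(x)=\mathrm{Tr}(AB)$. Here the operators are Hilbert-Schmidt, functions are identified a.e., and (i) refers to the extension of $W_0$ (hence $W_0'$) to the identity operator through the integral formula below. Fix integers $n,m\ge 1$ and $\lambda>0$. For $z,w\in\mathbb C^n$ put $zw:=\sum_k z_kw_k$ (bilinear), $|z|^2=z\bar z$, and $\omega((z,w),(z',w')):=\tfrac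 i2(zw'-z'w)$. Let $\alpha_1,\dots,\alpha_n$ be linear forms on $\mathbb R^m$; for $t\in\mathbb R^m$, $t\cdot z=(e^{i\alpha_1(t)}z_1,\dots,e^{i\alpha_n(t)}z_n)$; $t^{-1}$ means $-t$. The generalized diamond group $G$ is $\mathbb R^m\times\mathbb C^n\times\mathbb R$ with $(t,z,c)\cdot(t',z',c')=(t+t',\,z+t\cdot z',\,c+c'+\tfrac12\omega((z,\bar z),(t\cdot z',\overline{t\cdot z'})))$. It acts on $\mathbb C^n$ by $(t,z_0,c_0)\cdot z=t\cdot z+z_0$. Its Lie algebra $\mathfrak g$ consists of $(t,u,c)\in\mathbb R^m\times\mathbb C^n\times\mathbb R$ (tangent space at the identity). For $s\in(\mathbb R^m)^*$, $v\in\mathbb C^n$, $d\in\mathbb R$, $(s,v,d)\in\mathfrak g^*$ denotes the form $(t,u,c)\mapsto\langle s,t\rangle+\omega((v,\bar v),(u,\bar u))+cd$. $\mathcal F_\lambda$ is the Hilbert space of holomorphic $f$ on $\mathbb C^n$ with $\int_{\mathbb C^n}|f(z)|^2e^{-\lambda|z|^2/2}d\mu_\lambda(z)<\infty$, $d\mu_\lambda=(2\pi)^{-n}\lambda^n\,dx\,dy$, $z=x+iy$; $\mathcal L_2(\mathcal F_\lambda)$ is the space of Hilbert-Schmidt operators on it. Fix a unitary character $\chi$ of $\mathbb R^m$ with differential $d\chi$ at $0$. The unitary representation $\pi$ of $G$ on $\mathcal F_\lambda$ is $(\pi(t,z_0,c_0)f)(z)=\chi(t)\exp(i\lambda c_0+\tfrac\lambda2\bar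 z_0z-\tfrac\lambda4|z_0|^2)f(t^{-1}\cdot(z-z_0))$. With $e_z(w)=\exp(\lambda\bar zw/2)$ and $k_A(z,w)=\langle Ae_w,e_z\rangle$, the complex Weyl symbol of $A$ is $$W_0(A)(z)=2^n\int_{\mathbb C^n}k_A(z+w,z-w)\exp\left(\tfrac\lambda2(-z\bar z-w\bar w+z\bar w-\bar zw)\right)d\mu_\lambda(w)$$ whenever the integral converges absolutely; for $A$ trace class it equals $\mathrm{Tr}(A\,\Omega_0(z))$ with $(\Omega_0(z)f)(w)=2^n\exp(\lambda(w\bar z-|z|^2))f(2z-w)$. On $\mathcal L_2(\mathcal F_\lambda)$, $W_0$ is the (known) unitary map onto $L^2(\mathbb C^n,\mu_\lambda)$ extending $W_0$ continuously from trace class operators. $\psi:\mathbb C^n\to\mathfrak g^*$ is $\psi(z)=(-i\,d\chi+\tfrac12\sum_k(1-\lambda|z_k|^2)\alpha_k,\,-\lambda z,\,\lambda)$, which is a bijection onto the coadjoint orbit $\mathcal O(\xi_0)$ of $\xi_0=\psi(0)$. *)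

theory Defs
  imports "HOL-Analysis.Analysis" "HOL-Algebra.Group_Action"
begin

section \<open>Hilbert spaces of functions and their operators\<close>

text \<open>
  A complex Hilbert space is given by a set \<open>H\<close> of complex-valued functions on a type, with
  the pointwise vector space operations, and an inner product \<open>ip\<close>, linear in its first
  argument. Operators on \<open>H\<close> are extensional functions, that is \<open>undefined\<close> outside \<open>H\<close>, so
  that equality of operators is equality on \<open>H\<close>.
\<close>

type_synonym 'x inner_prod = "('x \<Rightarrow> complex) \<Rightarrow> ('x \<Rightarrow> complex) \<Rightarrow> complex"
type_synonym 'x operator = "('x \<Rightarrow> complex) \<Rightarrow> ('x \<Rightarrow> complex)"

definition hnorm :: "'x inner_prod \<Rightarrow> ('x \<Rightarrow> complex) \<Rightarrow> real" where
  "hnorm ip f = sqrt (Re (ip f f))"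

definition hilbert_space :: "('x \<Rightarrow> complex) set \<Rightarrow> 'x inner_prod \<Rightarrow> bool" where
  "hilbert_space H ip \<longleftrightarrow>
     (\<lambda>_. 0) \<in> H \<and>
     (\<forall>f\<in>H. \<forall>g\<in>H. \<forall>a b. (\<lambda>x. a * f x + b * g x) \<in> H) \<and>
     (\<forall>f\<in>H. \<forall>g\<in>H. \<forall>h\<in>H. \<forall>a b. ip (\<lambda>x. a * f x + b * g x) h = a * ip f h + b * ip g h) \<and>
     (\<forall>f\<in>H. \<forall>g\<in>H. ip g f = cnj (ip f g)) \<and>
     (\<forall>f\<in>H. f \<noteq> (\<lambda>_. 0) \<longrightarrow> Re (ip f f) > 0) \<and>
     (\<forall>F :: nat \<Rightarrow> 'x \<Rightarrow> complex. (\<forall>k. F k \<in> H) \<and>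
        (\<forall>\<epsilon>>0. \<exists>N. \<forall>j\<ge>N. \<forall>k\<ge>N. hnorm ip (\<lambda>x. F j x - F k x) < \<epsilon>) \<longrightarrow>
        (\<exists>f\<in>H. (\<lambda>k. hnorm ip (\<lambda>x. F k x - f x)) \<longlonglongrightarrow> 0))"

definition onb :: "('x \<Rightarrow> complex) set \<Rightarrow> 'x inner_prod \<Rightarrow> ('x \<Rightarrow> complex) set \<Rightarrow> bool" where
  "onb H ip E \<longleftrightarrow> E \<subseteq> H \<and>
     (\<forall>e\<in>E. \<forall>e'\<in>E. ip e e' = (if e = e' then 1 else 0)) \<and>
     (\<forall>f\<in>H. (\<forall>e\<in>E. ip f e = 0) \<longrightarrow> f = (\<lambda>_. 0))"

text \<open>The Hilbert-Schmidt norm and the trace below do not depend on the chosen basis.\<close>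

definition some_onb :: "('x \<Rightarrow> complex) set \<Rightarrow> 'x inner_prod \<Rightarrow> ('x \<Rightarrow> complex) set" where
  "some_onb H ip = (SOME E. onb H ip E)"

definition linear_op :: "('x \<Rightarrow> complex) set \<Rightarrow> 'x operator \<Rightarrow> bool" where
  "linear_op H A \<longleftrightarrow> A \<in> H \<rightarrow>\<^sub>E H \<and>
     (\<forall>f\<in>H. \<forall>g\<in>H. \<forall>a b. A (\<lambda>x. a * f x + b * g x) = (\<lambda>x. a * A f x + b * A g x))"

definition bounded_op :: "('x \<Rightarrow> complex) set \<Rightarrow> 'x inner_prod \<Rightarrow> 'x operator \<Rightarrow> bool" where
  "bounded_op H ip A \<longleftrightarrow> linear_op H A \<and> (\<exists>C. \<forall>f\<in>H. hnorm ip (A f) \<le> C * hnorm ip f)"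

definition id_op :: "('x \<Rightarrow> complex) set \<Rightarrow> 'x operator" where
  "id_op H = (\<lambda>f\<in>H. f)"

definition lincomb_op ::
    "('x \<Rightarrow> complex) set \<Rightarrow> complex \<Rightarrow> 'x operator \<Rightarrow> complex \<Rightarrow> 'x operator \<Rightarrow> 'x operator" where
  "lincomb_op H a A b B = (\<lambda>f\<in>H. \<lambda>x. a * A f x + b * B f x)"

definition adjoint_op ::
    "('x \<Rightarrow> complex) set \<Rightarrow> 'x inner_prod \<Rightarrow> 'x operator \<Rightarrow> 'x operator" where
  "adjoint_op H ip A =
     (THE B. bounded_op H ip B \<and> (\<forall>f\<in>H. \<forall>g\<in>H. ip (A f) g = ip f (B g)))"

definition hilbert_schmidt :: "('x \<Rightarrow> complex) set \<Rightarrow> 'x inner_prod \<Rightarrow> 'x operator set" where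
  "hilbert_schmidt H ip =
     {A. bounded_op H ip A \<and> (\<lambda>e. (hnorm ip (A e))\<^sup>2) summable_on some_onb H ip}"

definition hs_norm :: "('x \<Rightarrow> complex) set \<Rightarrow> 'x inner_prod \<Rightarrow> 'x operator \<Rightarrow> real" where
  "hs_norm H ip A = sqrt (\<Sum>\<^sub>\<infinity>e\<in>some_onb H ip. (hnorm ip (A e))\<^sup>2)"

text \<open>Trace class operators are the products of two Hilbert-Schmidt operators.\<close>

definition trace_class :: "('x \<Rightarrow> complex) set \<Rightarrow> 'x inner_prod \<Rightarrow> 'x operator set" where
  "trace_class H ip =
     {compose H A B | A B. A \<in> hilbert_schmidt H ip \<and> B \<in> hilbert_schmidt H ip}"

definition op_trace :: "('x \<Rightarrow> complex) set \<Rightarrow> 'x inner_prod \<Rightarrow> 'x operator \<Rightarrow> complex" where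
  "op_trace H ip A = (\<Sum>\<^sub>\<infinity>e\<in>some_onb H ip. ip (A e) e)"

definition L2 :: "'m measure \<Rightarrow> ('m \<Rightarrow> complex) set" where
  "L2 M = {F. F \<in> borel_measurable M \<and> integrable M (\<lambda>x. (cmod (F x))\<^sup>2)}"

definition L2_dist :: "'m measure \<Rightarrow> ('m \<Rightarrow> complex) \<Rightarrow> ('m \<Rightarrow> complex) \<Rightarrow> real" where
  "L2_dist M F F' = sqrt (LINT x|M. (cmod (F x - F' x))\<^sup>2)"


section \<open>Stratonovich-Weyl correspondences\<close>

definition topological_grp :: "('g::topological_space) monoid \<Rightarrow> bool" where
  "topological_grp G \<longleftrightarrow> group G \<and>
     continuous_on (carrier G \<times> carrier G) (\<lambda>(g, h). g \<otimes>\<^bsub>G\<^esub> h) \<and>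
     continuous_on (carrier G) (m_inv G)"

definition unitary_rep ::
    "('g::topological_space) monoid \<Rightarrow> ('x \<Rightarrow> complex) set \<Rightarrow> 'x inner_prod \<Rightarrow>
     ('g \<Rightarrow> 'x operator) \<Rightarrow> bool" where
  "unitary_rep G H ip \<pi> \<longleftrightarrow> group_action G H \<pi> \<and>
     (\<forall>g\<in>carrier G. linear_op H (\<pi> g) \<and> (\<forall>f\<in>H. \<forall>h\<in>H. ip (\<pi> g f) (\<pi> g h) = ip f h)) \<and>
     (\<forall>f\<in>H. \<forall>g\<in>carrier G.
        ((\<lambda>h. hnorm ip (\<lambda>x. \<pi> h f x - \<pi> g f x)) \<longlongrightarrow> 0) (at g within carrier G))"

definition homogeneous_space ::
    "('g::topological_space) monoid \<Rightarrow> ('m::topological_space) measure \<Rightarrow> ('g \<Rightarrow> 'm \<Rightarrow> 'm) \<Rightarrow> bool"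
  where
  "homogeneous_space G M act \<longleftrightarrow> space M \<noteq> {} \<and>
     sets M = sets (restrict_space borel (space M)) \<and>
     transitive_action G (space M) act \<and>
     continuous_on (carrier G \<times> space M) (\<lambda>(g, x). act g x) \<and>
     (\<forall>g\<in>carrier G. act g \<in> measurable M M \<and> distr M M (act g) = M)"

text \<open>
  Functions on \<open>M\<close> are identified when they agree almost everywhere, so the isomorphism \<open>W\<close> from
  the Hilbert-Schmidt operators onto \<open>L2 M\<close> is represented by a choice of representatives.
  The identity operator is in general not Hilbert-Schmidt; \<open>W\<close> is a total function, and its
  value there is that of an extension of the isomorphism.
\<close>

definition stratonovich_weyl ::
    "('g::topological_space) monoid \<Rightarrow> ('x \<Rightarrow> complex) set \<Rightarrow> 'x inner_prod \<Rightarrow>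
     ('g \<Rightarrow> 'x operator) \<Rightarrow> ('m::topological_space) measure \<Rightarrow> ('g \<Rightarrow> 'm \<Rightarrow> 'm) \<Rightarrow>
     ('x operator \<Rightarrow> 'm \<Rightarrow> complex) \<Rightarrow> bool" where
  "stratonovich_weyl G H ip \<pi> M act W \<longleftrightarrow>
     topological_grp G \<and> hilbert_space H ip \<and> unitary_rep G H ip \<pi> \<and> homogeneous_space G M act \<and>
     (let HS = hilbert_schmidt H ip in
       \<comment> \<open>isomorphism onto \<open>L2 M\<close> modulo null functions\<close>
       (\<forall>A\<in>HS. W A \<in> L2 M) \<and>
       (\<forall>A\<in>HS. \<forall>B\<in>HS. \<forall>a b. AE x in M. W (lincomb_op H a A b B) x = a * W A x + b * W B x) \<and>
       (\<forall>A\<in>HS. \<forall>B\<in>HS. (AE x in M. W A x = W B x) \<longrightarrow> A = B) \<and>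
       (\<forall>F\<in>L2 M. \<exists>A\<in>HS. AE x in M. W A x = F x) \<and>
       \<comment> \<open>the four conditions\<close>
       (AE x in M. W (id_op H) x = 1) \<and>
       (\<forall>A\<in>HS. AE x in M. W (adjoint_op H ip A) x = cnj (W A x)) \<and>
       (\<forall>g\<in>carrier G. \<forall>A\<in>HS. AE x in M.
          W (compose H (\<pi> g) (compose H A (\<pi> (m_inv G g)))) x = W A (act (m_inv G g) x)) \<and>
       (\<forall>A\<in>HS. \<forall>B\<in>HS. integrable M (\<lambda>x. W A x * W B x) \<and>
          (LINT x|M. W A x * W B x) = op_trace H ip (compose H A B)))"


section \<open>The generalized diamond group\<close>

definition cdot :: "complex ^ 'n \<Rightarrow> complex ^ 'n \<Rightarrow> complex" where
  "cdot z w = (\<Sum>k\<in>UNIV. z $ k * w $ k)"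

definition conjv :: "complex ^ 'n \<Rightarrow> complex ^ 'n" where
  "conjv z = (\<chi> k. cnj (z $ k))"

definition symp :: "(complex ^ 'n) \<times> (complex ^ 'n) \<Rightarrow> (complex ^ 'n) \<times> (complex ^ 'n) \<Rightarrow> complex" where
  "symp = (\<lambda>(z, w) (z', w'). \<i> / 2 * (cdot z w' - cdot z' w))"

text \<open>\<open>symp (z, conjv z) (w, conjv w)\<close> is real; its value as a real number:\<close>

definition rsymp :: "complex ^ 'n \<Rightarrow> complex ^ 'n \<Rightarrow> real" where
  "rsymp z w = Re (symp (z, conjv z) (w, conjv w))"

type_synonym ('m, 'n) diamond = "(real ^ 'm) \<times> (complex ^ 'n) \<times> real"

definition torus_act ::
    "('n::finite \<Rightarrow> (real ^ 'm) \<Rightarrow>\<^sub>L real) \<Rightarrow> real ^ 'm \<Rightarrow> complex ^ 'n \<Rightarrow> complex ^ 'n" where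
  "torus_act \<alpha> t z = (\<chi> k. exp (\<i> * of_real (blinfun_apply (\<alpha> k) t)) * z $ k)"

definition diamond_group ::
    "('n::finite \<Rightarrow> (real ^ 'm) \<Rightarrow>\<^sub>L real) \<Rightarrow> ('m, 'n) diamond monoid" where
  "diamond_group \<alpha> =
     \<lparr>carrier = UNIV,
      mult = (\<lambda>(t, z, c) (t', z', c').
        (t + t', z + torus_act \<alpha> t z', c + c' + rsymp z (torus_act \<alpha> t z') / 2)),
      one = (0, 0, 0)\<rparr>"

definition diamond_act ::
    "('n::finite \<Rightarrow> (real ^ 'm) \<Rightarrow>\<^sub>L real) \<Rightarrow> ('m, 'n) diamond \<Rightarrow> complex ^ 'n \<Rightarrow> complex ^ 'n" where
  "diamond_act \<alpha> = (\<lambda>(t, z0, c0) z. torus_act \<alpha> t z + z0)"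

text \<open>
  The group is a single global chart, so its Lie algebra, the tangent space at the identity,
  has the same underlying vector space; the dual of the latter is the space of (automatically
  bounded) linear functionals on it.
\<close>

definition Ad ::
    "('n::finite \<Rightarrow> (real ^ 'm) \<Rightarrow>\<^sub>L real) \<Rightarrow> ('m, 'n) diamond \<Rightarrow> ('m, 'n) diamond \<Rightarrow> ('m, 'n) diamond" where
  "Ad \<alpha> g = (let G = diamond_group \<alpha> in
     frechet_derivative (\<lambda>h. g \<otimes>\<^bsub>G\<^esub> h \<otimes>\<^bsub>G\<^esub> m_inv G g) (at \<one>\<^bsub>G\<^esub>))"

definition coAd ::
    "('n::finite \<Rightarrow> (real ^ 'm) \<Rightarrow>\<^sub>L real) \<Rightarrow> ('m, 'n) diamond \<Rightarrow>
     (('m, 'n) diamond \<Rightarrow>\<^sub>L real) \<Rightarrow> (('m, 'n) diamond \<Rightarrow>\<^sub>L real)" where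
  "coAd \<alpha> g \<xi> = Blinfun (\<lambda>X. blinfun_apply \<xi> (Ad \<alpha> (m_inv (diamond_group \<alpha>) g) X))"

text \<open>The functional denoted by \<open>(s, v, d)\<close>:\<close>

definition dual_triple ::
    "((real ^ 'm) \<Rightarrow>\<^sub>L real) \<Rightarrow> complex ^ 'n \<Rightarrow> real \<Rightarrow> (('m, 'n) diamond \<Rightarrow>\<^sub>L real)" where
  "dual_triple s v d = Blinfun (\<lambda>(t, u, c). blinfun_apply s t + rsymp v u + c * d)"

definition unitary_character :: "((real ^ 'm) \<Rightarrow> complex) \<Rightarrow> bool" where
  "unitary_character \<kappa> \<longleftrightarrow> continuous_on UNIV \<kappa> \<and>
     (\<forall>s t. \<kappa> (s + t) = \<kappa> s * \<kappa> t) \<and> (\<forall>t. cmod (\<kappa> t) = 1)"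

text \<open>\<open>-\<i> d\<kappa>\<close> as a real linear form; \<open>d\<kappa>\<close> takes purely imaginary values.\<close>

definition char_form :: "((real ^ 'm) \<Rightarrow> complex) \<Rightarrow> (real ^ 'm) \<Rightarrow>\<^sub>L real" where
  "char_form \<kappa> = Blinfun (\<lambda>t. Re (- \<i> * frechet_derivative \<kappa> (at 0) t))"

definition psi ::
    "('n::finite \<Rightarrow> (real ^ 'm) \<Rightarrow>\<^sub>L real) \<Rightarrow> ((real ^ 'm) \<Rightarrow> complex) \<Rightarrow> real \<Rightarrow> complex ^ 'n \<Rightarrow>
     (('m, 'n) diamond \<Rightarrow>\<^sub>L real)" where
  "psi \<alpha> \<kappa> l z = dual_triple
     (char_form \<kappa> + (1 / 2) *\<^sub>R (\<Sum>k\<in>UNIV. (1 - l * (cmod (z $ k))\<^sup>2) *\<^sub>R \<alpha> k))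
     ((- l) *\<^sub>R z) l"

definition coadjoint_orbit ::
    "('n::finite \<Rightarrow> (real ^ 'm) \<Rightarrow>\<^sub>L real) \<Rightarrow> ((real ^ 'm) \<Rightarrow> complex) \<Rightarrow> real \<Rightarrow>
     (('m, 'n) diamond \<Rightarrow>\<^sub>L real) set" where
  "coadjoint_orbit \<alpha> \<kappa> l = orbit (diamond_group \<alpha>) (coAd \<alpha>) (psi \<alpha> \<kappa> l 0)"

definition coadjoint_act ::
    "('n::finite \<Rightarrow> (real ^ 'm) \<Rightarrow>\<^sub>L real) \<Rightarrow> ((real ^ 'm) \<Rightarrow> complex) \<Rightarrow> real \<Rightarrow> ('m, 'n) diamond \<Rightarrow>
     (('m, 'n) diamond \<Rightarrow>\<^sub>L real) \<Rightarrow> (('m, 'n) diamond \<Rightarrow>\<^sub>L real)" where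
  "coadjoint_act \<alpha> \<kappa> l g = restrict (coAd \<alpha> g) (coadjoint_orbit \<alpha> \<kappa> l)"


section \<open>The Fock space and the representation\<close>

definition mu :: "real \<Rightarrow> (complex ^ 'n) measure" where
  "mu l = density lborel (\<lambda>_. ennreal ((l / (2 * pi)) ^ CARD('n)))"

definition nu ::
    "('n::finite \<Rightarrow> (real ^ 'm) \<Rightarrow>\<^sub>L real) \<Rightarrow> ((real ^ 'm) \<Rightarrow> complex) \<Rightarrow> real \<Rightarrow>
     (('m, 'n) diamond \<Rightarrow>\<^sub>L real) measure" where
  "nu \<alpha> \<kappa> l = distr (mu l) (restrict_space borel (coadjoint_orbit \<alpha> \<kappa> l)) (psi \<alpha> \<kappa> l)"

definition entire :: "(complex ^ 'n \<Rightarrow> complex) \<Rightarrow> bool" where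
  "entire f \<longleftrightarrow> (\<forall>z. \<exists>D. (f has_derivative D) (at z) \<and> (\<forall>a v. D (a *s v) = a * D v))"

definition fock :: "real \<Rightarrow> (complex ^ 'n \<Rightarrow> complex) set" where
  "fock l = {f. entire f \<and>
     integrable (mu l) (\<lambda>z. (cmod (f z))\<^sup>2 * exp (- l * (norm z)\<^sup>2 / 2))}"

definition fock_inner :: "real \<Rightarrow> (complex ^ 'n) inner_prod" where
  "fock_inner l f g = (LINT z|mu l. f z * cnj (g z) * of_real (exp (- l * (norm z)\<^sup>2 / 2)))"

definition diamond_rep ::
    "('n::finite \<Rightarrow> (real ^ 'm) \<Rightarrow>\<^sub>L real) \<Rightarrow> ((real ^ 'm) \<Rightarrow> complex) \<Rightarrow> real \<Rightarrow> ('m, 'n) diamond \<Rightarrow>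
     (complex ^ 'n) operator" where
  "diamond_rep \<alpha> \<kappa> l = (\<lambda>(t, z0, c0). \<lambda>f\<in>fock l. \<lambda>z.
     \<kappa> t * exp (\<i> * of_real (l * c0) + of_real (l / 2) * cdot (conjv z0) z
                - of_real (l / 4 * (norm z0)\<^sup>2))
     * f (torus_act \<alpha> (- t) (z - z0)))"


section \<open>The complex Weyl calculus\<close>

definition coherent :: "real \<Rightarrow> complex ^ 'n \<Rightarrow> complex ^ 'n \<Rightarrow> complex" where
  "coherent l z = (\<lambda>w. exp (of_real l * cdot (conjv z) w / 2))"

definition op_kernel ::
    "real \<Rightarrow> (complex ^ 'n) operator \<Rightarrow> complex ^ 'n \<Rightarrow> complex ^ 'n \<Rightarrow> complex" where
  "op_kernel l A z w = fock_inner l (A (coherent l w)) (coherent l z)"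

definition weyl_integral :: "real \<Rightarrow> (complex ^ 'n) operator \<Rightarrow> complex ^ 'n \<Rightarrow> complex" where
  "weyl_integral l A z = 2 ^ CARD('n) *
     (LINT w|mu l. op_kernel l A (z + w) (z - w) *
        exp (of_real (l / 2) * (- cdot z (conjv z) - cdot w (conjv w)
                                + cdot z (conjv w) - cdot (conjv z) w)))"

text \<open>
  The continuous extension of \<open>weyl_integral\<close> from the trace class operators to the
  Hilbert-Schmidt operators (in Hilbert-Schmidt norm, with values in \<open>L2 (mu l)\<close>). It is
  determined up to null functions.
\<close>

definition weyl_extension :: "real \<Rightarrow> (complex ^ 'n) operator \<Rightarrow> complex ^ 'n \<Rightarrow> complex" where
  "weyl_extension l A = (SOME F. F \<in> L2 (mu l) \<and>
     (\<forall>T. (\<forall>k::nat. T k \<in> trace_class (fock l) (fock_inner l)) \<and>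
          (\<lambda>k. hs_norm (fock l) (fock_inner l) (lincomb_op (fock l) 1 (T k) (- 1) A)) \<longlonglongrightarrow> 0 \<longrightarrow>
          (\<forall>k. weyl_integral l (T k) \<in> L2 (mu l)) \<and>
          (\<lambda>k. L2_dist (mu l) (weyl_integral l (T k)) F) \<longlonglongrightarrow> 0))"

text \<open>
  The map \<open>W\<^sub>0\<close>: the extension on Hilbert-Schmidt operators, and the integral formula for all
  other operators, in particular for the identity.
\<close>

definition weyl_symbol :: "real \<Rightarrow> (complex ^ 'n) operator \<Rightarrow> complex ^ 'n \<Rightarrow> complex" where
  "weyl_symbol l A =
     (if A \<in> hilbert_schmidt (fock l) (fock_inner l) then weyl_extension l A
      else weyl_integral l A)"

definition weyl_symbol_orbit ::
    "('n::finite \<Rightarrow> (real ^ 'm) \<Rightarrow>\<^sub>L real) \<Rightarrow> ((real ^ 'm) \<Rightarrow> complex) \<Rightarrow> real \<Rightarrow>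
     (complex ^ 'n) operator \<Rightarrow> (('m, 'n) diamond \<Rightarrow>\<^sub>L real) \<Rightarrow> complex" where
  "weyl_symbol_orbit \<alpha> \<kappa> l A = weyl_symbol l A \<circ> inv_into UNIV (psi \<alpha> \<kappa> l)"

end

theory Submission
  imports Defs "HOL-Probability.Distributions" "HOL-Complex_Analysis.Cauchy_Integral_Formula"
begin

text \<open>
  The operator \<open>R (a, b)\<close>, sending \<open>f\<close> to \<open>\<langle>f, e\<^sub>b\<rangle> e\<^sub>a\<close> for coherent states \<open>e\<^sub>a\<close>, \<open>e\<^sub>b\<close>, has an explicit
  Gaussian \<open>G (a, b)\<close> as its complex Weyl symbol, and the families \<open>R\<close> and \<open>G\<close> have the same Gram
  matrix in the Hilbert-Schmidt operators and in \<open>L\<^sup>2\<close>. The operators \<open>R (a, b)\<close> are total because the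
  Fock space has a reproducing kernel, the functions \<open>G (a, b)\<close> because the Fourier transform is
  injective. So \<open>R (a, b) \<mapsto> G (a, b)\<close> extends to a unitary map: the symbol of \<open>A\<close> is the unique \<open>F\<close>
  with \<open>\<langle>F, G (a, b)\<rangle> = \<langle>A e\<^sub>b, e\<^sub>a\<rangle>\<close> for all \<open>a\<close>, \<open>b\<close>. Covariance and compatibility with adjoints are
  read off from this description, and the trace formula is unitarity. For Hilbert-Schmidt \<open>B\<close>, \<open>C\<close> the
  integral formula applied to \<open>B C\<close> is bounded pointwise by \<open>2\<^sup>n \<parallel>B\<parallel> \<parallel>C\<parallel>\<close>, so it agrees with the
  unitary map, by approximation of \<open>B\<close> and \<open>C\<close> by combinations of the \<open>R (a, b)\<close>. The statement on
  the coadjoint orbit follows because \<open>\<psi>\<close> is an equivariant homeomorphism onto it.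
\<close>

section \<open>Semi-inner product spaces\<close>

text \<open>A symbol is determined only up to null functions, and operators are combined by
  \<open>lincomb_op\<close> rather than pointwise. Hence the abstract spaces carry a mere semi-inner
  product and take their linear combination \<open>lc\<close> as a parameter, and the unitary map is
  a relation \<open>matched\<close> rather than a function. The obstacle is that
  \<open>weyl_extension\<close> is a choice constrained only by convergence along sequences of trace
  class operators: every trace class operator has to be matched to its own integral, and such
  operators have to be dense. The pointwise bound behind this comes from the resolution of the
  identity by coherent states, which turns the Hilbert-Schmidt norm of C into the L2 norm of w ->
  \<open>nrm (C (coh w))\<close> times the square root of the Gaussian weight; the exponential in
  the integral formula has exactly the modulus needed for Cauchy-Schwarz in w. The Fourier kernel
  enters through the pairs (-\<zeta>, \<zeta>), for which the symbol is one fixed Gaussian times a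
  character, up to a constant.\<close>

locale semi_ip =
  fixes V :: "'v set" and lc :: "complex \<Rightarrow> 'v \<Rightarrow> complex \<Rightarrow> 'v \<Rightarrow> 'v" and ip :: "'v \<Rightarrow> 'v \<Rightarrow> complex"
  assumes lc_in: "f \<in> V \<Longrightarrow> g \<in> V \<Longrightarrow> lc a f b g \<in> V"
    and ip_lc: "f \<in> V \<Longrightarrow> g \<in> V \<Longrightarrow> h \<in> V \<Longrightarrow> ip (lc a f b g) h = a * ip f h + b * ip g h"
    and ip_herm: "f \<in> V \<Longrightarrow> g \<in> V \<Longrightarrow> ip g f = cnj (ip f g)"
    and ip_pos: "f \<in> V \<Longrightarrow> 0 \<le> Re (ip f f)"
begin

section \<open>Norm, distance and their elementary inequalities\<close>

definition nrm :: "'v \<Rightarrow> real" where "nrm f = sqrt (Re (ip f f))"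

definition dst :: "'v \<Rightarrow> 'v \<Rightarrow> real" where "dst f g = nrm (lc 1 f (-1) g)"

lemma ip_lc_right:
  assumes "f \<in> V" "g \<in> V" "h \<in> V"
  shows "ip h (lc a f b g) = cnj a * ip h f + cnj b * ip h g"
  using assms by (simp add: ip_herm[of "lc a f b g" h] ip_herm[of f h] ip_herm[of g h] lc_in ip_lc)

lemma nrm_ge0: "f \<in> V \<Longrightarrow> 0 \<le> nrm f" by (simp add: nrm_def ip_pos)

lemma nrm_sq: "f \<in> V \<Longrightarrow> (nrm f)\<^sup>2 = Re (ip f f)" by (simp add: nrm_def ip_pos)

lemma ip_self: "f \<in> V \<Longrightarrow> ip f f = of_real ((nrm f)\<^sup>2)"
  using ip_herm[of f f] by (simp add: nrm_sq complex_eq_iff)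

lemma nrm_lc_sq:
  assumes "f \<in> V" "g \<in> V"
  shows "(nrm (lc a f b g))\<^sup>2
    = (cmod a)\<^sup>2 * (nrm f)\<^sup>2 + (cmod b)\<^sup>2 * (nrm g)\<^sup>2 + 2 * Re (a * cnj b * ip f g)"
proof -
  have "ip (lc a f b g) (lc a f b g) = a * cnj a * ip f f + b * cnj b * ip g g
     + (a * cnj b * ip f g + cnj (a * cnj b * ip f g))"
    using assms by (simp add: ip_lc ip_lc_right lc_in ip_herm[of f g] algebra_simps)
  also have "\<dots> = of_real ((cmod a)\<^sup>2 * (nrm f)\<^sup>2 + (cmod b)\<^sup>2 * (nrm g)\<^sup>2
     + 2 * Re (a * cnj b * ip f g))"
    by (simp add: ip_self assms complex_add_cnj complex_norm_square[symmetric] del: complex_cnj_mult)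
  finally show ?thesis
    using assms by (simp only: nrm_sq lc_in Re_complex_of_real)
qed

text \<open>Positivity of the norm of f - t <f,g> g for all real t. A null vector g need not be
  zero, so the case of norm zero cannot be dismissed and is handled by letting t be large.\<close>

lemma cauchy_schwarz:
  assumes [simp]: "f \<in> V" "g \<in> V"
  shows "cmod (ip f g) \<le> nrm f * nrm g"
proof -
  let ?r = "ip f g"
  have *: "0 \<le> (nrm f)\<^sup>2 + t\<^sup>2 * (cmod ?r)\<^sup>2 * (nrm g)\<^sup>2 - 2 * t * (cmod ?r)\<^sup>2" for t :: real
  proof -
    have "0 \<le> (nrm (lc 1 f (- of_real t * ?r) g))\<^sup>2" by simp
    also have "\<dots> = (nrm f)\<^sup>2 + (cmod (of_real t * ?r))\<^sup>2 * (nrm g)\<^sup>2 + 2 * Re (- of_real t * (?r * cnj ?r))"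
      by (subst nrm_lc_sq) (auto simp: norm_mult algebra_simps)
    also have "\<dots> = (nrm f)\<^sup>2 + t\<^sup>2 * (cmod ?r)\<^sup>2 * (nrm g)\<^sup>2 - 2 * t * (cmod ?r)\<^sup>2"
      by (simp add: norm_mult power_mult_distrib complex_norm_square[symmetric] del: of_real_power of_real_mult)
    finally show ?thesis .
  qed
  have "(cmod ?r)\<^sup>2 \<le> (nrm f * nrm g)\<^sup>2"
  proof (cases "nrm g = 0")
    case True
    have "?r = 0"
    proof (rule ccontr)
      assume "?r \<noteq> 0"
      \<comment> \<open>With \<open>nrm g = 0\<close> this value of t makes the right-hand side of
        the inequality equal to -1.\<close>
      then show False
        using *[of "((nrm f)\<^sup>2 + 1) / (2 * (cmod ?r)\<^sup>2)"] True by (simp add: field_simps)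
    qed
    then show ?thesis by simp
  next
    case False
    have "(1 / (nrm g)\<^sup>2)\<^sup>2 * (cmod ?r)\<^sup>2 * (nrm g)\<^sup>2 = (cmod ?r)\<^sup>2 / (nrm g)\<^sup>2"
      using False by (simp add: field_simps power2_eq_square)
    then have "(cmod ?r)\<^sup>2 / (nrm g)\<^sup>2 \<le> (nrm f)\<^sup>2"
      using *[of "1 / (nrm g)\<^sup>2"] by simp
    then show ?thesis
      using False by (simp add: field_simps power_mult_distrib)
  qed
  then show ?thesis by (rule power2_le_imp_le) (simp add: nrm_ge0)
qed

lemma ip_null: "f \<in> V \<Longrightarrow> g \<in> V \<Longrightarrow> nrm f = 0 \<Longrightarrow> ip f g = 0"
  using cauchy_schwarz[of f g] by simp

text \<open>No vector space laws are assumed for \<open>lc\<close>, so two expressions for the same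
  combination cannot be rewritten into each other; comparing their inner products is enough for
  statements about norms.\<close>

lemma nrm_cong:
  assumes "f \<in> V" "g \<in> V" "\<And>h. h \<in> V \<Longrightarrow> ip f h = ip g h"
  shows "nrm f = nrm g"
proof -
  have "ip f f = cnj (ip g g)"
    unfolding assms(3)[OF assms(1)] ip_herm[OF assms(1,2)] assms(3)[OF assms(2)] ..
  then show ?thesis by (simp add: nrm_def)
qed

lemma nrm_lc_le:
  assumes "f \<in> V" "g \<in> V"
  shows "nrm (lc a f b g) \<le> cmod a * nrm f + cmod b * nrm g"
proof (rule power2_le_imp_le)
  have "Re (a * cnj b * ip f g) \<le> cmod a * cmod b * (nrm f * nrm g)"
    by (rule order_trans[OF complex_Re_le_cmod])
      (simp add: norm_mult mult_left_mono cauchy_schwarz assms)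
  then show "(nrm (lc a f b g))\<^sup>2 \<le> (cmod a * nrm f + cmod b * nrm g)\<^sup>2"
    by (simp add: nrm_lc_sq assms power2_sum power_mult_distrib algebra_simps)
qed (simp add: nrm_ge0 assms)

lemma dst_ge0: "f \<in> V \<Longrightarrow> g \<in> V \<Longrightarrow> 0 \<le> dst f g"
  by (simp add: dst_def nrm_ge0 lc_in)

lemma dst_sq:
  "f \<in> V \<Longrightarrow> g \<in> V \<Longrightarrow> (dst f g)\<^sup>2 = (nrm f)\<^sup>2 + (nrm g)\<^sup>2 - 2 * Re (ip f g)"
  by (simp add: dst_def nrm_lc_sq)

lemma dst_sym: "f \<in> V \<Longrightarrow> g \<in> V \<Longrightarrow> dst f g = dst g f"
  by (rule power2_eq_imp_eq) (simp_all add: dst_sq dst_ge0 ip_herm[of f g])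

lemma dst_self: "f \<in> V \<Longrightarrow> dst f f = 0"
  using dst_sq[of f f] by (simp add: nrm_sq)

lemma dst_triangle:
  assumes "f \<in> V" "g \<in> V" "h \<in> V"
  shows "dst f h \<le> dst f g + dst g h"
proof -
  have "dst f h = nrm (lc 1 (lc 1 f (-1) g) 1 (lc 1 g (-1) h))"
    unfolding dst_def by (rule nrm_cong) (simp_all add: assms lc_in ip_lc)
  also have "\<dots> \<le> dst f g + dst g h"
    using nrm_lc_le[of "lc 1 f (-1) g" "lc 1 g (-1) h" 1 1] by (simp add: dst_def assms lc_in)
  finally show ?thesis .
qed

lemma ip_diff_le:
  assumes "f \<in> V" "g \<in> V" "h \<in> V"
  shows "cmod (ip f h - ip g h) \<le> dst f g * nrm h"
  using cauchy_schwarz[of "lc 1 f (-1) g" h] by (simp add: assms lc_in ip_lc dst_def)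

lemma nrm_le_dst:
  assumes "f \<in> V" "g \<in> V"
  shows "nrm f \<le> dst f g + nrm g"
proof -
  have "nrm f = nrm (lc 1 (lc 1 f (-1) g) 1 g)"
    by (rule nrm_cong) (simp_all add: assms lc_in ip_lc)
  then show ?thesis
    using nrm_lc_le[of "lc 1 f (-1) g" g 1 1] by (simp add: dst_def assms lc_in)
qed

lemma nrm_diff_le:
  assumes "f \<in> V" "g \<in> V"
  shows "\<bar>nrm f - nrm g\<bar> \<le> dst f g"
  using nrm_le_dst[of f g] nrm_le_dst[of g f] by (simp add: assms dst_sym[of f g])

section \<open>Convergent and Cauchy sequences\<close>

definition lim_to :: "(nat \<Rightarrow> 'v) \<Rightarrow> 'v \<Rightarrow> bool" where
  "lim_to s f \<longleftrightarrow> (\<lambda>k. dst (s k) f) \<longlonglongrightarrow> 0"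

definition cauchy_seq :: "(nat \<Rightarrow> 'v) \<Rightarrow> bool" where
  "cauchy_seq s \<longleftrightarrow> (\<forall>e>0. \<exists>N. \<forall>j\<ge>N. \<forall>k\<ge>N. dst (s j) (s k) < e)"

lemma lim_to_ip_left:
  assumes "\<And>k. s k \<in> V" "f \<in> V" "h \<in> V" "lim_to s f"
  shows "(\<lambda>k. ip (s k) h) \<longlonglongrightarrow> ip f h"
proof (rule Lim_null_comparison[THEN LIM_zero_cancel])
  show "\<forall>\<^sub>F k in sequentially. cmod (ip (s k) h - ip f h) \<le> dst (s k) f * nrm h"
    by (simp add: ip_diff_le assms)
  show "(\<lambda>k. dst (s k) f * nrm h) \<longlonglongrightarrow> 0"
    using assms(4) by (simp add: lim_to_def tendsto_mult_left_zero)
qed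

lemma lim_to_ip_right:
  assumes "\<And>k. s k \<in> V" "f \<in> V" "h \<in> V" "lim_to s f"
  shows "(\<lambda>k. ip h (s k)) \<longlonglongrightarrow> ip h f"
  using tendsto_cnj[OF lim_to_ip_left[OF assms]]
  by (simp add: ip_herm[symmetric] assms)

lemma lim_to_nrm:
  assumes "\<And>k. s k \<in> V" "f \<in> V" "lim_to s f"
  shows "(\<lambda>k. nrm (s k)) \<longlonglongrightarrow> nrm f"
proof (rule Lim_null_comparison[THEN LIM_zero_cancel])
  show "\<forall>\<^sub>F k in sequentially. norm (nrm (s k) - nrm f) \<le> dst (s k) f"
    by (simp add: nrm_diff_le assms)
qed (use assms(3) in \<open>simp add: lim_to_def\<close>)

lemma lim_to_cauchy:
  assumes s: "\<And>k. s k \<in> V" and f: "f \<in> V" and l: "lim_to s f"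
  shows "cauchy_seq s"
  unfolding cauchy_seq_def
proof (intro allI impI)
  fix e :: real assume "e > 0"
  then obtain N where N: "\<And>k. k \<ge> N \<Longrightarrow> dst (s k) f < e / 2"
    using l[unfolded lim_to_def, THEN LIMSEQ_D, of "e/2"] by (auto simp: dst_ge0 s f)
  have "dst (s j) (s k) < e" if "j \<ge> N" "k \<ge> N" for j k
    using dst_triangle[of "s j" f "s k"] N[OF that(1)] N[OF that(2)] by (simp add: s f dst_sym)
  then show "\<exists>N. \<forall>j\<ge>N. \<forall>k\<ge>N. dst (s j) (s k) < e" by blast
qed

text \<open>
  A minimising sequence of \<open>\<parallel>s\<parallel>\<^sup>2 - 2 Re (\<phi> s)\<close> is Cauchy by the parallelogram identity and
  represents \<open>\<phi>\<close> in the limit.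
\<close>

lemma riesz_sequence:
  assumes S: "S \<subseteq> V" "S \<noteq> {}" "\<And>a b s t. s \<in> S \<Longrightarrow> t \<in> S \<Longrightarrow> lc a s b t \<in> S"
    and lin: "\<And>a b s t. s \<in> S \<Longrightarrow> t \<in> S \<Longrightarrow> \<phi> (lc a s b t) = a * \<phi> s + b * \<phi> t"
    and bd: "\<And>s. s \<in> S \<Longrightarrow> cmod (\<phi> s) \<le> C * nrm s"
  shows "\<exists>u. (\<forall>k. u k \<in> S) \<and> cauchy_seq u \<and> (\<forall>s\<in>S. (\<lambda>k. ip s (u k)) \<longlonglongrightarrow> \<phi> s)"
proof -
  have SV: "s \<in> V" if "s \<in> S" for s using S that by blast
  define J where "J s = (nrm s)\<^sup>2 - 2 * Re (\<phi> s)" for s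
  \<comment> \<open>Completing the square in \<open>nrm s\<close>.\<close>
  have Jbd: "- C\<^sup>2 \<le> J s" if "s \<in> S" for s
  proof -
    have "Re (\<phi> s) \<le> C * nrm s" using bd[OF that] complex_Re_le_cmod order_trans by blast
    moreover have "0 \<le> (nrm s - C)\<^sup>2" by simp
    ultimately show ?thesis by (simp add: J_def power2_diff mult.commute)
  qed
  have bb: "bdd_below (J ` S)" using Jbd by (auto intro!: bdd_belowI[of _ "- C\<^sup>2"])
  define d where "d = Inf (J ` S)"
  have dle: "d \<le> J s" if "s \<in> S" for s unfolding d_def by (rule cInf_lower) (use that bb in auto)
  have "\<exists>s\<in>S. J s < d + 1 / real (Suc k)" for k
    using cInf_lessD[of "J ` S" "d + 1 / real (Suc k)"] S(2) unfolding d_def by auto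
  then obtain u where u: "\<And>k. u k \<in> S" and Ju: "\<And>k. J (u k) < d + 1 / real (Suc k)" by metis
  \<comment> \<open>The parallelogram identity for the midpoint \<open>?m\<close>: the terms in
    \<phi> cancel, and \<open>d \<le> J ?m\<close> leaves only the excess of \<open>J (u j)\<close>
    and \<open>J (u k)\<close> over d.\<close>
  have par: "(dst (u j) (u k))\<^sup>2 \<le> 2 / real (Suc j) + 2 / real (Suc k)" for j k
  proof -
    let ?m = "lc (1/2) (u j) (1/2) (u k)"
    have "(dst (u j) (u k))\<^sup>2 = 2 * J (u j) + 2 * J (u k) - 4 * J ?m"
      by (simp add: dst_sq SV u J_def nrm_lc_sq lin power_divide field_simps)
    then show ?thesis using Ju[of j] Ju[of k] dle[OF S(3)[OF u u], of "1/2" j "1/2" k] by argo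
  qed
  have "cauchy_seq u" unfolding cauchy_seq_def
  proof (intro allI impI)
    fix e :: real assume e: "e > 0"
    obtain N where N: "4 / e\<^sup>2 < real (Suc N)" using reals_Archimedean2 less_trans by (metis of_nat_less_iff lessI)
    have "dst (u j) (u k) < e" if "j \<ge> N" "k \<ge> N" for j k
    proof -
      have "2 / real (Suc i) < e\<^sup>2 / 2" if "i \<ge> N" for i
      proof -
        have "4 / e\<^sup>2 < real (Suc i)" using N that by simp
        then show ?thesis using e by (simp add: field_simps)
      qed
      from this[OF that(1)] this[OF that(2)] par[of j k] have "(dst (u j) (u k))\<^sup>2 < e\<^sup>2" by linarith
      then show ?thesis using e by (simp add: power2_less_imp_less)
    qed
    then show "\<exists>N. \<forall>j\<ge>N. \<forall>k\<ge>N. dst (u j) (u k) < e" by blast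
  qed
  moreover have "(\<lambda>k. ip s (u k)) \<longlonglongrightarrow> \<phi> s" if s: "s \<in> S" for s
  proof -
    \<comment> \<open>The added 1 keeps B positive when s has norm zero.\<close>
    define B where "B = (nrm s)\<^sup>2 + 1"
    have B: "B > 0" unfolding B_def by (simp add: add_nonneg_pos)
    have est: "(cmod (ip s (u k) - \<phi> s))\<^sup>2 \<le> B / real (Suc k)" for k
    proof -
      define r where "r = ip s (u k) - \<phi> s"
      \<comment> \<open>With B equal to the squared norm of s this would minimise J along u k + c s;
        the slightly larger B still gives a decrease of at least |r|^2 / B.\<close>
      define c where "c = - cnj r / of_real B"
      have "d \<le> J (lc 1 (u k) c s)" by (intro dle S(3) u s)
      also have "\<dots> = J (u k) + (cmod c)\<^sup>2 * (nrm s)\<^sup>2 + 2 * Re (cnj (c * ip s (u k))) - 2 * Re (c * \<phi> s)"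
        by (simp add: J_def nrm_lc_sq SV u s lin ip_herm[of s "u k"])
      also have "\<dots> = J (u k) + (cmod c)\<^sup>2 * (nrm s)\<^sup>2 + 2 * Re (c * r)"
        by (simp add: r_def algebra_simps)
      also have "c * r = - of_real ((cmod r)\<^sup>2 / B)"
        unfolding c_def by (simp add: complex_norm_square mult.commute del: of_real_power)
      also have "(cmod c)\<^sup>2 * (nrm s)\<^sup>2 \<le> (cmod r)\<^sup>2 / B"
      proof -
        have "(cmod c)\<^sup>2 = (cmod r)\<^sup>2 / B\<^sup>2" using B by (simp add: c_def norm_divide power_divide)
        moreover have "(nrm s)\<^sup>2 \<le> B" by (simp add: B_def)
        ultimately have "(cmod c)\<^sup>2 * (nrm s)\<^sup>2 \<le> (cmod r)\<^sup>2 / B\<^sup>2 * B"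
          by (metis mult_left_mono zero_le_divide_iff zero_le_power2)
        also have "\<dots> = (cmod r)\<^sup>2 / B" using B by (simp add: power2_eq_square)
        finally show ?thesis .
      qed
      finally have "d \<le> J (u k) - (cmod r)\<^sup>2 / B" by simp
      with Ju[of k] have "(cmod r)\<^sup>2 / B \<le> 1 / real (Suc k)" by linarith
      then show ?thesis using B by (simp add: r_def field_simps)
    qed
    have "(\<lambda>k. (cmod (ip s (u k) - \<phi> s))\<^sup>2) \<longlonglongrightarrow> 0"
    proof (rule Lim_null_comparison)
      show "\<forall>\<^sub>F k in sequentially. norm ((cmod (ip s (u k) - \<phi> s))\<^sup>2) \<le> B / real (Suc k)"
        using est by simp
      show "(\<lambda>k. B / real (Suc k)) \<longlonglongrightarrow> 0"
        using LIMSEQ_Suc[OF lim_const_over_n[of B]] by simp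
    qed
    then have "(\<lambda>k. cmod (ip s (u k) - \<phi> s)) \<longlonglongrightarrow> 0"
      using tendsto_real_sqrt[of "\<lambda>k. (cmod (ip s (u k) - \<phi> s))\<^sup>2" 0] by simp
    then show ?thesis by (simp add: tendsto_norm_zero_iff LIM_zero_iff)
  qed
  ultimately show ?thesis using u by blast
qed

end

section \<open>Completeness: Riesz representation and density of total families\<close>

locale semi_hilbert = semi_ip +
  assumes complete: "(\<And>k. s k \<in> V) \<Longrightarrow> cauchy_seq s \<Longrightarrow> \<exists>f\<in>V. lim_to s f"
begin

lemma riesz:
  assumes "V \<noteq> {}" and "\<And>a b s t. s \<in> V \<Longrightarrow> t \<in> V \<Longrightarrow> \<phi> (lc a s b t) = a * \<phi> s + b * \<phi> t"
    and "\<And>s. s \<in> V \<Longrightarrow> cmod (\<phi> s) \<le> C * nrm s"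
  shows "\<exists>h\<in>V. \<forall>f\<in>V. \<phi> f = ip f h"
proof -
  have "\<exists>u. (\<forall>k. u k \<in> V) \<and> cauchy_seq u \<and> (\<forall>s\<in>V. (\<lambda>k. ip s (u k)) \<longlonglongrightarrow> \<phi> s)"
    by (rule riesz_sequence[OF _ assms(1) _ assms(2,3)]) (auto intro!: lc_in)
  then obtain u where "\<forall>k. u k \<in> V" "cauchy_seq u"
    "\<forall>s\<in>V. (\<lambda>k. ip s (u k)) \<longlonglongrightarrow> \<phi> s" by (elim exE conjE)
  then have u: "\<And>k. u k \<in> V" "cauchy_seq u"
    "\<And>s. s \<in> V \<Longrightarrow> (\<lambda>k. ip s (u k)) \<longlonglongrightarrow> \<phi> s" by simp_all
  obtain h where h: "h \<in> V" "lim_to u h" using complete[OF u(1,2)] by blast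
  have "\<phi> f = ip f h" if "f \<in> V" for f
    by (rule LIMSEQ_unique[OF u(3)[OF that] lim_to_ip_right[OF u(1) h(1) that h(2)]])
  with h show ?thesis by blast
qed

text \<open>The Riesz sequence of <., v> inside S converges to some p with the same inner products
  against S as v, that is, to the projection of v onto the closure of S; totality then puts p at
  distance 0 from v.\<close>

lemma total_dense:
  assumes S: "S \<subseteq> V" "S \<noteq> {}" "\<And>a b s t. s \<in> S \<Longrightarrow> t \<in> S \<Longrightarrow> lc a s b t \<in> S"
    and tot: "\<And>v. v \<in> V \<Longrightarrow> (\<And>s. s \<in> S \<Longrightarrow> ip v s = 0) \<Longrightarrow> nrm v = 0"
    and v: "v \<in> V"
  shows "\<exists>u. (\<forall>k. u k \<in> S) \<and> lim_to u v"
proof -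
  have SV: "s \<in> V" if "s \<in> S" for s using S that by blast
  have "\<exists>u. (\<forall>k. u k \<in> S) \<and> cauchy_seq u \<and> (\<forall>s\<in>S. (\<lambda>k. ip s (u k)) \<longlonglongrightarrow> ip s v)"
    by (rule riesz_sequence[OF S, of _ "nrm v"])
      (use cauchy_schwarz[OF _ v] in \<open>auto simp: ip_lc SV v mult.commute\<close>)
  then obtain u where "\<forall>k. u k \<in> S" "cauchy_seq u"
    "\<forall>s\<in>S. (\<lambda>k. ip s (u k)) \<longlonglongrightarrow> ip s v" by (elim exE conjE)
  then have u: "\<And>k. u k \<in> S" "cauchy_seq u"
    "\<And>s. s \<in> S \<Longrightarrow> (\<lambda>k. ip s (u k)) \<longlonglongrightarrow> ip s v" by simp_all
  have uV: "u k \<in> V" for k by (rule SV[OF u(1)])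
  obtain p where p: "p \<in> V" "lim_to u p" using complete[OF uV u(2)] by blast
  have "ip s p = ip s v" if "s \<in> S" for s
    by (rule LIMSEQ_unique[OF lim_to_ip_right[OF uV p(1) SV[OF that] p(2)] u(3)[OF that]])
  then have "ip (lc 1 p (-1) v) s = 0" if "s \<in> S" for s
    using that by (simp add: ip_lc p v SV ip_herm[of s p] ip_herm[of s v])
  then have "dst p v = 0" unfolding dst_def by (intro tot) (auto simp: lc_in p v)
  then have "dst (u k) v \<le> dst (u k) p" for k
    using dst_triangle[of "u k" p v] by (simp add: uV p v)
  then have "lim_to u v" unfolding lim_to_def
    by (intro Lim_null_comparison[OF _ p(2)[unfolded lim_to_def]]) (simp add: dst_ge0 uV v)
  with u(1) show ?thesis by (intro exI[of _ u]) simp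
qed

end

text \<open>The combination is a parameter so that the same closure also applies to pairs, combined
  componentwise.\<close>

inductive lin_span :: "('c \<Rightarrow> 'v \<Rightarrow> 'c \<Rightarrow> 'v \<Rightarrow> 'v) \<Rightarrow> 'v set \<Rightarrow> 'v \<Rightarrow> bool"
  for lc :: "'c \<Rightarrow> 'v \<Rightarrow> 'c \<Rightarrow> 'v \<Rightarrow> 'v" and S where
  base: "s \<in> S \<Longrightarrow> lin_span lc S s"
| comb: "lin_span lc S s \<Longrightarrow> lin_span lc S t \<Longrightarrow> lin_span lc S (lc a s b t)"

lemma (in semi_ip) lin_span_in:
  assumes "lin_span lc S s" "S \<subseteq> V" shows "s \<in> V"
  using assms by (induction rule: lin_span.induct) (auto intro!: lc_in)

lemma (in semi_hilbert) span_dense: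
  assumes "S \<subseteq> V" "S \<noteq> {}"
    and "\<And>v. v \<in> V \<Longrightarrow> (\<And>s. s \<in> S \<Longrightarrow> ip v s = 0) \<Longrightarrow> nrm v = 0" and "v \<in> V"
  shows "\<exists>u. (\<forall>k. lin_span lc S (u k)) \<and> lim_to u v"
proof -
  have "\<exists>u. (\<forall>k. u k \<in> Collect (lin_span lc S)) \<and> lim_to u v"
  proof (rule total_dense)
    show "Collect (lin_span lc S) \<subseteq> V" using lin_span_in assms(1) by blast
    show "Collect (lin_span lc S) \<noteq> {}" using lin_span.base[of _ S lc] assms(2) by auto
    show "nrm v = 0" if "v \<in> V" "\<And>s. s \<in> Collect (lin_span lc S) \<Longrightarrow> ip v s = 0" for v
      using assms(3)[OF that(1)] that(2) lin_span.base[of _ S lc] by simp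
  qed (use assms(4) lin_span.comb[of lc S] in auto)
  then show ?thesis by simp
qed

text \<open>Two total families with the same Gram matrix determine a unitary correspondence.\<close>

locale gram_pair =
  H1: semi_hilbert V1 lc1 ip1 + H2: semi_hilbert V2 lc2 ip2
  for V1 :: "'v set" and lc1 ip1 and V2 :: "'w set" and lc2 ip2 +
  fixes R :: "'i \<Rightarrow> 'v" and G :: "'i \<Rightarrow> 'w"
  assumes R_in: "R i \<in> V1" and G_in: "G i \<in> V2"
    and gram: "ip1 (R i) (R j) = ip2 (G i) (G j)"
    and R_total: "v \<in> V1 \<Longrightarrow> (\<And>i. ip1 v (R i) = 0) \<Longrightarrow> H1.nrm v = 0"
begin

text \<open>Coefficients against G determine w only up to a vector of norm 0, hence a relation and
  not a function.\<close>

definition matched :: "'v \<Rightarrow> 'w \<Rightarrow> bool" where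
  "matched v w \<longleftrightarrow> v \<in> V1 \<and> w \<in> V2 \<and> (\<forall>i. ip2 w (G i) = ip1 v (R i))"

abbreviation lcp where "lcp a p b q \<equiv> (lc1 a (fst p) b (fst q), lc2 a (snd p) b (snd q))"

text \<open>Combinations of the \<open>R i\<close> are carried along with the same combinations of
  the \<open>G i\<close>, so the correspondence on spans needs no proof that it is well
  defined.\<close>

abbreviation pairs where "pairs \<equiv> lin_span lcp (range (\<lambda>i. (R i, G i)))"

lemma pairs_in: "pairs p \<Longrightarrow> fst p \<in> V1 \<and> snd p \<in> V2"
  by (induction rule: lin_span.induct) (auto simp: R_in G_in intro!: H1.lc_in H2.lc_in)

lemma pairs_matched_ip:
  assumes "pairs p" "matched v w"
  shows "ip1 (fst p) v = ip2 (snd p) w"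
  using assms(1)
proof (induction rule: lin_span.induct)
  case (base p)
  then show ?case
    using assms(2) by (auto simp: matched_def H1.ip_herm[of v "R _"] H2.ip_herm[of w "G _"] R_in G_in)
next
  case (comb p q a b)
  then show ?case
    using pairs_in[of p] pairs_in[of q] assms(2) by (auto simp: matched_def H1.ip_lc H2.ip_lc)
qed

lemma matched_lc:
  "matched v w \<Longrightarrow> matched v' w' \<Longrightarrow> matched (lc1 a v b v') (lc2 a w b w')"
  by (simp add: matched_def H1.ip_lc H2.ip_lc H1.lc_in H2.lc_in R_in G_in)

lemma matched_RG: "matched (R i) (G i)"
  by (simp add: matched_def R_in G_in gram)

lemma pairs_matched: "pairs p \<Longrightarrow> matched (fst p) (snd p)"
  by (induction rule: lin_span.induct) (auto simp: matched_RG intro!: matched_lc)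

lemma pairs_fst:
  assumes "lin_span lc1 (range R) s" shows "\<exists>t. pairs (s, t)"
  using assms
proof (induction rule: lin_span.induct)
  case (base s)
  then show ?case by (auto intro!: lin_span.base)
next
  case (comb s s' a b)
  then obtain t t' where "pairs (s, t)" "pairs (s', t')" by auto
  from lin_span.comb[OF this, of a b] show ?case by auto
qed

lemma approx:
  assumes v: "v \<in> V1"
  shows "\<exists>s t. (\<forall>k. pairs (s k, t k)) \<and> H1.lim_to s v"
proof -
  have "\<exists>s. (\<forall>k. lin_span lc1 (range R) (s k)) \<and> H1.lim_to s v"
    by (rule H1.span_dense) (auto simp: R_in v intro: R_total)
  then obtain s where s: "\<forall>k. lin_span lc1 (range R) (s k)" "H1.lim_to s v" by auto
  have "\<forall>k. \<exists>t. pairs (s k, t)" using s(1) pairs_fst by simp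
  then obtain t where "\<forall>k. pairs (s k, t k)" by (rule choice[THEN exE])
  with s(2) show ?thesis by (intro exI[of _ s] exI[of _ t]) simp
qed

lemma pairs_dst:
  assumes "pairs (s, t)" "pairs (s', t')"
  shows "H1.dst s s' = H2.dst t t'"
proof -
  have p: "pairs (lc1 1 s (-1) s', lc2 1 t (-1) t')"
    using lin_span.comb[OF assms, of 1 "-1"] by simp
  from pairs_matched_ip[OF p, OF pairs_matched[OF p]] show ?thesis
    by (simp add: H1.dst_def H2.dst_def H1.nrm_def H2.nrm_def)
qed

text \<open>Approximants of v come with partners that form a Cauchy sequence by
  \<open>pairs_dst\<close>; w is its limit. The inner product identity is recorded together with
  existence because, as long as G is not known to be total, another partner of v may differ from w
  by a vector orthogonal to all \<open>G i\<close>.\<close>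

lemma matched_exists_ip:
  assumes v: "v \<in> V1"
  shows "\<exists>w. matched v w \<and> (\<forall>v' w'. matched v' w' \<longrightarrow> ip1 v v' = ip2 w w')"
proof -
  obtain s t where st: "\<And>k. pairs (s k, t k)" and lim: "H1.lim_to s v" using approx[OF v] by auto
  have sV: "s k \<in> V1" and tV: "t k \<in> V2" for k using pairs_in[OF st] by simp_all
  have "H2.cauchy_seq t"
    using H1.lim_to_cauchy[OF sV v lim] pairs_dst[OF st st]
    by (simp add: H1.cauchy_seq_def H2.cauchy_seq_def)
  from H2.complete[of t, OF tV this] obtain w where w: "w \<in> V2" "H2.lim_to t w" by auto
  have *: "ip1 v v' = ip2 w w'" if m: "matched v' w'" for v' w'
  proof (rule LIMSEQ_unique)
    have V: "v' \<in> V1" "w' \<in> V2" using m by (auto simp: matched_def)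
    show "(\<lambda>k. ip1 (s k) v') \<longlonglongrightarrow> ip1 v v'" by (rule H1.lim_to_ip_left) (simp_all add: sV V v lim)
    show "(\<lambda>k. ip1 (s k) v') \<longlonglongrightarrow> ip2 w w'"
      using H2.lim_to_ip_left[OF tV w(1) V(2) w(2)] pairs_matched_ip[OF st m] by simp
  qed
  then have "matched v w" using v w *[OF matched_RG] by (simp add: matched_def)
  with * show ?thesis by blast
qed

end

locale gram_pair_total = gram_pair +
  assumes G_total: "w \<in> V2 \<Longrightarrow> (\<And>i. ip2 w (G i) = 0) \<Longrightarrow> H2.nrm w = 0"
begin

lemma matched_unique:
  assumes "matched v w" "matched v w'"
  shows "H2.dst w w' = 0"
  unfolding H2.dst_def using assms
  by (intro G_total) (auto simp: matched_def H2.lc_in H2.ip_lc G_in)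

lemma matched_ip:
  assumes m: "matched v w" and m': "matched v' w'"
  shows "ip1 v v' = ip2 w w'"
proof -
  have V: "v \<in> V1" "w \<in> V2" "w' \<in> V2" using m m' by (auto simp: matched_def)
  obtain u where u: "matched v u" "ip1 v v' = ip2 u w'" using matched_exists_ip[OF V(1)] m' by blast
  then have "u \<in> V2" by (simp add: matched_def)
  moreover have "H2.dst u w = 0" using matched_unique[OF u(1) m] .
  ultimately have "ip2 u w' = ip2 w w'"
    using H2.ip_diff_le[OF _ V(2) V(3)] by force
  with u show ?thesis by simp
qed

text \<open>With both families total the hypotheses are symmetric in the two spaces, so existence is
  applied with the roles exchanged.\<close>

lemma matched_exists_rev:
  assumes "w \<in> V2"
  shows "\<exists>v. matched v w"
proof -
  interpret rev: gram_pair V2 lc2 ip2 V1 lc1 ip1 G R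
    by standard (auto simp: R_in G_in gram intro: G_total)
  show ?thesis using rev.matched_exists_ip[OF assms] by (auto simp: matched_def rev.matched_def)
qed

end

section \<open>Hilbert spaces of functions\<close>

definition fun_lc :: "complex \<Rightarrow> ('x \<Rightarrow> complex) \<Rightarrow> complex \<Rightarrow> ('x \<Rightarrow> complex) \<Rightarrow> 'x \<Rightarrow> complex" where
  "fun_lc a f b g = (\<lambda>x. a * f x + b * g x)"

locale hilbert_fun =
  fixes H :: "('x \<Rightarrow> complex) set" and ip :: "'x inner_prod"
  assumes hilbert: "hilbert_space H ip"
begin

lemma zero_in: "(\<lambda>_. 0) \<in> H"
  using hilbert by (simp add: hilbert_space_def)

lemma definite: "f \<in> H \<Longrightarrow> f \<noteq> (\<lambda>_. 0) \<Longrightarrow> 0 < Re (ip f f)"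
  using hilbert unfolding hilbert_space_def by blast

sublocale semi_hilbert H fun_lc ip
proof -
  have lc: "\<And>f g a b. f \<in> H \<Longrightarrow> g \<in> H \<Longrightarrow> fun_lc a f b g \<in> H"
    and lin: "\<And>f g h a b. f \<in> H \<Longrightarrow> g \<in> H \<Longrightarrow> h \<in> H \<Longrightarrow> ip (fun_lc a f b g) h = a * ip f h + b * ip g h"
    and herm: "\<And>f g. f \<in> H \<Longrightarrow> g \<in> H \<Longrightarrow> ip g f = cnj (ip f g)"
    using hilbert unfolding hilbert_space_def fun_lc_def by blast+
  interpret semi_ip H fun_lc ip
  proof
    show "0 \<le> Re (ip f f)" if "f \<in> H" for f
    proof (cases "f = (\<lambda>_. 0)")
      case True
      then show ?thesis using lin[OF that that that, of 0 0] by (simp add: fun_lc_def)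
    next
      case False
      then show ?thesis using definite[OF that] by simp
    qed
  qed (fact lc lin herm)+
  have hn: "hnorm ip (\<lambda>x. f x - g x) = dst f g" for f g
    by (simp add: hnorm_def dst_def nrm_def fun_lc_def)
  have *: "(\<forall>k. s k \<in> H) \<and> (\<forall>\<epsilon>>0. \<exists>N. \<forall>j\<ge>N. \<forall>k\<ge>N. dst (s j) (s k) < \<epsilon>)
      \<longrightarrow> (\<exists>f\<in>H. (\<lambda>k. dst (s k) f) \<longlonglongrightarrow> 0)" for s :: "nat \<Rightarrow> 'x \<Rightarrow> complex"
    using hilbert unfolding hilbert_space_def hn by (elim conjE) (erule spec)
  show "semi_hilbert H fun_lc ip"
  proof
    show "\<exists>f\<in>H. lim_to s f" if "\<And>k. s k \<in> H" "cauchy_seq s" for s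
      using * that by (simp add: lim_to_def cauchy_seq_def)
  qed
qed

lemma hnorm_nrm: "hnorm ip = nrm"
  by (simp add: fun_eq_iff hnorm_def nrm_def)

lemma hnorm_diff: "hnorm ip (\<lambda>x. f x - g x) = dst f g"
  by (simp add: hnorm_def dst_def nrm_def fun_lc_def)

lemma nrm_eq_0: "f \<in> H \<Longrightarrow> nrm f = 0 \<Longrightarrow> f = (\<lambda>_. 0)"
  using definite[of f] by (auto simp: nrm_def)

lemma dst_eq_0:
  assumes "f \<in> H" "g \<in> H" "dst f g = 0" shows "f = g"
proof -
  have "fun_lc 1 f (-1) g = (\<lambda>_. 0)"
    using nrm_eq_0[of "fun_lc 1 f (-1) g"] assms by (simp add: dst_def lc_in)
  then show ?thesis by (auto simp: fun_lc_def fun_eq_iff)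
qed

lemma ip_eqI:
  assumes "f \<in> H" "g \<in> H" "\<And>h. h \<in> H \<Longrightarrow> ip f h = ip g h"
  shows "f = g"
proof (rule dst_eq_0[OF assms(1,2)])
  have "ip (fun_lc 1 f (-1) g) (fun_lc 1 f (-1) g) = 0"
    using assms(3)[of "fun_lc 1 f (-1) g"] assms(1,2) by (simp add: ip_lc lc_in)
  then show "dst f g = 0" by (simp add: dst_def nrm_def)
qed

text \<open>Zorn's lemma: a vector orthogonal to a maximal orthonormal set would, once normalised,
  enlarge it. Existence is what gives the choice \<open>some_onb\<close> its properties.\<close>

lemma onb_exists: "\<exists>E. onb H ip E"
proof -
  define \<A> where "\<A> = {E. E \<subseteq> H \<and> (\<forall>e\<in>E. \<forall>e'\<in>E. ip e e' = (if e = e' then 1 else 0))}"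
  have "\<exists>M\<in>\<A>. \<forall>X\<in>\<A>. M \<subseteq> X \<longrightarrow> X = M"
  proof (rule subset_Zorn')
    fix C assume C: "subset.chain \<A> C"
    have *: "\<exists>E\<in>C. e \<in> E \<and> e' \<in> E" if "e \<in> \<Union>C" "e' \<in> \<Union>C" for e e'
      using C that unfolding subset_chain_def by blast
    show "\<Union>C \<in> \<A>"
      unfolding \<A>_def mem_Collect_eq
    proof (intro conjI ballI)
      show "\<Union>C \<subseteq> H" using C by (auto simp: subset_chain_def \<A>_def)
      fix e e' assume "e \<in> \<Union>C" "e' \<in> \<Union>C"
      then obtain E where "E \<in> C" "e \<in> E" "e' \<in> E" using * by meson
      moreover have "E \<in> \<A>" using C \<open>E \<in> C\<close> by (auto simp: subset_chain_def)
      ultimately show "ip e e' = (if e = e' then 1 else 0)" by (simp add: \<A>_def)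
    qed
  qed
  then obtain M where M: "M \<in> \<A>" "\<And>X. X \<in> \<A> \<Longrightarrow> M \<subseteq> X \<Longrightarrow> X = M" by auto
  have "f = (\<lambda>_. 0)" if f: "f \<in> H" and orth: "\<forall>e\<in>M. ip f e = 0" for f
  proof (rule ccontr)
    assume nz: "f \<noteq> (\<lambda>_. 0)"
    then have "nrm f > 0" using definite[OF f] by (simp add: nrm_def)
    define g where "g = fun_lc (of_real (1 / nrm f)) f 0 f"
    have g: "g \<in> H" by (simp add: g_def lc_in f)
    have ipg: "ip g h = of_real (1 / nrm f) * ip f h" if "h \<in> H" for h
      by (simp add: g_def ip_lc f that)
    have gg: "ip g g = 1"
    proof -
      have "ip f g = of_real (1 / nrm f) * ip f f"
        by (simp add: g_def ip_lc_right f)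
      then show ?thesis
        using \<open>nrm f > 0\<close> by (simp add: ipg[OF g] ip_self[OF f] power2_eq_square)
    qed
    have gM: "ip g e = 0" "ip e g = 0" if "e \<in> M" for e
    proof -
      have "e \<in> H" using M(1) that by (auto simp: \<A>_def)
      then show "ip g e = 0" using orth that by (simp add: ipg)
      then show "ip e g = 0" using ip_herm[OF g \<open>e \<in> H\<close>] by simp
    qed
    have "insert g M \<in> \<A>"
      using M(1) g gg gM by (auto simp: \<A>_def)
    then have "g \<in> M" using M(2) by blast
    then show False using gM(1) gg by force
  qed
  then have "onb H ip M" using M(1) by (auto simp: onb_def \<A>_def)
  then show ?thesis by (rule exI)
qed

section \<open>Expansion in an orthonormal basis\<close>

abbreviation E where "E \<equiv> some_onb H ip"

lemma onb_E: "onb H ip E"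
  unfolding some_onb_def using onb_exists by (rule someI_ex)

lemma E_in: "e \<in> E \<Longrightarrow> e \<in> H" using onb_E by (auto simp: onb_def)

lemma E_ip: "e \<in> E \<Longrightarrow> e' \<in> E \<Longrightarrow> ip e e' = (if e = e' then 1 else 0)"
  using onb_E by (simp add: onb_def)

lemma E_total: "f \<in> H \<Longrightarrow> (\<And>e. e \<in> E \<Longrightarrow> ip f e = 0) \<Longrightarrow> f = (\<lambda>_. 0)"
  using onb_E by (simp add: onb_def)

text \<open>Vectors are built from binary combinations only, so a finite sum is described by its
  inner products.\<close>

lemma finite_comb:
  assumes "finite F" "F \<subseteq> E"
  shows "\<exists>p\<in>H. \<forall>h\<in>H. ip p h = (\<Sum>e\<in>F. c e * ip e h)"
  using assms
proof (induction F rule: finite_induct)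
  case empty
  show ?case
    using ip_null[OF zero_in] nrm_def ip_lc[OF zero_in zero_in zero_in, of 0 0]
    by (intro bexI[OF _ zero_in]) (simp add: fun_lc_def)
next
  case (insert e F)
  then obtain p where p: "p \<in> H" "\<forall>h\<in>H. ip p h = (\<Sum>e\<in>F. c e * ip e h)" by auto
  have "e \<in> H" using insert.prems E_in by auto
  then show ?case
    using insert.hyps p by (intro bexI[of _ "fun_lc (c e) e 1 p"]) (auto simp: ip_lc lc_in)
qed

text \<open>p is the orthogonal projection of g onto the span of F, and the norm bound is
  \<open>0 \<le> (dst p g)\<^sup>2\<close>.\<close>

lemma proj_exists:
  assumes F: "finite F" "F \<subseteq> E" and g: "g \<in> H"
  shows "\<exists>p\<in>H. (\<forall>h\<in>H. ip p h = (\<Sum>e\<in>F. ip g e * ip e h)) \<and> nrm p \<le> nrm g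
    \<and> (\<Sum>e\<in>F. (cmod (ip g e))\<^sup>2) = (nrm p)\<^sup>2"
proof -
  obtain p where p: "p \<in> H" "\<And>h. h \<in> H \<Longrightarrow> ip p h = (\<Sum>e\<in>F. ip g e * ip e h)"
    using finite_comb[OF F, of "ip g"] by auto
  have FH: "e \<in> H" if "e \<in> F" for e using F E_in that by auto
  have pe: "ip p e = ip g e" if "e \<in> F" for e
  proof -
    have "ip p e = (\<Sum>e'\<in>F. ip g e' * ip e' e)" using p FH that by simp
    also have "\<dots> = (\<Sum>e'\<in>F. if e' = e then ip g e else 0)"
      using F that by (intro sum.cong) (auto simp: E_ip subset_iff)
    finally show ?thesis using F that by simp
  qed
  have "ip p p = (\<Sum>e\<in>F. ip g e * ip e p)" using p by simp
  also have "\<dots> = (\<Sum>e\<in>F. of_real ((cmod (ip g e))\<^sup>2))"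
    using FH p(1) pe by (intro sum.cong) (simp_all add: ip_herm[of p] complex_norm_square del: of_real_power)
  finally have pp: "(\<Sum>e\<in>F. (cmod (ip g e))\<^sup>2) = (nrm p)\<^sup>2"
    by (simp add: nrm_sq p(1))
  have "ip p g = (\<Sum>e\<in>F. ip g e * ip e g)" using p g by simp
  also have "\<dots> = (\<Sum>e\<in>F. of_real ((cmod (ip g e))\<^sup>2))"
    using FH g by (intro sum.cong) (simp_all add: ip_herm[of g] complex_norm_square del: of_real_power)
  finally have "Re (ip p g) = (nrm p)\<^sup>2" using pp by simp
  then have "(dst p g)\<^sup>2 = (nrm g)\<^sup>2 - (nrm p)\<^sup>2" by (simp add: dst_sq p(1) g)
  then have "(nrm p)\<^sup>2 \<le> (nrm g)\<^sup>2" using zero_le_power2[of "dst p g"] by linarith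
  then have "nrm p \<le> nrm g" using nrm_ge0[OF g] by (rule power2_le_imp_le)
  with p pp show ?thesis by (intro bexI[OF _ p(1)]) auto
qed

lemma bessel_ip:
  assumes "finite F" "F \<subseteq> E" "g \<in> H" "h \<in> H"
  shows "cmod (\<Sum>e\<in>F. ip g e * ip e h) \<le> nrm g * nrm h"
proof -
  obtain p where "p \<in> H" "ip p h = (\<Sum>e\<in>F. ip g e * ip e h)" "nrm p \<le> nrm g"
    using proj_exists[OF assms(1-3)] assms(4) by auto
  then show ?thesis
    using cauchy_schwarz[of p h] assms(4) nrm_ge0[of h]
    by (metis mult_right_mono order_trans)
qed

lemma parseval_span:
  assumes "lin_span fun_lc E s" "h \<in> H"
  shows "((\<lambda>e. ip s e * ip e h) has_sum ip s h) E"
  using assms(1)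
proof (induction rule: lin_span.induct)
  case (base s)
  have "((\<lambda>e. ip s e * ip e h) has_sum (\<Sum>e\<in>{s}. ip s e * ip e h)) E"
    using base by (intro has_sum_finite_neutralI[of "{s}"]) (auto simp: E_ip)
  then show ?case using base by (simp add: E_ip)
next
  case (comb s t a b)
  have "s \<in> H" "t \<in> H" using comb.hyps lin_span_in E_in by blast+
  moreover have "((\<lambda>e. a * (ip s e * ip e h) + b * (ip t e * ip e h)) has_sum a * ip s h + b * ip t h) E"
    using comb.IH by (intro has_sum_add has_sum_cmult_right)
  ultimately show ?case
    by (subst has_sum_cong[where g = "\<lambda>e. a * (ip s e * ip e h) + b * (ip t e * ip e h)"])
      (auto simp: ip_lc assms(2) E_in algebra_simps)
qed

lemma span_E_dense:
  assumes "f \<in> H" "\<epsilon> > 0" "E \<noteq> {}"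
  shows "\<exists>s. lin_span fun_lc E s \<and> dst s f < \<epsilon>"
proof -
  have "\<exists>u. (\<forall>k. lin_span fun_lc E (u k)) \<and> lim_to u f"
  proof (rule span_dense)
    show "nrm v = 0" if "v \<in> H" "\<And>s. s \<in> E \<Longrightarrow> ip v s = 0" for v
    proof -
      have "v = (\<lambda>_. 0)" using that by (rule E_total)
      then have "ip v v = 0" using ip_lc[OF zero_in zero_in zero_in, of 0 0] by (simp add: fun_lc_def)
      then show ?thesis by (simp add: nrm_def)
    qed
  qed (use assms E_in in auto)
  then obtain u where u: "\<forall>k. lin_span fun_lc E (u k)" "lim_to u f" by (elim exE conjE)
  have uH: "u k \<in> H" for k using u(1) lin_span_in[of E "u k"] E_in by auto
  obtain k where "dst (u k) f < \<epsilon>"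
    using LIMSEQ_D[OF u(2)[unfolded lim_to_def] assms(2)] dst_ge0[OF uH assms(1)] by force
  with u show ?thesis by (intro exI[of _ "u k"]) simp
qed

text \<open>By \<open>bessel_ip\<close> the finite partial sums are continuous in f uniformly in F,
  so the identity passes from the span of E to its closure.\<close>

lemma parseval_ip:
  assumes f: "f \<in> H" and h: "h \<in> H"
  shows "((\<lambda>e. ip f e * ip e h) has_sum ip f h) E"
proof (cases "E = {}")
  \<comment> \<open>The inductive span of the empty set is empty rather than {0}, so the density
    argument needs a nonempty basis.\<close>
  case True
  then have "f = (\<lambda>_. 0)" using E_total[OF f] by blast
  then have "ip f h = 0" using ip_lc[OF f f h, of 0 0] by (simp add: fun_lc_def)
  with True show ?thesis by simp
next
  case False
  show ?thesis unfolding has_sum_def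
  proof (rule tendstoI)
    fix \<epsilon> :: real assume e: "\<epsilon> > 0"
    \<comment> \<open>The added 1 keeps the denominator positive when h has norm zero.\<close>
    define \<delta> where "\<delta> = \<epsilon> / (3 * (nrm h + 1))"
    have nh: "nrm h + 1 > 0" using nrm_ge0[OF h] by simp
    have d: "\<delta> > 0" "\<delta> * nrm h \<le> \<epsilon> / 3" using e nh nrm_ge0[OF h] by (auto simp: \<delta>_def field_simps)
    obtain s where s: "lin_span fun_lc E s" "dst s f < \<delta>" using span_E_dense[OF f d(1) False] by auto
    have sH: "s \<in> H" using s(1) lin_span_in[of E s] E_in by auto
    have dfs: "dst f s < \<delta>" using s(2) dst_sym[OF f sH] by simp
    have "\<forall>\<^sub>F F in finite_subsets_at_top E. dist (\<Sum>e\<in>F. ip s e * ip e h) (ip s h) < \<epsilon> / 3"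
      using parseval_span[OF s(1) h, unfolded has_sum_def] e by (intro tendstoD) auto
    moreover have "\<forall>\<^sub>F F in finite_subsets_at_top E. finite F \<and> F \<subseteq> E"
      by (rule eventually_finite_subsets_at_top_weakI) simp
    ultimately show "\<forall>\<^sub>F F in finite_subsets_at_top E. dist (\<Sum>e\<in>F. ip f e * ip e h) (ip f h) < \<epsilon>"
    proof eventually_elim
      case (elim F)
      have FH: "e \<in> H" if "e \<in> F" for e using elim that E_in by auto
      let ?d = "fun_lc 1 f (-1) s"
      have "(\<Sum>e\<in>F. ip ?d e * ip e h) = (\<Sum>e\<in>F. ip f e * ip e h) - (\<Sum>e\<in>F. ip s e * ip e h)"
        using FH by (simp add: ip_lc f sH algebra_simps sum_subtractf)
      then have 1: "cmod ((\<Sum>e\<in>F. ip f e * ip e h) - (\<Sum>e\<in>F. ip s e * ip e h)) \<le> dst f s * nrm h"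
        using bessel_ip[of F ?d h] elim by (simp add: lc_in f sH h dst_def)
      have 2: "cmod (ip s h - ip f h) \<le> dst s f * nrm h" by (simp add: ip_diff_le sH f h)
      have 3: "dst f s * nrm h \<le> \<epsilon> / 3" "dst s f * nrm h \<le> \<epsilon> / 3"
        using d(2) mult_right_mono[of "dst f s" \<delta> "nrm h"] mult_right_mono[of "dst s f" \<delta> "nrm h"]
          dfs s(2) nrm_ge0[OF h] by auto
      have "cmod ((\<Sum>e\<in>F. ip f e * ip e h) - ip f h)
        \<le> cmod ((\<Sum>e\<in>F. ip f e * ip e h) - (\<Sum>e\<in>F. ip s e * ip e h))
          + cmod ((\<Sum>e\<in>F. ip s e * ip e h) - ip s h) + cmod (ip s h - ip f h)"
        using norm_triangle_ineq[of "(\<Sum>e\<in>F. ip f e * ip e h) - (\<Sum>e\<in>F. ip s e * ip e h)"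
            "((\<Sum>e\<in>F. ip s e * ip e h) - ip s h) + (ip s h - ip f h)"]
          norm_triangle_ineq[of "(\<Sum>e\<in>F. ip s e * ip e h) - ip s h" "ip s h - ip f h"]
        by simp
      then show ?case using 1 2 3 elim by (simp add: dist_norm)
    qed
  qed
qed

lemma parseval:
  assumes "f \<in> H"
  shows "((\<lambda>e. (cmod (ip f e))\<^sup>2) has_sum (nrm f)\<^sup>2) E"
proof -
  have "((\<lambda>e. Re (ip f e * ip e f)) has_sum Re (ip f f)) E"
    by (rule has_sum_Re[OF parseval_ip[OF assms assms]])
  moreover have "Re (ip f e * ip e f) = (cmod (ip f e))\<^sup>2" if "e \<in> E" for e
    using E_in[OF that] assms
    by (metis Re_complex_of_real complex_norm_square ip_herm)
  ultimately show ?thesis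
    unfolding nrm_sq[OF assms]
    by (subst has_sum_cong[of E _ "\<lambda>e. Re (ip f e * ip e f)"]) simp_all
qed

end

section \<open>Operators\<close>

context hilbert_fun
begin

section \<open>Bounded operators and adjoints\<close>

lemma bounded_opD:
  assumes "bounded_op H ip A"
  shows op_in: "f \<in> H \<Longrightarrow> A f \<in> H"
    and op_lc: "f \<in> H \<Longrightarrow> g \<in> H \<Longrightarrow> A (fun_lc a f b g) = fun_lc a (A f) b (A g)"
    and op_ext: "f \<notin> H \<Longrightarrow> A f = undefined"
  using assms by (auto simp: bounded_op_def linear_op_def fun_lc_def)

lemma bounded_op_bound:
  assumes "bounded_op H ip A"
  shows "\<exists>C\<ge>0. \<forall>f\<in>H. nrm (A f) \<le> C * nrm f"
proof -
  obtain C where C: "\<forall>f\<in>H. nrm (A f) \<le> C * nrm f"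
    using assms by (auto simp: bounded_op_def hnorm_nrm)
  have "nrm (A f) \<le> \<bar>C\<bar> * nrm f" if "f \<in> H" for f
    using C that nrm_ge0[OF that] mult_right_mono[of C "\<bar>C\<bar>" "nrm f"] by force
  then show ?thesis by (intro exI[of _ "\<bar>C\<bar>"]) auto
qed

lemma bounded_opI:
  assumes "\<And>f. f \<in> H \<Longrightarrow> A f \<in> H" "\<And>f. f \<notin> H \<Longrightarrow> A f = undefined"
    and "\<And>a f b g. f \<in> H \<Longrightarrow> g \<in> H \<Longrightarrow> A (fun_lc a f b g) = fun_lc a (A f) b (A g)"
    and "\<And>f. f \<in> H \<Longrightarrow> nrm (A f) \<le> C * nrm f"
  shows "bounded_op H ip A"
proof -
  have "\<exists>C. \<forall>f\<in>H. nrm (A f) \<le> C * nrm f" using assms(4) by blast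
  then show ?thesis
    using assms(1-3) unfolding bounded_op_def linear_op_def fun_lc_def hnorm_nrm
    by (auto simp: PiE_iff extensional_def)
qed

lemma op_eqI:
  assumes "bounded_op H ip A" "bounded_op H ip B"
    and "\<And>f g. f \<in> H \<Longrightarrow> g \<in> H \<Longrightarrow> ip (A f) g = ip (B f) g"
  shows "A = B"
proof
  fix f show "A f = B f"
    using ip_eqI[of "A f" "B f"] op_in[OF assms(1)] op_in[OF assms(2)] assms(3)
      op_ext[OF assms(1)] op_ext[OF assms(2)] by (cases "f \<in> H") auto
qed

text \<open>Riesz representation of f -> <A f, g> for each g. Restriction to H makes the result
  extensional, and its linearity is read off from inner products.\<close>

lemma adjoint_exists:
  assumes A: "bounded_op H ip A"
  shows "\<exists>B. bounded_op H ip B \<and> (\<forall>f\<in>H. \<forall>g\<in>H. ip (A f) g = ip f (B g))"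
proof -
  obtain C where C: "C \<ge> 0" "\<And>f. f \<in> H \<Longrightarrow> nrm (A f) \<le> C * nrm f"
    using bounded_op_bound[OF A] by auto
  note Ain = op_in[OF A]
  have "\<exists>h\<in>H. \<forall>f\<in>H. ip (A f) g = ip f h" if g: "g \<in> H" for g
  proof (rule riesz)
    show "H \<noteq> {}" using zero_in by auto
    show "ip (A (fun_lc a s b t)) g = a * ip (A s) g + b * ip (A t) g" if "s \<in> H" "t \<in> H" for a b s t
      using that g by (simp add: op_lc[OF A] ip_lc Ain)
    show "cmod (ip (A s) g) \<le> (C * nrm g) * nrm s" if "s \<in> H" for s
      using cauchy_schwarz[OF Ain[OF that] g] mult_right_mono[OF C(2)[OF that] nrm_ge0[OF g]]
      by (simp add: mult_ac)
  qed
  then obtain B where B: "\<And>g. g \<in> H \<Longrightarrow> B g \<in> H" "\<And>f g. g \<in> H \<Longrightarrow> f \<in> H \<Longrightarrow> ip (A f) g = ip f (B g)"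
    by metis
  define B' where "B' = restrict B H"
  have B'H: "B' g = B g" if "g \<in> H" for g using that by (simp add: B'_def)
  have ipB: "ip (B g) f = ip g (A f)" if "f \<in> H" "g \<in> H" for f g
    using B(2)[OF that(2,1)] ip_herm[OF that(1) B(1)[OF that(2)]] ip_herm[OF Ain[OF that(1)] that(2)] by simp
  have "bounded_op H ip B'"
  proof (rule bounded_opI[where C = C])
    fix a b f g assume fg: "f \<in> H" "g \<in> H"
    show "B' (fun_lc a f b g) = fun_lc a (B' f) b (B' g)"
      by (rule ip_eqI) (simp_all add: fg B'H lc_in B ipB ip_lc Ain)
  next
    fix g assume g: "g \<in> H"
    \<comment> \<open>Testing <A f, g> = <f, B g> at f = B g bounds B by the constant of A.\<close>
    have "(nrm (B g))\<^sup>2 = Re (ip (A (B g)) g)" by (simp add: nrm_sq B g)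
    also have "\<dots> \<le> nrm (A (B g)) * nrm g"
      using cauchy_schwarz[of "A (B g)" g] complex_Re_le_cmod order_trans by (metis Ain B(1) g)
    also have "\<dots> \<le> C * nrm (B g) * nrm g"
      by (intro mult_right_mono C nrm_ge0 B g)
    finally have "nrm (B g) * nrm (B g) \<le> nrm (B g) * (C * nrm g)"
      by (simp add: power2_eq_square mult_ac)
    then have "nrm (B g) \<le> C * nrm g"
      using nrm_ge0[OF B(1)[OF g]] nrm_ge0[OF g] C(1)
      by (cases "nrm (B g) = 0") (auto simp: mult_le_cancel_left)
    then show "nrm (B' g) \<le> C * nrm g" using g by (simp add: B'H)
  qed (auto simp: B'_def B)
  then show ?thesis using B B'H by (intro exI[of _ B']) auto
qed

abbreviation adj where "adj \<equiv> adjoint_op H ip"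

lemma adjointI:
  assumes B: "bounded_op H ip B" and A: "\<And>f. f \<in> H \<Longrightarrow> A f \<in> H"
    and AB: "\<And>f g. f \<in> H \<Longrightarrow> g \<in> H \<Longrightarrow> ip (A f) g = ip f (B g)"
  shows "adj A = B"
  unfolding adjoint_op_def
proof (rule the_equality)
  fix B' assume *: "bounded_op H ip B' \<and> (\<forall>f\<in>H. \<forall>g\<in>H. ip (A f) g = ip f (B' g))"
  show "B' = B"
  proof (rule op_eqI)
    fix f g assume fg: "f \<in> H" "g \<in> H"
    have "ip g (B' f) = ip g (B f)" using * AB[OF fg(2,1)] fg by metis
    then show "ip (B' f) g = ip (B f) g"
      using ip_herm[of g "B' f"] ip_herm[of g "B f"] fg op_in[OF B] op_in[of B'] * by metis
  qed (use * B in auto)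
qed (use B AB in auto)

lemma adj_bounded: "bounded_op H ip A \<Longrightarrow> bounded_op H ip (adj A)"
  and ip_adj: "bounded_op H ip A \<Longrightarrow> f \<in> H \<Longrightarrow> g \<in> H \<Longrightarrow> ip (A f) g = ip f (adj A g)"
  using adjoint_exists[of A] adjointI[of _ A] op_in[of A] by metis+

lemma ip_adj_left:
  assumes "bounded_op H ip A" "f \<in> H" "g \<in> H"
  shows "ip (adj A f) g = ip f (A g)"
  using ip_adj[OF assms(1) assms(3,2)] ip_herm[OF assms(3) op_in[OF adj_bounded[OF assms(1)] assms(2)]]
    ip_herm[OF op_in[OF assms(1,3)] assms(2)] by simp

lemma adj_adj: "bounded_op H ip A \<Longrightarrow> adj (adj A) = A"
  by (rule adjointI) (auto simp: ip_adj_left op_in adj_bounded)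

lemma compose_bounded:
  assumes A: "bounded_op H ip A" and B: "bounded_op H ip B"
  shows "bounded_op H ip (compose H A B)"
proof -
  obtain C D where C: "C \<ge> 0" "\<And>f. f \<in> H \<Longrightarrow> nrm (A f) \<le> C * nrm f"
    and D: "\<And>f. f \<in> H \<Longrightarrow> nrm (B f) \<le> D * nrm f"
    using bounded_op_bound[OF A] bounded_op_bound[OF B] by metis
  have "nrm (A (B f)) \<le> C * D * nrm f" if "f \<in> H" for f
    using C(2)[OF op_in[OF B that]] mult_left_mono[OF D[OF that] C(1)] by simp
  then show ?thesis
    by (intro bounded_opI[where C = "C * D"])
      (auto simp: compose_def lc_in op_in[OF A] op_in[OF B] op_lc[OF A] op_lc[OF B])
qed

lemma adj_compose:
  assumes A: "bounded_op H ip A" and B: "bounded_op H ip B"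
  shows "adj (compose H A B) = compose H (adj B) (adj A)"
  using assms by (intro adjointI)
    (simp_all add: compose_bounded adj_bounded compose_eq op_in ip_adj)

lemma lincomb_bounded:
  assumes A: "bounded_op H ip A" and B: "bounded_op H ip B"
  shows "bounded_op H ip (lincomb_op H a A b B)"
proof -
  obtain C D where C: "\<And>f. f \<in> H \<Longrightarrow> nrm (A f) \<le> C * nrm f"
    and D: "\<And>f. f \<in> H \<Longrightarrow> nrm (B f) \<le> D * nrm f"
    using bounded_op_bound[OF A] bounded_op_bound[OF B] by metis
  have L: "lincomb_op H a A b B f = fun_lc a (A f) b (B f)" if "f \<in> H" for f
    using that by (simp add: lincomb_op_def fun_lc_def)
  show ?thesis
  proof (rule bounded_opI[where C = "cmod a * C + cmod b * D"])
    fix f assume f: "f \<in> H"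
    have "nrm (fun_lc a (A f) b (B f)) \<le> cmod a * nrm (A f) + cmod b * nrm (B f)"
      by (rule nrm_lc_le) (simp_all add: op_in[OF A] op_in[OF B] f)
    also have "\<dots> \<le> cmod a * (C * nrm f) + cmod b * (D * nrm f)"
      by (intro add_mono mult_left_mono C D f) simp_all
    finally show "nrm (lincomb_op H a A b B f) \<le> (cmod a * C + cmod b * D) * nrm f"
      using f by (simp add: L algebra_simps)
  next
    fix c f d g assume fg: "f \<in> H" "g \<in> H"
    show "lincomb_op H a A b B (fun_lc c f d g) = fun_lc c (lincomb_op H a A b B f) d (lincomb_op H a A b B g)"
      using fg by (simp add: L lc_in op_lc[OF A] op_lc[OF B]) (simp add: fun_lc_def algebra_simps)
  next
    show "lincomb_op H a A b B f \<in> H" if "f \<in> H" for f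
      using that by (simp add: L lc_in op_in[OF A] op_in[OF B])
  qed (simp add: lincomb_op_def)
qed

lemma lincomb_apply: "f \<in> H \<Longrightarrow> lincomb_op H a A b B f = fun_lc a (A f) b (B f)"
  by (simp add: lincomb_op_def fun_lc_def)

subsection \<open>Hilbert-Schmidt operators\<close>

abbreviation HS where "HS \<equiv> hilbert_schmidt H ip"

definition hs_ip :: "'x operator \<Rightarrow> 'x operator \<Rightarrow> complex" where
  "hs_ip A B = (\<Sum>\<^sub>\<infinity>e\<in>E. ip (A e) (B e))"

lemma HS_bounded: "A \<in> HS \<Longrightarrow> bounded_op H ip A"
  by (simp add: hilbert_schmidt_def)

lemma HS_summable: "A \<in> HS \<Longrightarrow> (\<lambda>e. (nrm (A e))\<^sup>2) summable_on E"
  by (simp add: hilbert_schmidt_def hnorm_nrm)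

lemma HS_iff: "A \<in> HS \<longleftrightarrow> bounded_op H ip A \<and> (\<lambda>e. (nrm (A e))\<^sup>2) summable_on E"
  by (simp add: hilbert_schmidt_def hnorm_nrm)

lemma HS_in: "A \<in> HS \<Longrightarrow> f \<in> H \<Longrightarrow> A f \<in> H"
  using HS_bounded op_in by blast

lemma HS_comparison:
  assumes "bounded_op H ip A" "g summable_on E" "\<And>e. e \<in> E \<Longrightarrow> (nrm (A e))\<^sup>2 \<le> g e"
  shows "A \<in> HS"
  using assms unfolding HS_iff by (auto intro: summable_on_comparison_test)

lemma HS_ip_summable:
  assumes A: "A \<in> HS" and B: "B \<in> HS"
  shows "(\<lambda>e. ip (A e) (B e)) summable_on E"
proof -
  have "(\<lambda>e. cmod (ip (A e) (B e))) summable_on E"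
  proof (rule summable_on_comparison_test)
    show "(\<lambda>e. (nrm (A e))\<^sup>2 + (nrm (B e))\<^sup>2) summable_on E"
      by (intro summable_on_add HS_summable A B)
    show "cmod (ip (A e) (B e)) \<le> (nrm (A e))\<^sup>2 + (nrm (B e))\<^sup>2" if "e \<in> E" for e
    proof -
      have "cmod (ip (A e) (B e)) \<le> nrm (A e) * nrm (B e)"
        by (intro cauchy_schwarz HS_in[OF A] HS_in[OF B] E_in that)
      also have "\<dots> \<le> (nrm (A e))\<^sup>2 + (nrm (B e))\<^sup>2"
        using sum_squares_bound[of "nrm (A e)" "nrm (B e)"]
          nrm_ge0[OF HS_in[OF A E_in[OF that]]] nrm_ge0[OF HS_in[OF B E_in[OF that]]]
          mult_nonneg_nonneg[of "nrm (A e)" "nrm (B e)"] by linarith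
      finally show ?thesis .
    qed
  qed simp
  then show ?thesis by (rule abs_summable_summable)
qed

lemma HS_lincomb:
  assumes A: "A \<in> HS" and B: "B \<in> HS"
  shows "lincomb_op H a A b B \<in> HS"
proof (rule HS_comparison)
  show "bounded_op H ip (lincomb_op H a A b B)" by (intro lincomb_bounded HS_bounded A B)
  show "(\<lambda>e. 2 * (cmod a)\<^sup>2 * (nrm (A e))\<^sup>2 + 2 * (cmod b)\<^sup>2 * (nrm (B e))\<^sup>2) summable_on E"
    by (intro summable_on_add summable_on_cmult_right HS_summable A B)
  show "(nrm (lincomb_op H a A b B e))\<^sup>2 \<le> 2 * (cmod a)\<^sup>2 * (nrm (A e))\<^sup>2 + 2 * (cmod b)\<^sup>2 * (nrm (B e))\<^sup>2"
    if e: "e \<in> E" for e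
  proof -
    have "nrm (fun_lc a (A e) b (B e)) \<le> cmod a * nrm (A e) + cmod b * nrm (B e)"
      by (intro nrm_lc_le HS_in[OF A] HS_in[OF B] E_in e)
    then have "(nrm (fun_lc a (A e) b (B e)))\<^sup>2 \<le> (cmod a * nrm (A e) + cmod b * nrm (B e))\<^sup>2"
      by (intro power_mono nrm_ge0 lc_in HS_in[OF A] HS_in[OF B] E_in e)
    also have "\<dots> \<le> 2 * (cmod a * nrm (A e))\<^sup>2 + 2 * (cmod b * nrm (B e))\<^sup>2"
      using sum_squares_bound[of "cmod a * nrm (A e)" "cmod b * nrm (B e)"] by (simp add: power2_sum)
    finally show ?thesis using e by (simp add: lincomb_apply E_in power_mult_distrib)
  qed
qed

lemma hs_ip_has_sum:
  assumes "A \<in> HS" "B \<in> HS"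
  shows "((\<lambda>e. ip (A e) (B e)) has_sum hs_ip A B) E"
  unfolding hs_ip_def by (rule has_sum_infsum[OF HS_ip_summable[OF assms]])

lemma hs_ip_self:
  assumes "A \<in> HS"
  shows "Re (hs_ip A A) = (\<Sum>\<^sub>\<infinity>e\<in>E. (nrm (A e))\<^sup>2)"
proof -
  have "((\<lambda>e. Re (ip (A e) (A e))) has_sum Re (hs_ip A A)) E"
    by (rule has_sum_Re[OF hs_ip_has_sum[OF assms assms]])
  then have "Re (hs_ip A A) = (\<Sum>\<^sub>\<infinity>e\<in>E. Re (ip (A e) (A e)))" by (rule infsumI[symmetric])
  also have "\<dots> = (\<Sum>\<^sub>\<infinity>e\<in>E. (nrm (A e))\<^sup>2)"
    by (intro infsum_cong) (simp add: nrm_sq HS_in[OF assms] E_in)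
  finally show ?thesis .
qed

sublocale hs: semi_ip HS "lincomb_op H" hs_ip
proof
  fix A B C :: "'x operator" and a b
  assume ABC: "A \<in> HS" "B \<in> HS" "C \<in> HS"
  have "((\<lambda>e. a * ip (A e) (C e) + b * ip (B e) (C e)) has_sum a * hs_ip A C + b * hs_ip B C) E"
    by (intro has_sum_add has_sum_cmult_right hs_ip_has_sum ABC)
  then have "(\<Sum>\<^sub>\<infinity>e\<in>E. a * ip (A e) (C e) + b * ip (B e) (C e)) = a * hs_ip A C + b * hs_ip B C"
    by (rule infsumI)
  then show "hs_ip (lincomb_op H a A b B) C = a * hs_ip A C + b * hs_ip B C"
    by (subst hs_ip_def) (simp add: lincomb_apply E_in ip_lc HS_in[OF ABC(1)] HS_in[OF ABC(2)] HS_in[OF ABC(3)] cong: infsum_cong)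
next
  fix A B assume AB: "A \<in> HS" "B \<in> HS"
  have "hs_ip B A = (\<Sum>\<^sub>\<infinity>e\<in>E. cnj (ip (A e) (B e)))"
    unfolding hs_ip_def by (intro infsum_cong ip_herm HS_in[OF AB(1)] HS_in[OF AB(2)] E_in)
  then show "hs_ip B A = cnj (hs_ip A B)" by (simp add: hs_ip_def)
qed (simp_all add: HS_lincomb hs_ip_self infsum_nonneg)

lemma hs_nrm_sq: "A \<in> HS \<Longrightarrow> (hs.nrm A)\<^sup>2 = (\<Sum>\<^sub>\<infinity>e\<in>E. (nrm (A e))\<^sup>2)"
  by (simp add: hs.nrm_sq hs_ip_self)

lemma hs_norm_eq: "A \<in> HS \<Longrightarrow> hs_norm H ip A = hs.nrm A"
  by (simp add: hs_norm_def hnorm_nrm hs.nrm_def hs_ip_self)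

text \<open>The operator |g><f|. A scalar multiple is written \<open>fun_lc a g 0 g\<close> since
  the only linear operation at hand is the binary combination.\<close>

definition rank_one :: "('x \<Rightarrow> complex) \<Rightarrow> ('x \<Rightarrow> complex) \<Rightarrow> 'x operator" where
  "rank_one g f = (\<lambda>h\<in>H. fun_lc (ip h f) g 0 g)"

lemma nrm_scale: "g \<in> H \<Longrightarrow> nrm (fun_lc a g 0 g) = cmod a * nrm g"
  by (rule power2_eq_imp_eq) (simp_all add: nrm_lc_sq lc_in nrm_ge0 power_mult_distrib)

lemma ip_rank_one:
  "f \<in> H \<Longrightarrow> g \<in> H \<Longrightarrow> h \<in> H \<Longrightarrow> k \<in> H \<Longrightarrow> ip (rank_one g f h) k = ip h f * ip g k"
  by (simp add: rank_one_def ip_lc)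

lemma rank_one_bounded:
  assumes f: "f \<in> H" and g: "g \<in> H"
  shows "bounded_op H ip (rank_one g f)"
proof (rule bounded_opI[where C = "nrm f * nrm g"])
  fix h assume h: "h \<in> H"
  show "nrm (rank_one g f h) \<le> nrm f * nrm g * nrm h"
    using mult_right_mono[OF cauchy_schwarz[OF h f] nrm_ge0[OF g]]
    by (simp add: rank_one_def h g nrm_scale mult_ac)
next
  fix a h b k assume "h \<in> H" "k \<in> H"
  then show "rank_one g f (fun_lc a h b k) = fun_lc a (rank_one g f h) b (rank_one g f k)"
    using f by (simp add: rank_one_def lc_in ip_lc) (simp add: fun_lc_def algebra_simps)
qed (use f g in \<open>simp_all add: rank_one_def lc_in\<close>)

lemma rank_one_HS:
  assumes f: "f \<in> H" and g: "g \<in> H"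
  shows "rank_one g f \<in> HS"
proof (rule HS_comparison[OF rank_one_bounded[OF f g]])
  show "(\<lambda>e. (nrm g)\<^sup>2 * (cmod (ip f e))\<^sup>2) summable_on E"
    using parseval[OF f] by (intro summable_on_cmult_right) (auto simp: summable_on_def)
  show "(nrm (rank_one g f e))\<^sup>2 \<le> (nrm g)\<^sup>2 * (cmod (ip f e))\<^sup>2" if e: "e \<in> E" for e
    using E_in[OF e] ip_herm[OF f E_in[OF e]]
    by (simp add: rank_one_def nrm_scale g power_mult_distrib mult.commute)
qed

text \<open>Parseval for f and \<open>adj A g\<close>. Matrix elements of A thus become
  Hilbert-Schmidt inner products.\<close>

lemma hs_ip_rank_one:
  assumes A: "A \<in> HS" and f: "f \<in> H" and g: "g \<in> H"
  shows "hs_ip A (rank_one g f) = ip (A f) g"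
proof -
  have b: "bounded_op H ip A" using A by (rule HS_bounded)
  have "hs_ip A (rank_one g f) = (\<Sum>\<^sub>\<infinity>e\<in>E. ip f e * ip e (adj A g))"
    unfolding hs_ip_def
  proof (rule infsum_cong)
    fix e assume "e \<in> E"
    then have e: "e \<in> H" by (rule E_in)
    have "ip (A e) (rank_one g f e) = cnj (ip e f) * ip (A e) g"
      by (simp add: rank_one_def e f g ip_lc_right HS_in[OF A])
    then show "ip (A e) (rank_one g f e) = ip f e * ip e (adj A g)"
      using ip_herm[OF e f] by (simp add: ip_adj[OF b e g])
  qed
  also have "\<dots> = ip f (adj A g)"
    by (intro infsumI parseval_ip f op_in[OF adj_bounded[OF b]] g)
  finally show ?thesis by (simp add: ip_adj[OF b f g])
qed

lemma hs_nrm_rank_one: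
  assumes f: "f \<in> H" and g: "g \<in> H"
  shows "hs.nrm (rank_one g f) = nrm f * nrm g"
proof (rule power2_eq_imp_eq)
  have "complex_of_real ((hs.nrm (rank_one g f))\<^sup>2) = ip f f * ip g g"
    by (simp only: hs.ip_self[symmetric] rank_one_HS[OF f g] hs_ip_rank_one[OF rank_one_HS[OF f g] f g]
        ip_rank_one[OF f g f g])
  also have "\<dots> = of_real ((nrm f * nrm g)\<^sup>2)"
    by (simp add: ip_self f g power_mult_distrib)
  finally show "(hs.nrm (rank_one g f))\<^sup>2 = (nrm f * nrm g)\<^sup>2" by (simp only: of_real_eq_iff)
qed (simp_all add: hs.nrm_ge0 rank_one_HS f g nrm_ge0)

text \<open>Pairing A with \<open>rank_one (A f) f\<close> gives |A f|^2, which Cauchy-Schwarz in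
  \<open>HS\<close> bounds.\<close>

lemma op_le_hs_nrm:
  assumes A: "A \<in> HS" and f: "f \<in> H"
  shows "nrm (A f) \<le> hs.nrm A * nrm f"
proof -
  have Af: "A f \<in> H" by (rule HS_in[OF A f])
  have "(nrm (A f))\<^sup>2 = cmod (hs_ip A (rank_one (A f) f))"
    by (simp add: hs_ip_rank_one A f Af ip_self norm_power)
  also have "\<dots> \<le> hs.nrm A * (nrm f * nrm (A f))"
    using hs.cauchy_schwarz[OF A rank_one_HS[OF f Af]] by (simp add: hs_nrm_rank_one f Af)
  finally have "nrm (A f) * nrm (A f) \<le> (hs.nrm A * nrm f) * nrm (A f)"
    by (simp add: power2_eq_square mult_ac)
  then show ?thesis
    using nrm_ge0[OF Af] nrm_ge0[OF f] hs.nrm_ge0[OF A]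
    by (cases "nrm (A f) = 0") (auto simp: mult_le_cancel_right)
qed

text \<open>The limit is taken vector by vector, because the operator norm is at most the
  Hilbert-Schmidt norm. Convergence in \<open>HS\<close> follows since bounds on finite partial sums
  survive the pointwise limit.\<close>

lemma HS_complete:
  assumes A: "\<And>k. A k \<in> HS" and C: "hs.cauchy_seq A"
  shows "\<exists>B\<in>HS. hs.lim_to A B"
proof -
  have dA: "dst (A j f) (A k f) \<le> hs.dst (A j) (A k) * nrm f" if "f \<in> H" for j k f
    using op_le_hs_nrm[OF HS_lincomb[OF A A] that, of 1 j "-1" k]
    by (simp add: dst_def hs.dst_def lincomb_apply that)
  have "cauchy_seq (\<lambda>k. A k f)" if f: "f \<in> H" for f
    unfolding cauchy_seq_def
  proof (intro allI impI)
    fix e :: real assume e: "e > 0"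
    have n: "nrm f + 1 > 0" using nrm_ge0[OF f] by simp
    then obtain N where N: "\<And>j k. j \<ge> N \<Longrightarrow> k \<ge> N \<Longrightarrow> hs.dst (A j) (A k) < e / (nrm f + 1)"
      using C e unfolding hs.cauchy_seq_def by (meson divide_pos_pos)
    have "dst (A j f) (A k f) < e" if "j \<ge> N" "k \<ge> N" for j k
    proof -
      have "dst (A j f) (A k f) \<le> hs.dst (A j) (A k) * (nrm f + 1)"
        using dA[OF f, of j k] hs.dst_ge0[OF A A, of j k] by (simp add: distrib_left)
      also have "\<dots> < e" using N[OF that] n by (simp add: pos_less_divide_eq)
      finally show ?thesis .
    qed
    then show "\<exists>N. \<forall>j\<ge>N. \<forall>k\<ge>N. dst (A j f) (A k f) < e" by blast
  qed
  then have "\<forall>f\<in>H. \<exists>g\<in>H. lim_to (\<lambda>k. A k f) g"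
    using complete HS_in[OF A] by simp
  then obtain B0 where B0: "\<And>f. f \<in> H \<Longrightarrow> B0 f \<in> H" "\<And>f. f \<in> H \<Longrightarrow> lim_to (\<lambda>k. A k f) (B0 f)"
    by metis
  define B where "B = restrict B0 H"
  have BH: "B f \<in> H" "lim_to (\<lambda>k. A k f) (B f)" if "f \<in> H" for f using B0[OF that] that by (simp_all add: B_def)
  have ipB: "(\<lambda>k. ip (A k f) h) \<longlonglongrightarrow> ip (B f) h" if "f \<in> H" "h \<in> H" for f h
    by (rule lim_to_ip_left) (simp_all add: HS_in[OF A] BH that)
  \<comment> \<open>A uniform bound on the tail of the sequence makes the pointwise limit a bounded
    operator.\<close>
  obtain N1 where N1: "\<And>k. k \<ge> N1 \<Longrightarrow> hs.dst (A k) (A N1) < 1"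
    using C unfolding hs.cauchy_seq_def by (meson order_refl zero_less_one)
  have bd: "nrm (A k f) \<le> (1 + hs.nrm (A N1)) * nrm f" if "k \<ge> N1" "f \<in> H" for k f
  proof -
    have "hs.nrm (A k) \<le> 1 + hs.nrm (A N1)"
      using hs.nrm_le_dst[OF A A, of k N1] N1[OF that(1)] by simp
    then show ?thesis
      using op_le_hs_nrm[OF A that(2), of k] mult_right_mono nrm_ge0[OF that(2)] order_trans by blast
  qed
  have Bb: "bounded_op H ip B"
  proof (rule bounded_opI[where C = "1 + hs.nrm (A N1)"])
    fix a f b g assume fg: "f \<in> H" "g \<in> H"
    show "B (fun_lc a f b g) = fun_lc a (B f) b (B g)"
    proof (rule ip_eqI)
      fix h assume h: "h \<in> H"
      have "(\<lambda>k. ip (A k (fun_lc a f b g)) h) \<longlonglongrightarrow> ip (fun_lc a (B f) b (B g)) h"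
        unfolding ip_lc[OF BH(1)[OF fg(1)] BH(1)[OF fg(2)] h]
          op_lc[OF HS_bounded[OF A] fg] ip_lc[OF HS_in[OF A fg(1)] HS_in[OF A fg(2)] h]
        by (intro tendsto_intros ipB fg h)
      then show "ip (B (fun_lc a f b g)) h = ip (fun_lc a (B f) b (B g)) h"
        using ipB[OF lc_in[OF fg] h] LIMSEQ_unique by blast
    qed (simp_all add: BH lc_in fg)
  next
    fix f assume f: "f \<in> H"
    show "nrm (B f) \<le> (1 + hs.nrm (A N1)) * nrm f"
    proof (rule LIMSEQ_le_const2)
      show "(\<lambda>k. nrm (A k f)) \<longlonglongrightarrow> nrm (B f)"
        by (rule lim_to_nrm) (simp_all add: HS_in[OF A] BH f)
      show "\<exists>N. \<forall>k\<ge>N. nrm (A k f) \<le> (1 + hs.nrm (A N1)) * nrm f" using bd f by blast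
    qed
  qed (erule BH(1), simp add: B_def)
  \<comment> \<open>On finitely many basis vectors the estimate between \<open>A k\<close> and
    \<open>A j\<close> passes to the limit in j.\<close>
  have fin: "(\<Sum>e\<in>F. (nrm (lincomb_op H 1 (A k) (-1) B e))\<^sup>2) \<le> \<epsilon>\<^sup>2"
    if F: "finite F" "F \<subseteq> E" and k: "\<And>j. j \<ge> k \<Longrightarrow> hs.dst (A k) (A j) < \<epsilon>" for F k \<epsilon>
  proof (rule LIMSEQ_le_const2)
    have FH: "e \<in> H" if "e \<in> F" for e using that F E_in by auto
    show "(\<lambda>j. \<Sum>e\<in>F. (dst (A k e) (A j e))\<^sup>2) \<longlonglongrightarrow> (\<Sum>e\<in>F. (nrm (lincomb_op H 1 (A k) (-1) B e))\<^sup>2)"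
    proof (intro tendsto_sum tendsto_power)
      fix e assume e: "e \<in> F"
      have "(\<lambda>j. dst (A k e) (A j e)) \<longlonglongrightarrow> dst (A k e) (B e)"
      proof (rule Lim_null_comparison[THEN LIM_zero_cancel])
        show "\<forall>\<^sub>F j in sequentially. norm (dst (A k e) (A j e) - dst (A k e) (B e)) \<le> dst (A j e) (B e)"
        proof (rule always_eventually, rule allI)
          fix j
          have V: "A k e \<in> H" "A j e \<in> H" "B e \<in> H" using HS_in[OF A] BH FH e by auto
          show "norm (dst (A k e) (A j e) - dst (A k e) (B e)) \<le> dst (A j e) (B e)"
            using dst_triangle[OF V(1,2,3)] dst_triangle[OF V(1,3,2)] dst_sym[OF V(2,3)] by simp
        qed
        show "(\<lambda>j. dst (A j e) (B e)) \<longlonglongrightarrow> 0" using BH(2)[OF FH[OF e]] by (simp add: lim_to_def)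
      qed
      then show "(\<lambda>j. dst (A k e) (A j e)) \<longlonglongrightarrow> nrm (lincomb_op H 1 (A k) (-1) B e)"
        using FH[OF e] by (simp add: lincomb_apply dst_def)
    qed
    have "(\<Sum>e\<in>F. (dst (A k e) (A j e))\<^sup>2) \<le> \<epsilon>\<^sup>2" if "j \<ge> k" for j
    proof -
      let ?D = "lincomb_op H 1 (A k) (-1) (A j)"
      have D: "?D \<in> HS" by (intro HS_lincomb A)
      have "(\<Sum>e\<in>F. (dst (A k e) (A j e))\<^sup>2) = (\<Sum>e\<in>F. (nrm (?D e))\<^sup>2)"
        using FH by (intro sum.cong) (simp_all add: dst_def lincomb_apply)
      also have "\<dots> \<le> (hs.nrm ?D)\<^sup>2"
        unfolding hs_nrm_sq[OF D] by (rule finite_sum_le_infsum) (use F HS_summable[OF D] in auto)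
      also have "\<dots> \<le> \<epsilon>\<^sup>2"
        using k[OF that] hs.nrm_ge0[OF D] by (intro power_mono) (auto simp: hs.dst_def)
      finally show ?thesis .
    qed
    then show "\<exists>N. \<forall>j\<ge>N. (\<Sum>e\<in>F. (dst (A k e) (A j e))\<^sup>2) \<le> \<epsilon>\<^sup>2" by blast
  qed
  have dHS: "lincomb_op H 1 (A k) (-1) B \<in> HS" if k: "\<And>j. j \<ge> k \<Longrightarrow> hs.dst (A k) (A j) < \<epsilon>" for k \<epsilon>
    unfolding HS_iff
  proof
    show "bounded_op H ip (lincomb_op H 1 (A k) (- 1) B)" by (intro lincomb_bounded HS_bounded A Bb)
    show "(\<lambda>e. (nrm (lincomb_op H 1 (A k) (- 1) B e))\<^sup>2) summable_on E"
      using fin[OF _ _ k] by (intro nonneg_bdd_above_summable_on bdd_aboveI[of _ "\<epsilon>\<^sup>2"]) auto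
  qed
  have dB: "hs.dst (A k) B \<le> \<epsilon>" if k: "\<And>j. j \<ge> k \<Longrightarrow> hs.dst (A k) (A j) < \<epsilon>" for k \<epsilon>
  proof -
    have D: "lincomb_op H 1 (A k) (-1) B \<in> HS" by (rule dHS[OF k])
    have "(hs.dst (A k) B)\<^sup>2 \<le> \<epsilon>\<^sup>2"
      unfolding hs.dst_def hs_nrm_sq[OF D]
      by (rule infsum_le_finite_sums) (use HS_summable[OF D] fin[OF _ _ k] in auto)
    moreover have "\<epsilon> \<ge> 0" using k[OF order_refl] hs.dst_ge0[OF A A, of k k] by simp
    ultimately show ?thesis by (rule power2_le_imp_le)
  qed
  have ev: "\<exists>N. \<forall>k\<ge>N. \<forall>j\<ge>k. hs.dst (A k) (A j) < \<epsilon>" if "\<epsilon> > 0" for \<epsilon>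
    using C that unfolding hs.cauchy_seq_def by (meson order_trans)
  have BHS: "B \<in> HS"
  proof -
    obtain k where k: "\<And>j. j \<ge> k \<Longrightarrow> hs.dst (A k) (A j) < 1" using ev[of 1] by auto
    \<comment> \<open>B is the difference of \<open>A k\<close> and \<open>A k\<close> - B, both
      already known to be Hilbert-Schmidt.\<close>
    have eq: "lincomb_op H 1 (A k) (-1) (lincomb_op H 1 (A k) (-1) B) = B"
    proof (rule op_eqI)
      fix f g assume "f \<in> H" "g \<in> H"
      then show "ip (lincomb_op H 1 (A k) (-1) (lincomb_op H 1 (A k) (-1) B) f) g = ip (B f) g"
        using HS_in[OF A, of f k] BH(1)[of f] by (simp add: lincomb_apply ip_lc lc_in)
    qed (intro Bb lincomb_bounded HS_bounded A)+
    show ?thesis using HS_lincomb[OF A dHS[OF k], of 1 k "-1"] unfolding eq .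
  qed
  moreover have "hs.lim_to A B"
    unfolding hs.lim_to_def
  proof (rule LIMSEQ_I)
    fix r :: real assume r: "r > 0"
    then obtain N where N: "\<forall>k\<ge>N. \<forall>j\<ge>k. hs.dst (A k) (A j) < r / 2" using ev[of "r/2"] by auto
    have "norm (hs.dst (A k) B - 0) < r" if "k \<ge> N" for k
      using dB[of k "r / 2"] N that hs.dst_ge0[OF A BHS] r by auto
    then show "\<exists>N. \<forall>k\<ge>N. norm (hs.dst (A k) B - 0) < r" by blast
  qed
  ultimately show ?thesis by blast
qed

sublocale hs: semi_hilbert HS "lincomb_op H" hs_ip
  by standard (rule HS_complete)

text \<open>Both norms sum |<A e, e'>|^2 over pairs of basis vectors, by rows and by columns; the
  terms are nonnegative, so the order is immaterial.\<close>

lemma adj_HS: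
  assumes A: "A \<in> HS"
  shows "adj A \<in> HS" and hs_nrm_adj: "hs.nrm (adj A) = hs.nrm A"
proof -
  have b: "bounded_op H ip A" using A by (rule HS_bounded)
  note adj_in = op_in[OF adj_bounded[OF b]]
  let ?f = "\<lambda>(e, e'). (cmod (ip (A e) e'))\<^sup>2"
  have row: "((\<lambda>e'. ?f (e, e')) has_sum (nrm (A e))\<^sup>2) E" if "e \<in> E" for e
    using parseval[OF HS_in[OF A E_in[OF that]]] by simp
  have col: "((\<lambda>e. ?f (e, e')) has_sum (nrm (adj A e'))\<^sup>2) E" if e': "e' \<in> E" for e'
  proof -
    have "cmod (ip (adj A e') e) = cmod (ip (A e) e')" if "e \<in> E" for e
      using ip_adj[OF b E_in[OF that] E_in[OF e']] ip_herm[OF E_in[OF that] adj_in[OF E_in[OF e']]] by simp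
    then show ?thesis
      using parseval[OF adj_in[OF E_in[OF e']]]
      by (subst has_sum_cong[of E _ "\<lambda>e. (cmod (ip (adj A e') e))\<^sup>2"]) simp_all
  qed
  have summ: "?f summable_on (E \<times> E)"
    by (rule summable_on_SigmaI[OF row HS_summable[OF A]]) auto
  then have summ': "(\<lambda>(e', e). ?f (e, e')) summable_on (E \<times> E)"
    by (subst (asm) product_swap[symmetric], subst (asm) summable_on_reindex)
      (auto simp: o_def case_prod_unfold prod.swap_def)
  have "(\<lambda>e'. \<Sum>\<^sub>\<infinity>e\<in>E. ?f (e, e')) summable_on E"
    using summable_on_Sigma_banach[of "\<lambda>e' e. ?f (e, e')" E "\<lambda>_. E"] summ' by simp
  also have "?this \<longleftrightarrow> (\<lambda>e'. (nrm (adj A e'))\<^sup>2) summable_on E"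
    by (intro summable_on_cong infsumI col)
  finally show HS': "adj A \<in> HS" by (simp add: HS_iff adj_bounded b)
  have "(hs.nrm A)\<^sup>2 = (\<Sum>\<^sub>\<infinity>e\<in>E. \<Sum>\<^sub>\<infinity>e'\<in>E. ?f (e, e'))"
    unfolding hs_nrm_sq[OF A] by (intro infsum_cong infsumI[symmetric] row)
  also have "\<dots> = (\<Sum>\<^sub>\<infinity>e'\<in>E. \<Sum>\<^sub>\<infinity>e\<in>E. ?f (e, e'))"
    using infsum_swap_banach[of "\<lambda>e e'. ?f (e, e')" E E] summ by simp
  also have "\<dots> = (hs.nrm (adj A))\<^sup>2"
    unfolding hs_nrm_sq[OF HS'] by (intro infsum_cong infsumI col)
  finally have "(hs.nrm A)\<^sup>2 = (hs.nrm (adj A))\<^sup>2" .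
  from power2_eq_imp_eq[OF this[symmetric] hs.nrm_ge0[OF HS'] hs.nrm_ge0[OF A]]
  show "hs.nrm (adj A) = hs.nrm A" .
qed

lemma compose_HS_left:
  assumes B: "bounded_op H ip B" and A: "A \<in> HS"
  shows "compose H B A \<in> HS"
proof -
  obtain C where C: "C \<ge> 0" "\<And>f. f \<in> H \<Longrightarrow> nrm (B f) \<le> C * nrm f"
    using bounded_op_bound[OF B] by auto
  show ?thesis
  proof (rule HS_comparison[OF compose_bounded[OF B HS_bounded[OF A]]])
    show "(\<lambda>e. C\<^sup>2 * (nrm (A e))\<^sup>2) summable_on E" by (intro summable_on_cmult_right HS_summable A)
    show "(nrm (compose H B A e))\<^sup>2 \<le> C\<^sup>2 * (nrm (A e))\<^sup>2" if "e \<in> E" for e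
    proof -
      have "A e \<in> H" by (rule HS_in[OF A E_in[OF that]])
      then have "(nrm (B (A e)))\<^sup>2 \<le> (C * nrm (A e))\<^sup>2"
        by (intro power_mono C nrm_ge0 op_in[OF B])
      then show ?thesis by (simp add: compose_eq E_in that power_mult_distrib)
    qed
  qed
qed

text \<open>Reduced to composition on the left by taking adjoints.\<close>

lemma compose_HS_right:
  assumes B: "bounded_op H ip B" and A: "A \<in> HS"
  shows "compose H A B \<in> HS"
proof -
  have "adj (compose H (adj B) (adj A)) \<in> HS"
    by (intro adj_HS compose_HS_left adj_bounded B A)
  then show ?thesis
    by (simp add: adj_compose adj_bounded B HS_bounded A adj_adj)
qed

section \<open>Trace class operators\<close>

lemma trace_class_HS: "T \<in> trace_class H ip \<Longrightarrow> T \<in> HS"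
  using compose_HS_left[OF HS_bounded] by (auto simp: trace_class_def)

text \<open><A B e, e> = <B e, \<open>adj A\<close> e> makes the trace of a product a
  Hilbert-Schmidt inner product, so the trace formula becomes a statement of unitarity.\<close>

lemma op_trace_compose:
  assumes A: "A \<in> HS" and B: "B \<in> HS"
  shows "op_trace H ip (compose H A B) = hs_ip B (adj A)"
  unfolding op_trace_def hs_ip_def
  by (rule infsum_cong) (simp add: compose_eq E_in ip_adj[OF HS_bounded[OF A]] HS_in[OF B])

lemma finite_proj_HS:
  assumes "finite F" "F \<subseteq> E"
  shows "\<exists>P\<in>HS. \<forall>e\<in>E. P e = (if e \<in> F then e else (\<lambda>_. 0))"
  using assms
proof (induction F rule: finite_induct)
  case empty
  have "rank_one (\<lambda>_. 0) (\<lambda>_. 0) e = (\<lambda>_. 0)" if "e \<in> E" for e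
    using E_in[OF that] by (simp add: rank_one_def fun_lc_def)
  then show ?case using rank_one_HS[OF zero_in zero_in] by auto
next
  case (insert x F)
  then obtain P where P: "P \<in> HS" "\<forall>e\<in>E. P e = (if e \<in> F then e else (\<lambda>_. 0))" by auto
  have x: "x \<in> E" "x \<in> H" using insert.prems E_in by auto
  have "lincomb_op H 1 P 1 (rank_one x x) e = (if e \<in> insert x F then e else (\<lambda>_. 0))" if "e \<in> E" for e
    using that P(2) insert.hyps
    by (simp add: lincomb_apply E_in rank_one_def E_ip x) (simp add: fun_lc_def)
  then show ?case using HS_lincomb[OF P(1) rank_one_HS[OF x(2) x(2)], of 1 1] by blast
qed

text \<open>A composed with the projection onto finitely many basis vectors is a product of two
  Hilbert-Schmidt operators, and the squared error is the tail of the sum that defines the norm of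
  A.\<close>

lemma trace_class_dense:
  assumes A: "A \<in> HS"
  shows "\<exists>T. (\<forall>k. T k \<in> trace_class H ip) \<and> hs.lim_to T A"
proof -
  have "\<exists>T\<in>trace_class H ip. (hs.dst T A)\<^sup>2 \<le> 1 / real (Suc k)" for k
  proof -
    have "((\<lambda>e. (nrm (A e))\<^sup>2) has_sum (hs.nrm A)\<^sup>2) E"
      unfolding hs_nrm_sq[OF A] by (rule has_sum_infsum[OF HS_summable[OF A]])
    from has_sum_finite_approximation[OF this, of "1 / real (Suc k)"]
    obtain F where F: "finite F" "F \<subseteq> E"
      "dist (\<Sum>e\<in>F. (nrm (A e))\<^sup>2) ((hs.nrm A)\<^sup>2) \<le> 1 / real (Suc k)" by auto
    obtain P where P: "P \<in> HS" "\<forall>e\<in>E. P e = (if e \<in> F then e else (\<lambda>_. 0))"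
      using finite_proj_HS[OF F(1,2)] by auto
    let ?T = "compose H A P" and ?D = "lincomb_op H 1 (compose H A P) (-1) A"
    have T: "?T \<in> trace_class H ip" using A P(1) by (auto simp: trace_class_def)
    then have D: "?D \<in> HS" by (intro HS_lincomb trace_class_HS A)
    have A0: "A (\<lambda>_. 0) = (\<lambda>_. 0)"
      using op_lc[OF HS_bounded[OF A] zero_in zero_in, of 0 0] by (simp add: fun_lc_def)
    have De: "(nrm (?D e))\<^sup>2 = (if e \<in> F then 0 else (nrm (A e))\<^sup>2)" if e: "e \<in> E" for e
    proof -
      have "?D e = fun_lc 1 (if e \<in> F then A e else (\<lambda>_. 0)) (-1) (A e)"
        using e P(2) A0 by (simp add: lincomb_apply E_in compose_eq)
      then show ?thesis
        using dst_self[OF HS_in[OF A E_in[OF e]]] nrm_scale[OF HS_in[OF A E_in[OF e]], of "-1"]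
        by (auto simp: dst_def fun_lc_def)
    qed
    have "((\<lambda>e. (nrm (?D e))\<^sup>2) has_sum (hs.nrm ?D)\<^sup>2) E"
      unfolding hs_nrm_sq[OF D] by (rule has_sum_infsum[OF HS_summable[OF D]])
    moreover have "((\<lambda>e. if e \<in> F then (nrm (A e))\<^sup>2 else 0) has_sum (\<Sum>e\<in>F. (nrm (A e))\<^sup>2)) E"
      using F by (intro has_sum_finite_neutralI[of F]) auto
    ultimately have "((\<lambda>e. (nrm (?D e))\<^sup>2 + (if e \<in> F then (nrm (A e))\<^sup>2 else 0))
        has_sum (hs.nrm ?D)\<^sup>2 + (\<Sum>e\<in>F. (nrm (A e))\<^sup>2)) E" by (rule has_sum_add)
    also have "?this \<longleftrightarrow> ((\<lambda>e. (nrm (A e))\<^sup>2) has_sum (hs.nrm ?D)\<^sup>2 + (\<Sum>e\<in>F. (nrm (A e))\<^sup>2)) E"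
      by (intro has_sum_cong) (simp add: De)
    finally have "(hs.nrm ?D)\<^sup>2 + (\<Sum>e\<in>F. (nrm (A e))\<^sup>2) = (hs.nrm A)\<^sup>2"
      unfolding hs_nrm_sq[OF A] by (rule infsumI[symmetric])
    with F(3) have "(hs.nrm ?D)\<^sup>2 \<le> 1 / real (Suc k)" by (simp add: dist_real_def)
    with T show ?thesis by (intro bexI[of _ ?T]) (simp_all add: hs.dst_def)
  qed
  then obtain T where T: "\<And>k. T k \<in> trace_class H ip" "\<And>k. (hs.dst (T k) A)\<^sup>2 \<le> 1 / real (Suc k)"
    by metis
  have "(\<lambda>k. (hs.dst (T k) A)\<^sup>2) \<longlonglongrightarrow> 0"
    by (rule Lim_null_comparison[OF _ LIMSEQ_Suc[OF lim_1_over_n]]) (simp add: T del: of_nat_Suc)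
  then have "(\<lambda>k. hs.dst (T k) A) \<longlonglongrightarrow> 0"
    using tendsto_real_sqrt[of "\<lambda>k. (hs.dst (T k) A)\<^sup>2" 0] hs.dst_ge0[OF trace_class_HS[OF T(1)] A] by simp
  with T(1) show ?thesis by (intro exI[of _ T]) (simp add: hs.lim_to_def)
qed

end

section \<open>Lebesgue measure and square-integrable functions\<close>

lemma nn_integral_lborel_shift:
  fixes f :: "'a::euclidean_space \<Rightarrow> ennreal"
  assumes [measurable]: "f \<in> borel_measurable borel"
  shows "(\<integral>\<^sup>+x. f (c + x) \<partial>lborel) = (\<integral>\<^sup>+x. f x \<partial>lborel)"
  by (subst (2) lborel_distr_plus[of c, symmetric]) (simp add: nn_integral_distr)

lemma nn_integral_lborel_reflect:
  fixes f :: "'a::euclidean_space \<Rightarrow> ennreal"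
  assumes [measurable]: "f \<in> borel_measurable borel"
  shows "(\<integral>\<^sup>+x. f (c - x) \<partial>lborel) = (\<integral>\<^sup>+x. f x \<partial>lborel)"
  by (subst (2) lborel_affine[of "-1" c]) (simp_all add: nn_integral_density nn_integral_distr)

text \<open>
  Uniqueness of Haar measure: for \<open>\<nu>\<close> the image of \<open>\<lambda>\<close> under \<open>T\<close>, Tonelli's theorem and
  translation invariance give \<open>\<nu>(A) \<lambda>(B) = \<lambda>(A) \<nu>(B)\<close>, and the unit ball is \<open>T\<close>-invariant.
\<close>

lemma lborel_distr_isometry:
  fixes T :: "'a::euclidean_space \<Rightarrow> 'a"
  assumes lin: "linear T" and iso: "\<And>x. norm (T x) = norm x"
  shows "distr lborel borel T = lborel"
proof -
  have [measurable]: "T \<in> borel_measurable borel"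
    using linear_continuous_on[of T UNIV] lin
    by (simp add: linear_conv_bounded_linear borel_measurable_continuous_onI)
  have "inj T"
    using iso by (auto simp: linear_injective_0[OF lin] simp flip: norm_eq_zero[of "T _"])
  then have "surj T" by (rule linear_injective_imp_surjective[OF lin]) simp
  have ind: "(\<integral>\<^sup>+x. indicator A (T x) \<partial>lborel) = emeasure lborel (T -` A)"
    if "A \<in> sets borel" for A
  proof -
    have "T -` A \<in> sets borel"
      using measurable_sets[of T borel borel A] that by auto
    moreover have "(\<lambda>x. indicator A (T x)) = (indicator (T -` A) :: 'a \<Rightarrow> ennreal)"
      by (auto simp: indicator_def fun_eq_iff)
    ultimately show ?thesis by (metis nn_integral_indicator sets_lborel)
  qed
  have key: "emeasure lborel (T -` A) * emeasure lborel B = emeasure lborel (T -` B) * emeasure lborel A"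
    if [measurable]: "A \<in> sets borel" "B \<in> sets borel" for A B
  proof -
    let ?I = "\<lambda>S. indicator S :: 'a \<Rightarrow> ennreal"
    have "(\<integral>\<^sup>+y. \<integral>\<^sup>+x. ?I A (T x) * ?I B (T x + y) \<partial>lborel \<partial>lborel)
        = (\<integral>\<^sup>+x. \<integral>\<^sup>+y. ?I A (T x) * ?I B (T x + y) \<partial>lborel \<partial>lborel)"
      by (rule lborel_pair.Fubini') measurable
    also have "\<dots> = (\<integral>\<^sup>+x. ?I A (T x) * emeasure lborel B \<partial>lborel)"
      using nn_integral_lborel_shift[of "?I B"] by (intro nn_integral_cong) (simp add: nn_integral_cmult)
    also have "\<dots> = emeasure lborel (T -` A) * emeasure lborel B"
      by (simp add: nn_integral_multc ind)
    finally have 1: "(\<integral>\<^sup>+y. \<integral>\<^sup>+x. ?I A (T x) * ?I B (T x + y) \<partial>lborel \<partial>lborel)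
        = emeasure lborel (T -` A) * emeasure lborel B" .
    have "(\<integral>\<^sup>+x. ?I A (T x) * ?I B (T x + y) \<partial>lborel) = (\<integral>\<^sup>+x. ?I A (T x - y) * ?I B (T x) \<partial>lborel)" for y
    proof -
      \<comment> \<open>The shift by y is the image under T of a shift by c, and Lebesgue measure is
        invariant under the latter.\<close>
      obtain c where c: "T c = y" using \<open>surj T\<close> by (metis surjD)
      show ?thesis
        using nn_integral_lborel_shift[of "\<lambda>x. ?I A (T x - y) * ?I B (T x)" c]
        by (simp add: linear_add[OF lin] c add.commute)
    qed
    then have "(\<integral>\<^sup>+y. \<integral>\<^sup>+x. ?I A (T x) * ?I B (T x + y) \<partial>lborel \<partial>lborel)
        = (\<integral>\<^sup>+y. \<integral>\<^sup>+x. ?I A (T x - y) * ?I B (T x) \<partial>lborel \<partial>lborel)" by simp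
    also have "\<dots> = (\<integral>\<^sup>+x. \<integral>\<^sup>+y. ?I A (T x - y) * ?I B (T x) \<partial>lborel \<partial>lborel)"
      by (rule lborel_pair.Fubini') measurable
    also have "\<dots> = (\<integral>\<^sup>+x. emeasure lborel A * ?I B (T x) \<partial>lborel)"
      using nn_integral_lborel_reflect[of "?I A"] by (intro nn_integral_cong) (simp add: nn_integral_multc)
    also have "\<dots> = emeasure lborel (T -` B) * emeasure lborel A"
      by (simp add: nn_integral_cmult ind mult.commute)
    finally show ?thesis using 1 by simp
  qed
  have ball: "T -` ball 0 1 = ball 0 1" by (auto simp: iso)
  have pos: "emeasure lborel (ball (0::'a) 1) \<noteq> 0" "emeasure lborel (ball (0::'a) 1) \<noteq> \<infinity>"
    using emeasure_lborel_ball_finite[of "0::'a" 1] open_not_negligible[of "ball (0::'a) 1"]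
    by (auto simp: negligible_iff_emeasure0 emeasure_completion)
  show ?thesis
  proof (rule measure_eqI)
    fix A assume "A \<in> sets (distr lborel borel T)"
    then have A: "A \<in> sets borel" by simp
    have "emeasure lborel (T -` A) = emeasure lborel A"
      using key[OF A, of "ball 0 1"] pos
        ennreal_mult_cancel_left[of "emeasure lborel (ball (0::'a) 1)" "emeasure lborel (T -` A)"
          "emeasure lborel A"]
      by (simp add: ball mult.commute)
    then show "emeasure (distr lborel borel T) A = emeasure lborel A"
      using A by (simp add: emeasure_distr)
  qed simp
qed

subsection \<open>The space of square-integrable functions\<close>

definition l2_ip :: "'m measure \<Rightarrow> ('m \<Rightarrow> complex) \<Rightarrow> ('m \<Rightarrow> complex) \<Rightarrow> complex" where
  "l2_ip M f g = (LINT x|M. f x * cnj (g x))"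

lemma L2_D:
  assumes "f \<in> L2 M"
  shows L2_measurable: "f \<in> borel_measurable M"
    and L2_integrable: "integrable M (\<lambda>x. (cmod (f x))\<^sup>2)"
  using assms by (simp_all add: L2_def)

lemma borel_measurable_cnj [measurable (raw)]:
  "f \<in> borel_measurable M \<Longrightarrow> (\<lambda>x. cnj (f x)) \<in> borel_measurable M"
  by (rule borel_measurable_continuous_on[of cnj]) (auto intro: continuous_intros)

lemma norm_mult_le_squares: "norm (a * b) \<le> (norm a)\<^sup>2 + (norm b)\<^sup>2" for a b :: complex
  using sum_squares_bound[of "norm a" "norm b"] mult_nonneg_nonneg[OF norm_ge_zero norm_ge_zero, of a b]
  unfolding norm_mult by linarith

lemma L2_mult_integrable:
  assumes f: "f \<in> L2 M" and g: "g \<in> L2 M"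
  shows "integrable M (\<lambda>x. f x * g x)" "integrable M (\<lambda>x. f x * cnj (g x))"
proof -
  note [measurable] = L2_measurable[OF f] L2_measurable[OF g]
  have i: "integrable M (\<lambda>x. (cmod (f x))\<^sup>2 + (cmod (g x))\<^sup>2)"
    by (intro Bochner_Integration.integrable_add L2_integrable f g)
  show "integrable M (\<lambda>x. f x * g x)"
    by (rule Bochner_Integration.integrable_bound[OF i]) (use norm_mult_le_squares in auto)
  show "integrable M (\<lambda>x. f x * cnj (g x))"
    by (rule Bochner_Integration.integrable_bound[OF i])
      (use norm_mult_le_squares[of "f _" "cnj (g _)"] in auto)
qed

lemma L2_fun_lc:
  assumes f: "f \<in> L2 M" and g: "g \<in> L2 M"
  shows "fun_lc a f b g \<in> L2 M"
proof -
  note [measurable] = L2_measurable[OF f] L2_measurable[OF g]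
  have i: "integrable M (\<lambda>x. 2 * (cmod a)\<^sup>2 * (cmod (f x))\<^sup>2 + 2 * (cmod b)\<^sup>2 * (cmod (g x))\<^sup>2)"
    by (intro Bochner_Integration.integrable_add integrable_mult_right L2_integrable f g)
  have "(cmod (a * u + b * v))\<^sup>2 \<le> 2 * (cmod a)\<^sup>2 * (cmod u)\<^sup>2 + 2 * (cmod b)\<^sup>2 * (cmod v)\<^sup>2" for u v
  proof -
    have "(cmod (a * u + b * v))\<^sup>2 \<le> (cmod (a * u) + cmod (b * v))\<^sup>2"
      by (intro power_mono norm_triangle_ineq) simp
    also have "\<dots> \<le> 2 * (cmod (a * u))\<^sup>2 + 2 * (cmod (b * v))\<^sup>2"
      using sum_squares_bound[of "cmod (a * u)" "cmod (b * v)"] by (simp add: power2_sum)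
    finally show ?thesis by (simp add: norm_mult power_mult_distrib mult.assoc)
  qed
  then have "integrable M (\<lambda>x. (cmod (a * f x + b * g x))\<^sup>2)"
    by (intro Bochner_Integration.integrable_bound[OF i]) auto
  then show ?thesis by (simp add: L2_def fun_lc_def)
qed

lemma l2_ip_self: "l2_ip M f f = of_real (LINT x|M. (cmod (f x))\<^sup>2)"
  unfolding l2_ip_def by (simp only: complex_norm_square[symmetric] integral_complex_of_real)

interpretation l2: semi_ip "L2 M" fun_lc "l2_ip M" for M
proof
  fix f g h :: "'a \<Rightarrow> complex" and a b
  assume fgh: "f \<in> L2 M" "g \<in> L2 M" "h \<in> L2 M"
  have "l2_ip M (fun_lc a f b g) h = (LINT x|M. a * (f x * cnj (h x)) + b * (g x * cnj (h x)))"
    by (simp add: l2_ip_def fun_lc_def algebra_simps)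
  then show "l2_ip M (fun_lc a f b g) h = a * l2_ip M f h + b * l2_ip M g h"
    by (simp add: l2_ip_def L2_mult_integrable fgh)
next
  fix f g :: "'a \<Rightarrow> complex"
  have "l2_ip M g f = (LINT x|M. cnj (f x * cnj (g x)))" by (simp add: l2_ip_def mult.commute)
  then show "l2_ip M g f = cnj (l2_ip M f g)" by (simp add: l2_ip_def del: complex_cnj_mult)
qed (simp_all add: L2_fun_lc l2_ip_self)

abbreviation l2_nrm where "l2_nrm M \<equiv> semi_ip.nrm (l2_ip M)"
abbreviation l2_dst where "l2_dst M \<equiv> semi_ip.dst fun_lc (l2_ip M)"

lemma l2_nrm_eq: "l2_nrm M f = sqrt (LINT x|M. (cmod (f x))\<^sup>2)"
  by (simp add: l2.nrm_def l2_ip_self)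

lemma L2_dist_eq: "L2_dist M f g = l2_dst M f g"
  by (simp add: L2_dist_def l2.dst_def l2_nrm_eq fun_lc_def)

lemma l2_nn_integral:
  assumes "f \<in> L2 M"
  shows "(\<integral>\<^sup>+x. ennreal ((cmod (f x))\<^sup>2) \<partial>M) = ennreal ((l2_nrm M f)\<^sup>2)"
  using nn_integral_eq_integral[OF L2_integrable[OF assms]]
  by (simp add: l2_nrm_eq)

lemma L2_nn_integralI:
  assumes [measurable]: "f \<in> borel_measurable M"
    and le: "(\<integral>\<^sup>+x. ennreal ((cmod (f x))\<^sup>2) \<partial>M) \<le> ennreal (C\<^sup>2)" and C: "0 \<le> C"
  shows "f \<in> L2 M \<and> l2_nrm M f \<le> C"
proof
  have "(\<integral>\<^sup>+x. ennreal ((cmod (f x))\<^sup>2) \<partial>M) < \<infinity>" using le by (rule order_le_less_trans) simp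
  then show f: "f \<in> L2 M" by (simp add: L2_def integrableI_nonneg)
  have "(l2_nrm M f)\<^sup>2 \<le> C\<^sup>2" using le by (simp add: l2_nn_integral[OF f])
  then show "l2_nrm M f \<le> C" using C by (rule power2_le_imp_le)
qed

text \<open>Fatou's lemma. The bound is required only from N on because it is applied to tails of
  convergent and Cauchy sequences.\<close>

lemma L2_fatou:
  assumes s: "\<And>k. s k \<in> L2 M" and [measurable]: "f \<in> borel_measurable M"
    and lim: "AE x in M. (\<lambda>k. s k x) \<longlonglongrightarrow> f x"
    and bd: "\<And>k. k \<ge> N \<Longrightarrow> l2_nrm M (s k) \<le> C"
  shows "f \<in> L2 M \<and> l2_nrm M f \<le> C"
proof (rule L2_nn_integralI)
  note [measurable] = L2_measurable[OF s]
  have C: "0 \<le> C" using bd[of N] l2.nrm_ge0[OF s, of N] by simp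
  show "0 \<le> C" by fact
  have "(\<integral>\<^sup>+x. ennreal ((cmod (f x))\<^sup>2) \<partial>M) = (\<integral>\<^sup>+x. liminf (\<lambda>k. ennreal ((cmod (s k x))\<^sup>2)) \<partial>M)"
  proof (rule nn_integral_cong_AE)
    show "AE x in M. ennreal ((cmod (f x))\<^sup>2) = liminf (\<lambda>k. ennreal ((cmod (s k x))\<^sup>2))"
      using lim
    proof eventually_elim
      case (elim x)
      have "(\<lambda>k. ennreal ((cmod (s k x))\<^sup>2)) \<longlonglongrightarrow> ennreal ((cmod (f x))\<^sup>2)"
        by (intro tendsto_intros elim)
      then show ?case by (intro lim_imp_Liminf[symmetric]) auto
    qed
  qed
  also have "\<dots> \<le> liminf (\<lambda>k. \<integral>\<^sup>+x. ennreal ((cmod (s k x))\<^sup>2) \<partial>M)"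
    by (rule nn_integral_liminf) measurable
  also have "\<dots> \<le> liminf (\<lambda>k::nat. ennreal (C\<^sup>2))"
    unfolding l2_nn_integral[OF s]
    by (intro Liminf_mono eventually_sequentiallyI[of N] ennreal_leI power_mono bd l2.nrm_ge0 s)
  also have "\<dots> = ennreal (C\<^sup>2)" by (intro lim_imp_Liminf) auto
  finally show "(\<integral>\<^sup>+x. ennreal ((cmod (f x))\<^sup>2) \<partial>M) \<le> ennreal (C\<^sup>2)" .
qed simp

lemma l2_nrm_eq_0_iff:
  assumes "f \<in> L2 M"
  shows "l2_nrm M f = 0 \<longleftrightarrow> (AE x in M. f x = 0)"
  using integral_nonneg_eq_0_iff_AE[OF L2_integrable[OF assms]] by (simp add: l2_nrm_eq)

lemma l2_dst_eq_0_iff: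
  assumes "f \<in> L2 M" "g \<in> L2 M"
  shows "l2_dst M f g = 0 \<longleftrightarrow> (AE x in M. f x = g x)"
  using l2_nrm_eq_0_iff[OF L2_fun_lc[OF assms, of 1 "-1"]] by (simp add: l2.dst_def fun_lc_def)

text \<open>Fatou applied to F - s k: pointwise it tends to F - f, while its norm is eventually
  below any \<epsilon>.\<close>

lemma L2_lim_pointwise:
  assumes s: "\<And>k. s k \<in> L2 M" and F: "F \<in> L2 M" and [measurable]: "f \<in> borel_measurable M"
    and l2: "l2.lim_to M s F" and lim: "AE x in M. (\<lambda>k. s k x) \<longlonglongrightarrow> f x"
  shows "AE x in M. F x = f x"
proof -
  note [measurable] = L2_measurable[OF s] L2_measurable[OF F]
  have D: "fun_lc 1 F (-1) f \<in> L2 M \<and> l2_nrm M (fun_lc 1 F (-1) f) \<le> \<epsilon>" if e: "\<epsilon> > 0" for \<epsilon>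
  proof -
    obtain N where N: "\<And>k. k \<ge> N \<Longrightarrow> l2_dst M (s k) F < \<epsilon>"
      using LIMSEQ_D[OF l2[unfolded l2.lim_to_def] e] by (auto simp: l2.dst_ge0 s F)
    show ?thesis
    proof (rule L2_fatou[where s = "\<lambda>k. fun_lc 1 F (-1) (s k)" and N = N])
      show "AE x in M. (\<lambda>k. fun_lc 1 F (-1) (s k) x) \<longlonglongrightarrow> fun_lc 1 F (-1) f x"
        using lim by eventually_elim (auto simp: fun_lc_def intro!: tendsto_intros)
      show "l2_nrm M (fun_lc 1 F (-1) (s k)) \<le> \<epsilon>" if "k \<ge> N" for k
        using N[OF that] by (simp add: l2.dst_def[symmetric] l2.dst_sym[OF F s])
    qed (auto simp: L2_fun_lc F s, simp add: fun_lc_def)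
  qed
  have "fun_lc 1 F (-1) f \<in> L2 M" using D[of 1] by simp
  moreover have "l2_nrm M (fun_lc 1 F (-1) f) = 0"
    using D l2.nrm_ge0[OF calculation] by (meson antisym field_le_epsilon add_0 dense_ge)
  ultimately show ?thesis
    using l2_nrm_eq_0_iff[of "fun_lc 1 F (-1) f" M] by (auto simp: fun_lc_def)
qed

text \<open>Riesz-Fischer. Along a subsequence with consecutive distances below 4^-k, the squared
  increments weighted by 4^k have a summable integral, so almost everywhere the increments are at
  most a constant times 2^-k and the subsequence converges.\<close>

lemma L2_complete:
  assumes s: "\<And>k. s k \<in> L2 M" and C: "l2.cauchy_seq M s"
  shows "\<exists>f\<in>L2 M. l2.lim_to M s f"
proof -
  note [measurable] = L2_measurable[OF s]
  have "\<exists>N. \<forall>j\<ge>N. \<forall>k\<ge>N. l2_dst M (s j) (s k) < (1 / 4) ^ n" for n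
    using C unfolding l2.cauchy_seq_def by simp
  then obtain N0 where N0: "\<And>n j k. j \<ge> N0 n \<Longrightarrow> k \<ge> N0 n \<Longrightarrow> l2_dst M (s j) (s k) < (1 / 4) ^ n"
    by metis
  \<comment> \<open>Partial sums make the indices monotone while keeping
    \<open>N0 n \<le> r n\<close>.\<close>
  define r where "r n = (\<Sum>i\<le>n. N0 i)" for n
  have rN: "N0 n \<le> r n" for n by (simp add: r_def member_le_sum)
  have r_mono: "r j \<le> r n" if "j \<le> n" for j n
    unfolding r_def by (rule sum_mono2) (use that in auto)
  have rd: "l2_dst M (s (r j)) (s (r k)) < (1 / 4) ^ n" if "j \<ge> n" "k \<ge> n" for j k n
    using N0 rN r_mono that by (meson order_trans)
  define h where "h k x = (cmod (s (r (Suc k)) x - s (r k) x))\<^sup>2" for k x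
  have [measurable]: "h k \<in> borel_measurable M" for k unfolding h_def by measurable
  have hint: "(\<integral>\<^sup>+x. ennreal (4 ^ k * h k x) \<partial>M) \<le> ennreal ((1 / 4) ^ k)" for k
  proof -
    have "(\<integral>\<^sup>+x. ennreal (4 ^ k * h k x) \<partial>M) = ennreal (4 ^ k) * (\<integral>\<^sup>+x. ennreal (h k x) \<partial>M)"
      by (simp add: ennreal_mult' nn_integral_cmult h_def)
    also have "(\<integral>\<^sup>+x. ennreal (h k x) \<partial>M) = ennreal ((l2_dst M (s (r (Suc k))) (s (r k)))\<^sup>2)"
      using l2_nn_integral[OF L2_fun_lc[OF s s, of 1 "r (Suc k)" "-1" "r k"]]
      by (simp add: l2.dst_def h_def fun_lc_def)
    also have "ennreal (4 ^ k) * \<dots> \<le> ennreal (4 ^ k) * ennreal (((1 / 4) ^ k)\<^sup>2)"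
      using rd[of k "Suc k" k] by (intro mult_left_mono ennreal_leI power_mono l2.dst_ge0 s) auto
    also have "\<dots> = ennreal ((1 / 4) ^ k)"
      by (simp add: ennreal_mult''[symmetric] power2_eq_square power_one_over field_simps)
    finally show ?thesis .
  qed
  have "AE x in M. (\<Sum>k. ennreal (4 ^ k * h k x)) \<noteq> \<infinity>"
  proof (rule nn_integral_PInf_AE)
    have "(\<integral>\<^sup>+x. (\<Sum>k. ennreal (4 ^ k * h k x)) \<partial>M) = (\<Sum>k. \<integral>\<^sup>+x. ennreal (4 ^ k * h k x) \<partial>M)"
      by (rule nn_integral_suminf) measurable
    also have "\<dots> \<le> (\<Sum>k. ennreal ((1 / 4) ^ k))" by (intro suminf_le hint) auto
    also have "\<dots> = ennreal (\<Sum>k. (1 / 4) ^ k)"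
      by (intro suminf_ennreal2) (auto intro!: summable_geometric)
    also have "\<dots> < \<infinity>" by simp
    finally show "(\<integral>\<^sup>+x. (\<Sum>k. ennreal (4 ^ k * h k x)) \<partial>M) \<noteq> \<infinity>" by simp
  qed measurable
  then have conv: "AE x in M. convergent (\<lambda>k. s (r k) x)"
  proof eventually_elim
    case (elim x)
    then obtain B where B: "(\<Sum>k. ennreal (4 ^ k * h k x)) = ennreal B" "0 \<le> B"
      by (metis ennreal_cases infinity_ennreal_def)
    have hB: "cmod (s (r (Suc k)) x - s (r k) x) \<le> sqrt B * (1 / 2) ^ k" for k
    proof -
      have "ennreal (4 ^ k * h k x) \<le> ennreal B"
        using ennreal_suminf_lessD[of "\<lambda>k. ennreal (4 ^ k * h k x)"] B(1)
        by (metis leI less_irrefl)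
      then have "4 ^ k * h k x \<le> B" using B by simp
      then have "h k x \<le> B * (1 / 4) ^ k" by (simp add: power_one_over field_simps)
      also have "\<dots> = (sqrt B * (1 / 2) ^ k)\<^sup>2"
        using B(2) by (simp add: power_mult_distrib power_mult[symmetric] mult.commute[of k 2])
          (simp add: power_mult power2_eq_square)
      finally show ?thesis unfolding h_def by (rule power2_le_imp_le) (simp add: B(2))
    qed
    have "summable (\<lambda>k. s (r (Suc k)) x - s (r k) x)"
      by (rule summable_comparison_test'[of "\<lambda>k. sqrt B * (1 / 2) ^ k"])
        (auto intro!: summable_mult summable_geometric simp: hB)
    then have "convergent (\<lambda>n. \<Sum>k<n. s (r (Suc k)) x - s (r k) x)" by (simp add: summable_iff_convergent)
    then have "convergent (\<lambda>n. s (r 0) x + (s (r n) x - s (r 0) x))"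
      by (subst (asm) sum_lessThan_telescope) (intro convergent_add convergent_const)
    then show ?case by simp
  qed
  define f where "f x = lim (\<lambda>k. s (r k) x)" for x
  have [measurable]: "f \<in> borel_measurable M" unfolding f_def by measurable
  have lim: "AE x in M. (\<lambda>k. s (r k) x) \<longlonglongrightarrow> f x"
    using conv by eventually_elim (simp add: f_def convergent_LIMSEQ_iff)
  have D: "fun_lc 1 f (-1) (s j) \<in> L2 M \<and> l2_nrm M (fun_lc 1 f (-1) (s j)) \<le> (1 / 4) ^ n" if "j \<ge> r n" for j n
  proof (rule L2_fatou[where s = "\<lambda>k. fun_lc 1 (s (r k)) (-1) (s j)" and N = n])
    show "AE x in M. (\<lambda>k. fun_lc 1 (s (r k)) (-1) (s j) x) \<longlonglongrightarrow> fun_lc 1 f (-1) (s j) x"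
      using lim by eventually_elim (auto simp: fun_lc_def intro!: tendsto_intros)
    show "l2_nrm M (fun_lc 1 (s (r k)) (- 1) (s j)) \<le> (1 / 4) ^ n" if "k \<ge> n" for k
      using N0[of n "r k" j] rN[of n] r_mono[OF that] \<open>j \<ge> r n\<close> by (simp add: l2.dst_def)
  qed (auto simp: L2_fun_lc s, simp add: fun_lc_def)
  have "fun_lc 1 (fun_lc 1 f (-1) (s (r 0))) 1 (s (r 0)) \<in> L2 M"
    by (rule L2_fun_lc[OF conjunct1[OF D[of 0 "r 0"]] s]) simp
  then have f: "f \<in> L2 M" by (simp add: fun_lc_def)
  have "l2.lim_to M s f"
    unfolding l2.lim_to_def
  proof (rule LIMSEQ_I)
    fix e :: real assume "e > 0"
    then obtain n where n: "(1 / 4) ^ n < e" using real_arch_pow_inv[of e "1/4"] by auto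
    have "norm (l2_dst M (s j) f - 0) < e" if "j \<ge> r n" for j
    proof -
      have "l2_dst M (s j) f \<le> (1 / 4) ^ n"
        using D[OF that] by (subst l2.dst_sym[OF s f]) (simp add: l2.dst_def)
      then show ?thesis using n l2.dst_ge0[OF s f, of j] by simp
    qed
    then show "\<exists>N. \<forall>j\<ge>N. norm (l2_dst M (s j) f - 0) < e" by blast
  qed
  with f show ?thesis by blast
qed

interpretation l2: semi_hilbert "L2 M" fun_lc "l2_ip M" for M
  by standard (rule L2_complete)

subsection \<open>The Gaussian integral\<close>

lemma mu_basic [simp]: "sets (mu l) = sets borel" "space (mu l) = UNIV"
  by (simp_all add: mu_def)

lemma measurable_mu [simp]: "measurable (mu l) N = measurable borel N" "measurable N (mu l) = measurable N borel"
  by (auto intro!: measurable_cong_sets)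

lemma nn_integral_mu:
  fixes f :: "complex ^ 'n \<Rightarrow> ennreal"
  assumes [measurable]: "f \<in> borel_measurable borel"
  shows "(\<integral>\<^sup>+x. f x \<partial>mu l) = ennreal ((l / (2 * pi)) ^ CARD('n)) * (\<integral>\<^sup>+x. f x \<partial>lborel)"
  by (simp add: mu_def nn_integral_density nn_integral_cmult)

lemma sigma_finite_mu: "sigma_finite_measure (mu l :: (complex ^ 'n) measure)"
  unfolding mu_def by (subst sigma_finite_measure.sigma_finite_iff_density_finite[OF lborel.sigma_finite_measure_axioms]) auto

lemma gaussian_1d:
  assumes "l > 0"
  shows "(\<integral>\<^sup>+x. ennreal (exp (- l * x\<^sup>2 / 2)) \<partial>lborel) = ennreal (sqrt (2 * pi / l))"
proof -
  \<comment> \<open>Standard deviation of the normal density with exponent - l x^2 / 2.\<close>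
  define \<sigma> where "\<sigma> = sqrt (1 / l)"
  have s: "\<sigma>\<^sup>2 = 1 / l" "\<sigma> > 0" using assms by (simp_all add: \<sigma>_def)
  have nd: "exp (- l * x\<^sup>2 / 2) = sqrt (2 * pi / l) * normal_density 0 \<sigma> x" for x
    using assms by (simp add: normal_density_def s field_simps)
  have "(\<integral>\<^sup>+x. ennreal (normal_density 0 \<sigma> x) \<partial>lborel) = 1"
    using nn_integral_eq_integral[OF integrable_normal_density[OF s(2), of 0]] s(2)
    by (simp add: normal_density_nonneg)
  then show ?thesis
    unfolding nd using assms by (simp add: ennreal_mult' nn_integral_cmult normal_density_nonneg)
qed

text \<open>Each of the 2n real coordinates contributes \<open>sqrt (2 * pi / l)\<close>, which the
  normalisation of \<open>mu\<close> cancels.\<close>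

lemma gaussian_nn_integral:
  assumes l: "l > 0"
  shows "(\<integral>\<^sup>+z. ennreal (exp (- l * (norm (z :: complex ^ 'n))\<^sup>2 / 2)) \<partial>mu l) = 1"
    (is "(\<integral>\<^sup>+z. ?g z \<partial>_) = _")
proof -
  have n2: "(norm z)\<^sup>2 = (\<Sum>b\<in>Basis. (z \<bullet> b)\<^sup>2)" for z :: "complex ^ 'n"
    unfolding power2_norm_eq_inner euclidean_inner[of z z] by (simp add: power2_eq_square)
  have g: "?g z = (\<Prod>b\<in>Basis. ennreal (exp (- l * (z \<bullet> b)\<^sup>2 / 2)))" for z :: "complex ^ 'n"
    by (simp add: prod_ennreal exp_sum[symmetric] n2 sum_distrib_left sum_divide_distrib sum_negf)
  have "(\<integral>\<^sup>+z. ?g z \<partial>lborel) = (\<Prod>b\<in>(Basis :: (complex ^ 'n) set). \<integral>\<^sup>+x. ennreal (exp (- l * x\<^sup>2 / 2)) \<partial>lborel)"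
    unfolding g by (rule nn_integral_lborel_prod) auto
  also have "\<dots> = ennreal (sqrt (2 * pi / l)) ^ DIM(complex ^ 'n)"
    by (simp only: gaussian_1d[OF l] prod_constant)
  also have "\<dots> = ennreal ((2 * pi / l) ^ CARD('n))"
    using l by (simp add: ennreal_power power_mult mult.commute[of _ 2])
  finally have "(\<integral>\<^sup>+z. ?g z \<partial>mu l) = ennreal ((l / (2 * pi)) ^ CARD('n)) * ennreal ((2 * pi / l) ^ CARD('n))"
    by (subst nn_integral_mu) auto
  also have "\<dots> = 1"
    using l by (simp add: ennreal_mult[symmetric] power_mult_distrib[symmetric])
  finally show ?thesis .
qed

lemma gaussian_integrable:
  assumes "l > 0"
  shows "integrable (mu l) (\<lambda>z :: complex ^ 'n. exp (- l * (norm z)\<^sup>2 / 2))"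
proof (rule integrableI_nonneg)
  show "(\<integral>\<^sup>+z. ennreal (exp (- l * (norm (z :: complex ^ 'n))\<^sup>2 / 2)) \<partial>mu l) < \<infinity>"
    unfolding gaussian_nn_integral[OF assms] by simp
qed auto

lemma gaussian_integral:
  assumes "l > 0"
  shows "(LINT z|mu l. exp (- l * (norm (z :: complex ^ 'n))\<^sup>2 / 2)) = 1"
proof -
  have "ennreal (LINT z|mu l. exp (- l * (norm (z :: complex ^ 'n))\<^sup>2 / 2))
      = (\<integral>\<^sup>+z. ennreal (exp (- l * (norm (z :: complex ^ 'n))\<^sup>2 / 2)) \<partial>mu l)"
    by (rule nn_integral_eq_integral[OF gaussian_integrable[OF assms], symmetric]) simp
  also have "\<dots> = 1" by (rule gaussian_nn_integral[OF assms])
  finally show ?thesis by (simp only: ennreal_eq_1)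
qed

lemma mu_distr_affine:
  fixes T :: "complex ^ 'n \<Rightarrow> complex ^ 'n"
  assumes "linear T" "\<And>x. norm (T x) = norm x"
  shows "distr (mu l) (mu l) (\<lambda>x. T x + a) = mu l"
proof (rule measure_eqI)
  have [measurable]: "T \<in> borel_measurable borel"
    using linear_continuous_on[of T UNIV] assms
    by (simp add: linear_conv_bounded_linear borel_measurable_continuous_onI)
  fix A assume "A \<in> sets (distr (mu l) (mu l) (\<lambda>x. T x + a))"
  then have [measurable]: "A \<in> sets borel" by simp
  have "emeasure (distr (mu l) (mu l) (\<lambda>x. T x + a)) A
      = (\<integral>\<^sup>+x. indicator A x \<partial>distr (mu l) (mu l) (\<lambda>x. T x + a))" by simp
  also have "\<dots> = (\<integral>\<^sup>+x. indicator A (T x + a) \<partial>mu l)" by (rule nn_integral_distr) simp_all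
  also have "\<dots> = ennreal ((l / (2 * pi)) ^ CARD('n)) * (\<integral>\<^sup>+x. indicator A (T x + a) \<partial>lborel)"
    by (simp add: nn_integral_mu)
  also have "(\<integral>\<^sup>+x. indicator A (T x + a) \<partial>lborel) = (\<integral>\<^sup>+x. indicator A (x + a) \<partial>(distr lborel borel T))"
    by (simp add: nn_integral_distr)
  also have "\<dots> = (\<integral>\<^sup>+x. indicator A x \<partial>lborel)"
    unfolding lborel_distr_isometry[OF assms]
    using nn_integral_lborel_shift[of "indicator A" a] by (simp add: add.commute)
  also have "ennreal ((l / (2 * pi)) ^ CARD('n)) * \<dots> = emeasure (mu l) A"
    by (subst nn_integral_mu[symmetric]) simp_all
  finally show "emeasure (distr (mu l) (mu l) (\<lambda>x. T x + a)) A = emeasure (mu l) A" .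
qed simp

lemma mu_integral_affine:
  fixes T :: "complex ^ 'n \<Rightarrow> complex ^ 'n" and f :: "complex ^ 'n \<Rightarrow> 'b::{banach,second_countable_topology}"
  assumes "linear T" "\<And>x. norm (T x) = norm x" and f: "f \<in> borel_measurable borel"
  shows "(LINT x|mu l. f (T x + a)) = (LINT x|mu l. f x)"
    and "integrable (mu l) (\<lambda>x. f (T x + a)) \<longleftrightarrow> integrable (mu l) f"
proof -
  have [measurable]: "T \<in> borel_measurable borel"
    using linear_continuous_on[of T UNIV] assms
    by (simp add: linear_conv_bounded_linear borel_measurable_continuous_onI)
  note [measurable] = f
  show "(LINT x|mu l. f (T x + a)) = (LINT x|mu l. f x)"
    using integral_distr[of "\<lambda>x. T x + a" "mu l" "mu l" f] by (simp add: mu_distr_affine[OF assms(1,2)])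
  show "integrable (mu l) (\<lambda>x. f (T x + a)) \<longleftrightarrow> integrable (mu l) f"
    using integrable_distr_eq[of "\<lambda>x. T x + a" "mu l" "mu l" f] by (simp add: mu_distr_affine[OF assms(1,2)])
qed

section \<open>The Fock space\<close>

subsection \<open>The Hermitian pairing\<close>

abbreviation hdot :: "complex ^ 'n \<Rightarrow> complex ^ 'n \<Rightarrow> complex" where "hdot a z \<equiv> cdot (conjv a) z"

lemma hdot_eq: "hdot a z = (\<Sum>k\<in>UNIV. cnj (a $ k) * z $ k)"
  by (simp add: cdot_def conjv_def)

lemma hdot_algebra:
  "hdot (a + b) z = hdot a z + hdot b z" "hdot a (z + w) = hdot a z + hdot a w"
  "hdot (a - b) z = hdot a z - hdot b z" "hdot a (z - w) = hdot a z - hdot a w"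
  "hdot (- a) z = - hdot a z" "hdot a (- z) = - hdot a z"
  "hdot (c *s a) z = cnj c * hdot a z" "hdot a (c *s z) = c * hdot a z"
  "hdot (r *\<^sub>R a) z = of_real r * hdot a z" "hdot a (r *\<^sub>R z) = of_real r * hdot a z"
  "hdot 0 z = 0" "hdot a 0 = 0"
  by (simp_all add: hdot_eq algebra_simps sum.distrib sum_subtractf sum_negf sum_distrib_left
      scaleR_conv_of_real[where 'a = complex])

lemma cnj_hdot: "cnj (hdot a z) = hdot z a"
  by (simp add: hdot_eq mult.commute)

lemma cdot_conjv: "cdot z (conjv w) = hdot w z"
  by (simp add: cdot_def conjv_def mult.commute)

lemma hdot_self: "hdot z z = of_real ((norm z)\<^sup>2)"
proof -
  have "(norm z)\<^sup>2 = (\<Sum>k\<in>UNIV. (norm (z $ k))\<^sup>2)"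
    by (simp add: norm_vec_def L2_set_def sum_nonneg)
  then show ?thesis
    by (simp add: hdot_eq complex_norm_square mult.commute del: of_real_power)
qed

lemma norm_sq_hdot: "(norm z)\<^sup>2 = Re (hdot z z)"
  by (simp add: hdot_self)

lemma norm_sq_add: "(norm (z + w))\<^sup>2 = (norm z)\<^sup>2 + (norm w)\<^sup>2 + 2 * Re (hdot w z)"
  using arg_cong[OF cnj_hdot[of w z], of Re] by (simp add: norm_sq_hdot hdot_algebra)

lemma norm_sq_diff: "(norm (z - w))\<^sup>2 = (norm z)\<^sup>2 + (norm w)\<^sup>2 - 2 * Re (hdot w z)"
  using arg_cong[OF cnj_hdot[of w z], of Re] by (simp add: norm_sq_hdot hdot_algebra)

lemma hdot_cauchy_schwarz: "cmod (hdot a z) \<le> norm a * norm z"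
proof -
  have "cmod (hdot a z) \<le> (\<Sum>k\<in>UNIV. cmod (cnj (a $ k) * z $ k))"
    unfolding hdot_eq by (rule norm_sum)
  also have "\<dots> \<le> norm a * norm z"
    using L2_set_mult_ineq[of "\<lambda>k. cmod (a $ k)" "\<lambda>k. cmod (z $ k)" UNIV]
    by (simp add: norm_mult norm_vec_def)
  finally show ?thesis .
qed

lemma bounded_linear_hdot: "bounded_linear (hdot a)"
proof (rule bounded_linear_intro[where K = "norm a"])
  show "cmod (hdot a z) \<le> norm z * norm a" for z
    using hdot_cauchy_schwarz[of a z] by (simp add: mult.commute)
qed (simp_all add: hdot_algebra scaleR_conv_of_real[where 'a = complex])

lemma continuous_on_hdot [continuous_intros]:
  assumes "continuous_on S f" "continuous_on S g"
  shows "continuous_on S (\<lambda>x. hdot (f x) (g x))"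
  unfolding hdot_eq using assms by (intro continuous_intros)

lemma hdot_measurable [measurable (raw)]:
  assumes [measurable]: "f \<in> borel_measurable M" "g \<in> borel_measurable M"
  shows "(\<lambda>x. hdot (f x) (g x)) \<in> borel_measurable M"
proof -
  have "(\<lambda>p. hdot (fst p) (snd p)) \<in> borel_measurable borel"
    by (intro borel_measurable_continuous_onI continuous_intros)
  from measurable_compose[OF _ this, of "\<lambda>x. (f x, g x)" M] show ?thesis by simp
qed

lemma norm_smult: "norm (c *s z) = cmod c * norm (z :: complex ^ 'n)"
  by (simp add: norm_vec_def norm_mult L2_set_right_distrib)

subsection \<open>Entire functions\<close>

lemma entireI:
  assumes "\<And>z. (f has_derivative D z) (at z)" "\<And>z a v. D z (a *s v) = a * D z v"
  shows "entire f"
  using assms unfolding entire_def by blast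

lemma entireE:
  assumes "entire f"
  obtains D where "\<And>z. (f has_derivative D z) (at z)" "\<And>z a v. D z (a *s v) = a * D z v"
  using assms unfolding entire_def by metis

lemma entire_continuous: "entire f \<Longrightarrow> continuous_on UNIV f"
  by (erule entireE) (meson continuous_at_imp_continuous_on has_derivative_continuous)

lemma entire_measurable [measurable_dest]: "entire f \<Longrightarrow> f \<in> borel_measurable borel"
  by (intro borel_measurable_continuous_onI entire_continuous)

lemma entire_const: "entire (\<lambda>_. c)"
  by (rule entireI[where D = "\<lambda>_ _. 0"]) auto

lemma entire_mult:
  assumes "entire f" "entire g"
  shows "entire (\<lambda>z. f z * g z)"
proof -
  obtain D where D: "\<And>z. (f has_derivative D z) (at z)" "\<And>z a v. D z (a *s v) = a * D z v"
    using assms(1) by (rule entireE) auto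
  obtain D' where D': "\<And>z. (g has_derivative D' z) (at z)" "\<And>z a v. D' z (a *s v) = a * D' z v"
    using assms(2) by (rule entireE) auto
  show ?thesis
    by (rule entireI[OF has_derivative_mult[OF D(1) D'(1)]]) (simp add: D(2) D'(2) algebra_simps)
qed

lemma entire_lincomb:
  assumes "entire f" "entire g"
  shows "entire (\<lambda>z. a * f z + b * g z)"
proof -
  obtain D where D: "\<And>z. (f has_derivative D z) (at z)" "\<And>z a v. D z (a *s v) = a * D z v"
    using assms(1) by (rule entireE) auto
  obtain D' where D': "\<And>z. (g has_derivative D' z) (at z)" "\<And>z a v. D' z (a *s v) = a * D' z v"
    using assms(2) by (rule entireE) auto
  show ?thesis
    by (rule entireI[OF has_derivative_add[OF has_derivative_mult_right[OF D(1)] has_derivative_mult_right[OF D'(1)]]])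
      (simp add: D(2) D'(2) algebra_simps)
qed

lemma entire_compose_affine:
  fixes L :: "complex ^ 'n \<Rightarrow> complex ^ 'n"
  assumes f: "entire f" and L: "bounded_linear L" "\<And>a v. L (a *s v) = a *s L v"
  shows "entire (\<lambda>z. f (L z + c))"
proof -
  obtain D where D: "\<And>z. (f has_derivative D z) (at z)" "\<And>z a v. D z (a *s v) = a * D z v"
    using f by (rule entireE) auto
  have "((\<lambda>z. L z + c) has_derivative L) (at z)" for z
    using L(1) by (auto intro!: derivative_eq_intros bounded_linear_imp_has_derivative)
  then have "((\<lambda>z. f (L z + c)) has_derivative (\<lambda>v. D (L z + c) (L v))) (at z)" for z
    using has_derivative_compose D(1) by fast
  then show ?thesis by (rule entireI) (simp add: L(2) D(2))
qed

lemma entire_exp_hdot: "entire (\<lambda>z. exp (c * hdot a z + d))"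
proof (rule entireI[where D = "\<lambda>z v. exp (c * hdot a z + d) * (c * hdot a v)"])
  fix z
  have "((\<lambda>z. c * hdot a z + d) has_derivative (\<lambda>v. c * hdot a v)) (at z)"
    by (intro has_derivative_add_const has_derivative_mult_right bounded_linear_imp_has_derivative
        bounded_linear_hdot)
  from has_derivative_compose[OF this DERIV_exp[unfolded has_field_derivative_def]]
  show "((\<lambda>z. exp (c * hdot a z + d)) has_derivative (\<lambda>v. exp (c * hdot a z + d) * (c * hdot a v))) (at z)"
    by (simp add: mult.commute)
qed (simp add: hdot_algebra)

lemma entire_line:
  assumes "entire f"
  shows "(\<lambda>\<zeta>. f (\<zeta> *s w)) holomorphic_on S"
proof -
  obtain D where D: "\<And>z. (f has_derivative D z) (at z)" "\<And>z a v. D z (a *s v) = a * D z v"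
    using assms by (rule entireE) auto
  have "bounded_linear (\<lambda>h. h *s w)"
    by (rule bounded_linear_intro[where K = "norm w"])
      (simp_all add: norm_smult vector_sadd_rdistrib vec_eq_iff)
  then have "((\<lambda>h. h *s w) has_derivative (\<lambda>h. h *s w)) (at \<zeta>)" for \<zeta>
    by (rule bounded_linear_imp_has_derivative)
  then have "((\<lambda>\<zeta>. f (\<zeta> *s w)) has_derivative (\<lambda>h. D (\<zeta> *s w) (h *s w))) (at \<zeta>)" for \<zeta>
    using has_derivative_compose D(1) by fast
  then have "((\<lambda>\<zeta>. f (\<zeta> *s w)) has_field_derivative D (\<zeta> *s w) w) (at \<zeta>)" for \<zeta>
    by (simp add: has_field_derivative_def D(2) mult.commute[of _ "D _ w"])
  then show ?thesis
    by (auto simp: holomorphic_on_def field_differentiable_def intro: has_field_derivative_at_within)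
qed

text \<open>Cauchy's integral formula at the centre of the unit circle, for the one-variable
  function \<zeta> -> f (\<zeta> w).\<close>

lemma circle_mean:
  assumes "entire f"
  shows "(LINT t:{0..1}|lborel. f (exp (2 * of_real pi * \<i> * of_real t) *s w)) = f 0"
proof -
  let ?g = "\<lambda>t::real. f (exp (2 * of_real pi * \<i> * of_real t) *s w)"
  have "((\<lambda>u. f (u *s w) / (u - 0)) has_contour_integral (2 * of_real pi * \<i> * f (0 *s w))) (circlepath 0 1)"
    by (rule Cauchy_integral_circlepath_simple) (simp_all add: entire_line[OF assms])
  then have "((\<lambda>x. f (circlepath 0 1 x *s w) / (circlepath 0 1 x - 0)
      * vector_derivative (circlepath 0 1) (at x)) has_integral (2 * of_real pi * \<i> * f 0)) {0..1}"
    unfolding has_contour_integral by (simp only: vector_smult_lzero)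
  then have "((\<lambda>t. 2 * of_real pi * \<i> * ?g t) has_integral (2 * of_real pi * \<i> * f 0)) {0..1}"
    by (rule has_integral_eq[rotated]) (simp add: vector_derivative_circlepath, simp add: circlepath)
  then have "((\<lambda>t. inverse (2 * of_real pi * \<i>) * (2 * of_real pi * \<i> * ?g t))
      has_integral inverse (2 * of_real pi * \<i>) * (2 * of_real pi * \<i> * f 0)) {0..1}"
    by (rule has_integral_mult_right)
  then have hi: "(?g has_integral f 0) {0..1}" by (simp add: field_simps)
  have "continuous_on UNIV (\<lambda>t::real. exp (2 * of_real pi * \<i> * of_real t) *s w)"
    unfolding vector_scalar_mult_def by (intro continuous_intros)
  then have "continuous_on {0..1} ?g"
    using continuous_on_compose2[OF entire_continuous[OF assms]] continuous_on_subset by blast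
  then have s: "set_integrable lborel {0..1} ?g" by (rule borel_integrable_atLeastAtMost')
  show "(LINT t:{0..1}|lborel. ?g t) = f 0"
    unfolding set_borel_integral_eq_integral(2)[OF s] using hi by (rule integral_unique)
qed

lemma mu_integral_exp_rotate:
  fixes f :: "complex ^ 'n \<Rightarrow> 'b::{banach,second_countable_topology}"
  assumes "cmod c = 1" "f \<in> borel_measurable borel"
  shows "(LINT w|mu l. f (c *s w)) = (LINT w|mu l. f w)"
    "integrable (mu l) (\<lambda>w. f (c *s w)) \<longleftrightarrow> integrable (mu l) f"
proof -
  have "linear (\<lambda>w. c *s w)"
    by (rule linearI) (simp_all add: vector_add_ldistrib vec_eq_iff)
  then show "(LINT w|mu l. f (c *s w)) = (LINT w|mu l. f w)"
    "integrable (mu l) (\<lambda>w. f (c *s w)) \<longleftrightarrow> integrable (mu l) f"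
    using mu_integral_affine[of "\<lambda>w. c *s w" f l 0] assms by (simp_all add: norm_smult)
qed

text \<open>Measure and weight are invariant under multiplication of w by exp(2 pi i t). Averaging
  over t and exchanging the integrals replaces f by its circle means, all equal to
  \<open>f 0\<close>, against a Gaussian of total mass 1.\<close>

lemma mean_value:
  fixes f :: "complex ^ 'n \<Rightarrow> complex"
  assumes l: "l > 0" and f: "entire f"
    and int: "integrable (mu l) (\<lambda>w. f w * of_real (exp (- l * (norm w)\<^sup>2 / 2)))"
  shows "(LINT w|mu l. f w * of_real (exp (- l * (norm w)\<^sup>2 / 2))) = f 0"
proof -
  let ?e = "\<lambda>t::real. exp (2 * complex_of_real pi * \<i> * of_real t)"
  let ?w = "\<lambda>w :: complex ^ 'n. complex_of_real (exp (- l * (norm w)\<^sup>2 / 2))"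
  have e1: "cmod (?e t) = 1" for t by (simp add: norm_exp_eq_Re)
  note [measurable] = entire_measurable[OF f]
  interpret sf: sigma_finite_measure "mu l :: (complex ^ 'n) measure" by (rule sigma_finite_mu)
  interpret pair_sigma_finite lborel "mu l :: (complex ^ 'n) measure" ..
  define F where "F = (\<lambda>(t, w). indicator {0..1} t *\<^sub>R (f (?e t *s w) * ?w w))"
  have inner: "integrable (mu l) (\<lambda>w. F (t, w))"
    "(LINT w|mu l. F (t, w)) = indicator {0..1} t *\<^sub>R (LINT w|mu l. f w * ?w w)"
    "(LINT w|mu l. norm (F (t, w))) = indicator {0..1} t *\<^sub>R (LINT w|mu l. norm (f w * ?w w))" for t
    using mu_integral_exp_rotate[OF e1, of "\<lambda>w. f w * ?w w" l t]
      mu_integral_exp_rotate[OF e1, of "\<lambda>w. norm (f w * ?w w)" l t] int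
    by (auto simp: F_def norm_smult e1 indicator_def)
  have cont: "continuous_on UNIV (\<lambda>p. ?e (fst p) *s snd p)"
    unfolding vector_scalar_mult_def by (intro continuous_intros)
  have "(\<lambda>p. f (?e (fst p) *s snd p)) \<in> borel_measurable borel"
    by (intro borel_measurable_continuous_onI continuous_on_compose2[OF entire_continuous[OF f] cont]) simp
  moreover have "sets (lborel \<Otimes>\<^sub>M mu l) = sets (borel :: (real \<times> (complex ^ 'n)) measure)"
    using sets_pair_measure_cong[of "lborel :: real measure" borel "mu l :: (complex ^ 'n) measure" borel]
    unfolding borel_prod by simp
  ultimately have m1: "(\<lambda>p. f (?e (fst p) *s snd p)) \<in> borel_measurable (lborel \<Otimes>\<^sub>M mu l)"
    using measurable_cong_sets by blast
  have m2: "(\<lambda>p. ?w (snd p)) \<in> borel_measurable (lborel \<Otimes>\<^sub>M mu l)"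
    by (rule measurable_compose[OF measurable_snd]) simp
  have m3: "(\<lambda>p. indicator {0..1::real} (fst p) :: real) \<in> borel_measurable (lborel \<Otimes>\<^sub>M (mu l :: (complex ^ 'n) measure))"
    by (rule measurable_compose[OF measurable_fst], rule borel_measurable_indicator) simp
  have Fm: "F \<in> borel_measurable (lborel \<Otimes>\<^sub>M mu l)"
    unfolding F_def case_prod_beta using m1 m2 m3 by measurable
  have Fint: "integrable (lborel \<Otimes>\<^sub>M mu l) F"
  proof (rule Fubini_integrable[OF Fm])
    show "integrable lborel (\<lambda>t. LINT w|mu l. norm (F (t, w)))"
      unfolding inner(3) by (rule integrable_scaleR_left) (simp add: integrable_indicator_iff)
  qed (simp add: inner(1))
  have Fint': "integrable (lborel \<Otimes>\<^sub>M mu l) (\<lambda>(t, w). F (t, w))" using Fint by simp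
  have "(LINT w|mu l. f 0 * ?w w) = (LINT w|mu l. LINT t|lborel. F (t, w))"
  proof (rule Bochner_Integration.integral_cong[OF refl])
    fix w
    have "(LINT t|lborel. F (t, w)) = (LINT t|lborel. (indicator {0..1} t *\<^sub>R f (?e t *s w)) * ?w w)"
      by (simp add: F_def)
    also have "\<dots> = (LINT t|lborel. indicator {0..1} t *\<^sub>R f (?e t *s w)) * ?w w"
      by (rule integral_mult_left_zero)
    also have "\<dots> = f 0 * ?w w"
      using circle_mean[OF f, of w] by (simp add: set_lebesgue_integral_def)
    finally show "f 0 * ?w w = (LINT t|lborel. F (t, w))" ..
  qed
  also have "\<dots> = (LINT t|lborel. LINT w|mu l. F (t, w))"
    using Fubini_integral[OF Fint'] .
  also have "\<dots> = (LINT w|mu l. f w * ?w w)"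
    unfolding inner(2) by simp
  finally show ?thesis
    using gaussian_integral[OF l, where 'n = 'n] gaussian_integrable[OF l, where 'n = 'n] by simp
qed

subsection \<open>Reproducing property\<close>

text \<open>Multiplication by the square root of the weight embeds the Fock space isometrically in
  the unweighted \<open>L2 (mu l)\<close>, where completeness is available.\<close>

definition wt :: "real \<Rightarrow> (complex ^ 'n \<Rightarrow> complex) \<Rightarrow> complex ^ 'n \<Rightarrow> complex" where
  "wt l f = (\<lambda>z. f z * of_real (exp (- l * (norm z)\<^sup>2 / 4)))"

lemma wt_measurable [measurable]: "f \<in> borel_measurable borel \<Longrightarrow> wt l f \<in> borel_measurable borel"
  by (simp add: wt_def)

lemma exp_half: "exp (- l * x / 4) * exp (- l * x / 4) = exp (- l * x / 2 :: real)"
  by (simp add: exp_add[symmetric])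

lemma cmod_wt_sq: "(cmod (wt l f z))\<^sup>2 = (cmod (f z))\<^sup>2 * exp (- l * (norm z)\<^sup>2 / 2)"
  unfolding exp_half[symmetric] by (simp add: wt_def norm_mult power_mult_distrib power2_eq_square)

lemma fock_iff: "f \<in> fock l \<longleftrightarrow> entire f \<and> wt l f \<in> L2 (mu l)"
  using entire_measurable[of f] by (auto simp: fock_def L2_def cmod_wt_sq)

lemma fock_entire: "f \<in> fock l \<Longrightarrow> entire f"
  and fock_wt: "f \<in> fock l \<Longrightarrow> wt l f \<in> L2 (mu l)"
  by (simp_all add: fock_iff)

lemma fock_inner_eq: "fock_inner l f g = l2_ip (mu l) (wt l f) (wt l g)"
proof -
  have "f z * cnj (g z) * complex_of_real (exp (- l * (norm z)\<^sup>2 / 2)) = wt l f z * cnj (wt l g z)" for z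
    unfolding exp_half[symmetric] by (simp add: wt_def)
  then show ?thesis by (simp add: fock_inner_def l2_ip_def)
qed

lemma wt_lc: "wt l (fun_lc a f b g) = fun_lc a (wt l f) b (wt l g)"
  by (simp add: wt_def fun_lc_def fun_eq_iff algebra_simps)

lemma fock_lc:
  assumes "f \<in> fock l" "g \<in> fock l"
  shows "fun_lc a f b g \<in> fock l"
  using entire_lincomb[of f g a b] L2_fun_lc[of "wt l f" "mu l" "wt l g" a b] assms
  unfolding fock_iff wt_lc by (simp add: fun_lc_def)

lemma mu_integrable_iff:
  fixes f :: "complex ^ 'n \<Rightarrow> 'b::{banach,second_countable_topology}"
  assumes "l > 0" "f \<in> borel_measurable borel"
  shows "integrable (mu l) f \<longleftrightarrow> integrable lborel f"
    and "(LINT x|mu l. f x) = ((l / (2 * pi)) ^ CARD('n)) *\<^sub>R (LINT x|lborel. f x)"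
proof -
  define c where "c = (l / (2 * pi)) ^ CARD('n)"
  have c: "c > 0" using assms by (simp add: c_def)
  have "integrable lborel (\<lambda>x. c *\<^sub>R f x) \<longleftrightarrow> integrable lborel f"
    using integrable_scaleR_right[of "inverse c" lborel "\<lambda>x. c *\<^sub>R f x"] c by auto
  then show "integrable (mu l) f \<longleftrightarrow> integrable lborel f"
    unfolding mu_def c_def[symmetric] using c assms(2) by (subst integrable_density) auto
  show "(LINT x|mu l. f x) = ((l / (2 * pi)) ^ CARD('n)) *\<^sub>R (LINT x|lborel. f x)"
    unfolding mu_def c_def[symmetric] using c assms(2) by (subst integral_density) auto
qed

lemma gaussian_integrable_mu:
  assumes "l > 0" "c > 0"
  shows "integrable (mu l) (\<lambda>z :: complex ^ 'n. exp (- c * (norm z)\<^sup>2 / 2))"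
  using gaussian_integrable[OF assms(2), where 'n = 'n] assms
  by (subst mu_integrable_iff) (auto simp: mu_integrable_iff)

text \<open>Since \<open>d x \<le> d\<^sup>2 / l + l x\<^sup>2 / 4\<close>, exponential growth is absorbed by the Gaussian weight.\<close>

lemma exp_weight_L2:
  assumes "l > 0"
  shows "(\<lambda>z :: complex ^ 'n. of_real (exp (d * norm z - l * (norm z)\<^sup>2 / 4))) \<in> L2 (mu l)"
proof -
  have bd: "(exp (d * x - l * x\<^sup>2 / 4))\<^sup>2 \<le> exp (4 * d\<^sup>2 / l) * exp (- (l / 2) * x\<^sup>2 / 2)" for x
  proof -
    have "0 \<le> (2 * d / sqrt l - sqrt l * x / 2)\<^sup>2" by simp
    also have "(2 * d / sqrt l - sqrt l * x / 2)\<^sup>2 = 4 * d\<^sup>2 / l + l * x\<^sup>2 / 4 - 2 * d * x"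
      using assms by (simp add: power2_diff power_divide power_mult_distrib)
    finally have "2 * (d * x - l * x\<^sup>2 / 4) \<le> 4 * d\<^sup>2 / l + - (l / 2) * x\<^sup>2 / 2"
      by simp
    then have "exp (2 * (d * x - l * x\<^sup>2 / 4)) \<le> exp (4 * d\<^sup>2 / l + - (l / 2) * x\<^sup>2 / 2)"
      by (simp only: exp_le_cancel_iff)
    then show ?thesis by (simp only: exp_add exp_double[symmetric])
  qed
  have "integrable (mu l) (\<lambda>z :: complex ^ 'n. (exp (d * norm z - l * (norm z)\<^sup>2 / 4))\<^sup>2)"
  proof (rule Bochner_Integration.integrable_bound)
    show "integrable (mu l) (\<lambda>z :: complex ^ 'n. exp (4 * d\<^sup>2 / l) * exp (- (l / 2) * (norm z)\<^sup>2 / 2))"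
      using gaussian_integrable_mu[OF assms, of "l / 2", where 'n = 'n] assms by simp
    show "AE z :: complex ^ 'n in mu l. norm ((exp (d * norm z - l * (norm z)\<^sup>2 / 4))\<^sup>2)
        \<le> norm (exp (4 * d\<^sup>2 / l) * exp (- (l / 2) * (norm z)\<^sup>2 / 2))"
      using bd by auto
  qed simp
  then show ?thesis by (simp add: L2_def)
qed

lemma L2_boundI:
  assumes "g \<in> L2 M" "f \<in> borel_measurable M" "\<And>x. cmod (f x) \<le> cmod (g x)"
  shows "f \<in> L2 M"
proof -
  have "integrable M (\<lambda>x. (cmod (f x))\<^sup>2)"
    using assms by (intro Bochner_Integration.integrable_bound[OF L2_integrable[OF assms(1)]])
      (auto intro!: power_mono)
  with assms(2) show ?thesis by (simp add: L2_def)
qed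

lemma coherent_eq: "coherent l a = (\<lambda>z. exp (of_real (l / 2) * hdot a z))"
  by (simp add: coherent_def)

lemma entire_coherent: "entire (coherent l a)"
  using entire_exp_hdot[of "of_real (l / 2)" a 0] by (simp add: coherent_eq)

lemma coherent_fock:
  assumes "l > 0" shows "coherent l a \<in> fock l"
  unfolding fock_iff
proof
  show "wt l (coherent l a) \<in> L2 (mu l)"
  proof (rule L2_boundI[OF exp_weight_L2[OF assms, of "l / 2 * norm a"]])
    fix z
    have "Re (hdot a z) \<le> norm a * norm z"
      using hdot_cauchy_schwarz[of a z] complex_Re_le_cmod order_trans by blast
    then have "l / 2 * Re (hdot a z) \<le> l / 2 * norm a * norm z"
      using assms by (simp add: mult_left_mono mult.assoc)
    then show "cmod (wt l (coherent l a) z)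
      \<le> cmod (complex_of_real (exp (l / 2 * norm a * norm z - l * (norm z)\<^sup>2 / 4)))"
      by (simp add: wt_def coherent_eq norm_mult exp_add[symmetric])
  qed (simp add: wt_measurable entire_measurable[OF entire_coherent])
qed (rule entire_coherent)

lemma gauss_exp: "complex_of_real (exp (- l * (norm z)\<^sup>2 / 2)) = exp (of_real (- l / 2) * hdot z z)"
  by (simp add: exp_of_real[symmetric] hdot_self)

lemma cnj_coherent: "cnj (coherent l a z) = coherent l z a"
  by (simp add: coherent_eq exp_cnj cnj_hdot)

text \<open>Translation by a reduces this to the mean value property at the origin: the kernel and
  the shifted weight combine into the centred weight times the entire function g below, for which
  \<open>g 0 = f a\<close>.\<close>

lemma reproducing:
  fixes f :: "complex ^ 'n \<Rightarrow> complex"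
  assumes l: "l > 0" and f: "f \<in> fock l"
  shows "fock_inner l f (coherent l a) = f a"
proof -
  note e = fock_entire[OF f]
  note [measurable] = entire_measurable[OF e] entire_measurable[OF entire_coherent]
  define g where "g z = f (z + a) * exp (of_real (- l / 2) * hdot a z)" for z
  have eg: "entire g"
    unfolding g_def using entire_compose_affine[OF e bounded_linear_ident, of a]
      entire_exp_hdot[of "of_real (- l / 2)" a 0] by (intro entire_mult) simp_all
  let ?h = "\<lambda>z. wt l f z * cnj (wt l (coherent l a) z)"
  have h: "g z * of_real (exp (- l * (norm z)\<^sup>2 / 2)) = ?h (z + a)" for z
  proof -
    have "g z * of_real (exp (- l * (norm z)\<^sup>2 / 2))
        = f (z + a) * exp (of_real (- l / 2) * (hdot a z + hdot z z))"
      unfolding gauss_exp g_def by (simp add: exp_add[symmetric] algebra_simps)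
    also have "of_real (- l / 2) * (hdot a z + hdot z z)
        = of_real (l / 2) * hdot (z + a) a + of_real (- l / 2) * hdot (z + a) (z + a)"
      by (simp add: hdot_algebra algebra_simps)
    also have "exp \<dots> = coherent l (z + a) a * of_real (exp (- l * (norm (z + a))\<^sup>2 / 2))"
      unfolding gauss_exp coherent_eq by (rule exp_add)
    also have "f (z + a) * \<dots> = ?h (z + a)"
      unfolding exp_half[symmetric] by (simp add: wt_def cnj_coherent mult_ac)
    finally show ?thesis .
  qed
  have "integrable (mu l) ?h"
    by (intro L2_mult_integrable fock_wt f coherent_fock l)
  then have "integrable (mu l) (\<lambda>z. ?h (z + a))"
    using mu_integral_affine(2)[of "\<lambda>z. z" ?h l a] by (simp add: linear_ident)
  then have "(LINT z|mu l. ?h (z + a)) = g 0"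
    unfolding h[symmetric] by (rule mean_value[OF l eg])
  moreover have "(LINT z|mu l. ?h (z + a)) = (LINT z|mu l. ?h z)"
    using mu_integral_affine(1)[of "\<lambda>z. z" ?h l a] by (simp add: linear_ident)
  ultimately show ?thesis
    by (simp add: fock_inner_eq l2_ip_def g_def hdot_algebra)
qed

text \<open>Controls the remainder when a parameter integral is differentiated: p and q are the
  integrands at two parameters, r is the candidate derivative.\<close>

lemma integral_diff_bound:
  fixes A p q r :: "'a \<Rightarrow> complex" and Q :: "'a \<Rightarrow> real"
  assumes p: "integrable M (\<lambda>w. A w * p w)" and q: "integrable M (\<lambda>w. A w * q w)"
    and r: "integrable M (\<lambda>w. A w * r w)" and Q: "integrable M (\<lambda>w. norm (A w * of_real (Q w)))"
    and bd: "\<And>w. norm (p w - q w - r w) \<le> c * Q w"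
  shows "norm ((LINT w|M. A w * p w) - (LINT w|M. A w * q w) - (LINT w|M. A w * r w))
    \<le> (LINT w|M. norm (A w * of_real (Q w))) * \<bar>c\<bar>"
proof -
  have i: "integrable M (\<lambda>w. A w * p w - A w * q w - A w * r w)"
    by (intro Bochner_Integration.integrable_diff p q r)
  have "(LINT w|M. A w * p w) - (LINT w|M. A w * q w) - (LINT w|M. A w * r w)
      = (LINT w|M. A w * p w - A w * q w - A w * r w)"
    using p q r by simp
  also have "norm \<dots> \<le> (LINT w|M. norm (A w * p w - A w * q w - A w * r w))"
    by (rule integral_norm_bound)
  also have "\<dots> \<le> (LINT w|M. norm (A w * of_real (Q w)) * \<bar>c\<bar>)"
  proof (rule integral_mono)
    fix w
    have "A w * p w - A w * q w - A w * r w = A w * (p w - q w - r w)" by (simp add: algebra_simps)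
    then have "norm (A w * p w - A w * q w - A w * r w) = norm (A w) * norm (p w - q w - r w)"
      by (simp only: norm_mult)
    also have "\<dots> \<le> norm (A w) * (\<bar>c\<bar> * \<bar>Q w\<bar>)"
      using bd[of w] by (intro mult_left_mono) (auto simp flip: abs_mult)
    also have "\<dots> = norm (A w * of_real (Q w)) * \<bar>c\<bar>" by (simp add: norm_mult)
    finally show "norm (A w * p w - A w * q w - A w * r w) \<le> norm (A w * of_real (Q w)) * \<bar>c\<bar>" .
  qed (intro integrable_norm i integrable_mult_left Q)+
  finally show ?thesis by simp
qed

text \<open>This function is the orthogonal projection of \<open>F\<close> onto the Fock space.\<close>

lemma entire_projection:
  fixes F :: "complex ^ 'n \<Rightarrow> complex"
  assumes l: "l > 0" and F: "F \<in> L2 (mu l)"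
  shows "entire (\<lambda>z. l2_ip (mu l) F (wt l (coherent l z)))"
proof -
  let ?G = "\<lambda>w. complex_of_real (exp (- l * (norm w)\<^sup>2 / 4))"
  let ?u = "\<lambda>w z. of_real (l / 2) * hdot w z"
  \<comment> \<open>The derivative computed formally under the integral sign.\<close>
  define D where "D z v = (LINT w|mu l. F w * ?G w * exp (?u w z) * ?u w v)" for z v :: "complex ^ 'n"
  note [measurable] = L2_measurable[OF F, simplified]
  have u_bd: "cmod (?u w v) \<le> l / 2 * norm v * norm w" for w v
    using hdot_cauchy_schwarz[of w v] l by (simp add: norm_mult mult_ac)
  have exp_u: "cmod (exp (?u w z)) \<le> exp (l / 2 * norm z * norm w)" for w z
    using u_bd[of w z] complex_Re_le_cmod[of "?u w z"] by (simp del: Re_divide_of_nat)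
  have P: "l2_ip (mu l) F (wt l (coherent l z)) = (LINT w|mu l. F w * ?G w * exp (?u w z))" for z
    unfolding l2_ip_def by (simp add: wt_def cnj_coherent) (simp add: coherent_eq mult_ac)
  have pw: "x ^ k \<le> exp (real k * x)" if "x \<ge> 0" for x :: real and k
    using power_mono[of x "exp x" k] that exp_ge_add_one_self[of x] by (simp add: exp_of_nat_mult)
  \<comment> \<open>The Gaussian factor absorbs polynomial and exponential growth, so every integral
    below exists.\<close>
  have L: "integrable (mu l) (\<lambda>w. F w * ?G w * q w)"
    if [measurable]: "q \<in> borel_measurable borel"
      and q: "\<And>w. cmod (q w) \<le> C * (norm w ^ k * exp (c * norm w))" and C: "0 \<le> C" for q C k c
  proof -
    have "(\<lambda>w. of_real C * of_real (exp ((c + real k) * norm w - l * (norm w)\<^sup>2 / 4))) \<in> L2 (mu l)"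
      using L2_fun_lc[OF exp_weight_L2[OF l] exp_weight_L2[OF l], of "of_real C" "c + real k" 0 "c + real k"]
      by (simp add: fun_lc_def)
    then have "(\<lambda>w. ?G w * q w) \<in> L2 (mu l)"
    proof (rule L2_boundI)
      fix w :: "complex ^ 'n"
      have "cmod (?G w * q w) \<le> exp (- l * (norm w)\<^sup>2 / 4) * (C * (norm w ^ k * exp (c * norm w)))"
        unfolding norm_mult by (intro mult_mono q) auto
      also have "\<dots> \<le> exp (- l * (norm w)\<^sup>2 / 4) * (C * (exp (real k * norm w) * exp (c * norm w)))"
        by (intro mult_left_mono mult_right_mono pw C) auto
      also have "\<dots> = C * exp ((c + real k) * norm w - l * (norm w)\<^sup>2 / 4)"
        by (simp add: exp_add[symmetric] algebra_simps)
      finally show "cmod (?G w * q w)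
        \<le> cmod (of_real C * complex_of_real (exp ((c + real k) * norm w - l * (norm w)\<^sup>2 / 4)))"
        using C by (simp add: norm_mult)
    qed simp
    from L2_mult_integrable(1)[OF F this] show ?thesis by (simp add: mult.assoc)
  qed
  have intD: "integrable (mu l) (\<lambda>w. F w * ?G w * exp (?u w z) * ?u w v)" for z v
  proof -
    have "integrable (mu l) (\<lambda>w. F w * ?G w * (exp (?u w z) * ?u w v))"
    proof (rule L[of _ "l / 2 * norm v" 1 "l / 2 * norm z"])
      fix w
      have "cmod (exp (?u w z) * ?u w v) \<le> exp (l / 2 * norm z * norm w) * (l / 2 * norm v * norm w)"
        unfolding norm_mult[of "exp _"] by (intro mult_mono exp_u u_bd) auto
      then show "cmod (exp (?u w z) * ?u w v) \<le> l / 2 * norm v * (norm w ^ 1 * exp (l / 2 * norm z * norm w))"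
        by (simp add: mult_ac)
    qed (use l in auto)
    then show ?thesis by (simp add: mult.assoc)
  qed
  have intP: "integrable (mu l) (\<lambda>w. F w * ?G w * exp (?u w z))" for z
    by (rule L[of _ 1 0 "l / 2 * norm z"]) (use exp_u[of _ z] in auto)
  \<comment> \<open>Integrates the bound on the second-order Taylor remainder of the exponential,
    valid for v of norm at most 1, with the factor |v|^2 taken out.\<close>
  define K where "K z = (LINT w|mu l. norm (F w * ?G w * of_real ((l / 2)\<^sup>2 * (norm w ^ 2 * exp ((l / 2 * norm z + l / 2) * norm w)))))"
    for z :: "complex ^ 'n"
  have intK: "integrable (mu l) (\<lambda>w. norm (F w * ?G w * of_real ((l / 2)\<^sup>2 * (norm w ^ 2 * exp ((l / 2 * norm z + l / 2) * norm w)))))" for z :: "complex ^ 'n"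
    by (intro integrable_norm L[of _ "(l / 2)\<^sup>2" 2 "l / 2 * norm z + l / 2"])
      (use l in \<open>auto simp: norm_mult norm_power norm_divide\<close>)
  have rem: "cmod ((LINT w|mu l. F w * ?G w * exp (?u w (z + v))) - (LINT w|mu l. F w * ?G w * exp (?u w z)) - D z v)
      \<le> K z * (norm v)\<^sup>2" if v: "norm v \<le> 1" for z v
  proof -
    have pt: "cmod (exp (?u w (z + v)) - exp (?u w z) - exp (?u w z) * ?u w v)
        \<le> (norm v)\<^sup>2 * ((l / 2)\<^sup>2 * (norm w ^ 2 * exp ((l / 2 * norm z + l / 2) * norm w)))" for w
    proof -
      let ?x = "?u w v"
      have "exp (?u w (z + v)) - exp (?u w z) - exp (?u w z) * ?x = exp (?u w z) * (exp ?x - (1 + ?x))"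
        by (simp add: hdot_algebra distrib_left exp_add algebra_simps)
      then have "cmod (exp (?u w (z + v)) - exp (?u w z) - exp (?u w z) * ?x)
          = cmod (exp (?u w z)) * cmod (exp ?x - (1 + ?x))" by (simp only: norm_mult)
      also have "\<dots> \<le> exp (l / 2 * norm z * norm w) * (exp (l / 2 * norm w) * (l / 2 * norm v * norm w)\<^sup>2)"
      proof (intro mult_mono exp_u)
        have "cmod (exp ?x - (1 + ?x)) \<le> exp (cmod ?x) * (cmod ?x)\<^sup>2"
          using Taylor_exp_field[of ?x 1] by (simp add: power2_eq_square)
        also have "\<dots> \<le> exp (l / 2 * norm w) * (l / 2 * norm v * norm w)\<^sup>2"
        proof (intro mult_mono power_mono u_bd)
          have "l / 2 * norm v * norm w \<le> l / 2 * 1 * norm w"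
            using l v by (intro mult_right_mono mult_left_mono) auto
          then show "exp (cmod ?x) \<le> exp (l / 2 * norm w)" using u_bd[of w v] by simp
        qed auto
        finally show "cmod (exp ?x - (1 + ?x)) \<le> exp (l / 2 * norm w) * (l / 2 * norm v * norm w)\<^sup>2" .
      qed auto
      also have "\<dots> = (norm v)\<^sup>2 * ((l / 2)\<^sup>2 * (norm w ^ 2 * exp ((l / 2 * norm z + l / 2) * norm w)))"
      proof -
        have "exp ((l / 2 * norm z + l / 2) * norm w) = exp (l / 2 * norm z * norm w) * exp (l / 2 * norm w)"
          by (simp add: exp_add[symmetric] algebra_simps)
        then show ?thesis by (simp only: power_mult_distrib mult_ac)
      qed
      finally show ?thesis .
    qed
    have intD': "integrable (mu l) (\<lambda>w. F w * ?G w * (exp (?u w z) * ?u w v))"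
      using intD[of z v] by (simp only: mult.assoc)
    have Deq: "D z v = (LINT w|mu l. F w * ?G w * (exp (?u w z) * ?u w v))"
      unfolding D_def by (simp only: mult.assoc)
    show ?thesis
      using integral_diff_bound[OF intP[of "z + v"] intP[of z] intD' intK[of z] pt]
      unfolding abs_power2 K_def Deq .
  qed
  have K0: "0 \<le> K z" for z unfolding K_def by (intro Bochner_Integration.integral_nonneg) simp
  show ?thesis
    unfolding P
  proof (rule entireI[where D = D])
    fix z
    show "((\<lambda>z. LINT w|mu l. F w * ?G w * exp (?u w z)) has_derivative D z) (at z)"
      unfolding has_derivative_at
    proof
      show "bounded_linear (D z)"
      proof (rule bounded_linear_intro[where K = "LINT w|mu l. norm (F w * ?G w * (exp (?u w z) * of_real (l / 2 * norm w)))"])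
        show "D z (v + v') = D z v + D z v'" for v v'
          unfolding D_def using intD[of z v] intD[of z v']
          by (simp add: hdot_algebra distrib_left)
        show "D z (r *\<^sub>R v) = r *\<^sub>R D z v" for r v
          unfolding D_def scaleR_conv_of_real[where 'a = complex] hdot_algebra
          by (subst integral_mult_right_zero[symmetric]) (simp add: mult_ac)
        have i2: "integrable (mu l) (\<lambda>w. norm (F w * ?G w * (exp (?u w z) * of_real (l / 2 * norm w))))"
        proof (intro integrable_norm L[of _ "l / 2" 1 "l / 2 * norm z"])
          fix w :: "complex ^ 'n"
          show "cmod (exp (?u w z) * of_real (l / 2 * norm w)) \<le> l / 2 * (norm w ^ 1 * exp (l / 2 * norm z * norm w))"
            using mult_right_mono[OF exp_u[of w z], of "l / 2 * norm w"] l
            by (simp add: norm_mult mult_ac)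
        qed (use l in auto)
        show "cmod (D z v) \<le> norm v * (LINT w|mu l. norm (F w * ?G w * (exp (?u w z) * of_real (l / 2 * norm w))))" for v
        proof -
          have "cmod (D z v) \<le> (LINT w|mu l. norm (F w * ?G w * exp (?u w z) * ?u w v))"
            unfolding D_def by (rule integral_norm_bound)
          also have "\<dots> \<le> (LINT w|mu l. norm v * norm (F w * ?G w * (exp (?u w z) * of_real (l / 2 * norm w))))"
          proof (rule integral_mono)
            fix w
            have "norm (F w * ?G w * exp (?u w z) * ?u w v) \<le> norm (F w * ?G w * exp (?u w z)) * (l / 2 * norm v * norm w)"
              unfolding norm_mult[of "F w * ?G w * exp (?u w z)"] by (intro mult_left_mono u_bd) simp
            also have "\<dots> = norm v * norm (F w * ?G w * (exp (?u w z) * of_real (l / 2 * norm w)))"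
              using l by (simp add: norm_mult)
            finally show "norm (F w * ?G w * exp (?u w z) * ?u w v)
              \<le> norm v * norm (F w * ?G w * (exp (?u w z) * of_real (l / 2 * norm w)))" .
          qed (intro integrable_norm integrable_mult_right intD i2)+
          finally show ?thesis by simp
        qed
      qed
      show "(\<lambda>v. norm ((LINT w|mu l. F w * ?G w * exp (?u w (z + v))) - (LINT w|mu l. F w * ?G w * exp (?u w z)) - D z v) / norm v)
          \<midarrow>0\<rightarrow> 0"
      proof (rule Lim_null_comparison)
        show "\<forall>\<^sub>F v in at 0. norm (norm ((LINT w|mu l. F w * ?G w * exp (?u w (z + v)))
            - (LINT w|mu l. F w * ?G w * exp (?u w z)) - D z v) / norm v) \<le> K z * norm v"
          unfolding eventually_at
        proof (intro exI[of _ 1] conjI ballI impI)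
          fix v :: "complex ^ 'n" assume v: "v \<noteq> 0 \<and> dist v 0 < 1"
          then show "norm (norm ((LINT w|mu l. F w * ?G w * exp (?u w (z + v)))
            - (LINT w|mu l. F w * ?G w * exp (?u w z)) - D z v) / norm v) \<le> K z * norm v"
            using rem[of v z] by (simp add: pos_divide_le_eq power2_eq_square mult.assoc)
        qed simp
        show "(\<lambda>v. K z * norm v) \<midarrow>0\<rightarrow> 0" by (auto intro!: tendsto_eq_intros)
      qed
    qed
  next
    fix z a v
    show "D z (a *s v) = a * D z v"
      unfolding D_def hdot_algebra by (subst integral_mult_right_zero[symmetric]) (simp add: mult_ac)
  qed
qed

lemma L2_cong_AE:
  assumes "F \<in> L2 M" "f \<in> borel_measurable M" "AE x in M. F x = f x"
  shows "f \<in> L2 M"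
proof -
  have "integrable M (\<lambda>x. (cmod (F x))\<^sup>2) \<longleftrightarrow> integrable M (\<lambda>x. (cmod (f x))\<^sup>2)"
    using assms L2_measurable[OF assms(1)] by (intro integrable_cong_AE) auto
  with assms show ?thesis by (simp add: L2_def)
qed

text \<open>Only completeness is hard. After applying \<open>wt l\<close>, a Cauchy sequence has a
  limit \<Phi> in \<open>L2 (mu l)\<close>. Pairing with coherent states shows pointwise convergence
  to the projection f of \<Phi>, which is entire, and so \<Phi> agrees almost everywhere with
  \<open>wt l f\<close>.\<close>

lemma fock_hilbert:
  assumes l: "l > 0"
  shows "hilbert_space (fock l) (fock_inner l :: (complex ^ 'n) inner_prod)"
proof -
  have rep: "l2_ip (mu l) (wt l f) (wt l (coherent l a)) = f a"
    if "f \<in> fock l" for f :: "complex ^ 'n \<Rightarrow> complex" and a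
    using reproducing[OF l that, of a] by (simp add: fock_inner_eq)
  have hn: "hnorm (fock_inner l) (\<lambda>x. f x - g x) = l2_dst (mu l) (wt l f) (wt l g)"
    for f g :: "complex ^ 'n \<Rightarrow> complex"
    using wt_lc[of l 1 f "-1" g]
    by (simp add: hnorm_def l2.dst_def l2.nrm_def fock_inner_eq) (simp add: fun_lc_def)
  show ?thesis
    unfolding hilbert_space_def hn
  proof (intro conjI ballI allI impI)
    show "(\<lambda>_. 0) \<in> fock l" by (simp add: fock_iff entire_const wt_def L2_def)
    show "(\<lambda>x. a * f x + b * g x) \<in> fock l" if "f \<in> fock l" "g \<in> fock l"
      for f g :: "complex ^ 'n \<Rightarrow> complex" and a b
      using fock_lc[OF that, of a b] by (simp add: fun_lc_def)
    show "fock_inner l (\<lambda>x. a * f x + b * g x) h = a * fock_inner l f h + b * fock_inner l g h"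
      if "f \<in> fock l" "g \<in> fock l" "h \<in> fock l" for f g h :: "complex ^ 'n \<Rightarrow> complex" and a b
      using l2.ip_lc[OF fock_wt[OF that(1)] fock_wt[OF that(2)] fock_wt[OF that(3)], of a b]
      by (simp add: fock_inner_eq wt_lc[symmetric]) (simp add: fun_lc_def)
    show "fock_inner l g f = cnj (fock_inner l f g)" if "f \<in> fock l" "g \<in> fock l"
      for f g :: "complex ^ 'n \<Rightarrow> complex"
      unfolding fock_inner_eq by (intro l2.ip_herm fock_wt that)
    \<comment> \<open>A vanishing norm annihilates all pairings with coherent states, and by the
      reproducing property these are the values of f at every point.\<close>
    show "0 < Re (fock_inner l f f)" if f: "f \<in> fock l" "f \<noteq> (\<lambda>_. 0)" for f :: "complex ^ 'n \<Rightarrow> complex"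
    proof (rule ccontr)
      assume "\<not> 0 < Re (fock_inner l f f)"
      then have "l2_nrm (mu l) (wt l f) = 0"
        using l2.ip_pos[OF fock_wt[OF f(1)]] by (simp add: l2.nrm_def fock_inner_eq)
      then have "f a = 0" for a
        using l2.ip_null[OF fock_wt[OF f(1)] fock_wt[OF coherent_fock[OF l]]] rep[OF f(1)] by simp
      then show False using f(2) by auto
    qed
  next
    fix F :: "nat \<Rightarrow> complex ^ 'n \<Rightarrow> complex"
    assume *: "(\<forall>k. F k \<in> fock l) \<and>
      (\<forall>\<epsilon>>0. \<exists>N. \<forall>j\<ge>N. \<forall>k\<ge>N. l2_dst (mu l) (wt l (F j)) (wt l (F k)) < \<epsilon>)"
    then have F: "F k \<in> fock l" for k by simp
    have "l2.cauchy_seq (mu l) (\<lambda>k. wt l (F k))" using * by (simp add: l2.cauchy_seq_def)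
    then obtain \<Phi> where \<Phi>: "\<Phi> \<in> L2 (mu l)" "l2.lim_to (mu l) (\<lambda>k. wt l (F k)) \<Phi>"
      using l2.complete[of "\<lambda>k. wt l (F k)" "mu l"] fock_wt[OF F] by auto
    define f where "f z = l2_ip (mu l) \<Phi> (wt l (coherent l z))" for z
    have ef: "entire f" unfolding f_def by (rule entire_projection[OF l \<Phi>(1)])
    have "(\<lambda>k. F k z) \<longlonglongrightarrow> f z" for z
      using l2.lim_to_ip_left[OF fock_wt[OF F] \<Phi>(1) fock_wt[OF coherent_fock[OF l]] \<Phi>(2)]
      by (simp add: rep[OF F] f_def)
    then have "(\<lambda>k. wt l (F k) z) \<longlonglongrightarrow> wt l f z" for z
      unfolding wt_def by (intro tendsto_intros)
    then have ae: "AE z in mu l. \<Phi> z = wt l f z"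
      using entire_measurable[OF ef] by (intro L2_lim_pointwise[OF fock_wt[OF F] \<Phi>(1) _ \<Phi>(2)]) auto
    have wf: "wt l f \<in> L2 (mu l)"
      by (rule L2_cong_AE[OF \<Phi>(1) _ ae]) (simp add: wt_measurable entire_measurable[OF ef])
    have "l2_dst (mu l) \<Phi> (wt l f) = 0" using ae by (simp add: l2_dst_eq_0_iff \<Phi>(1) wf)
    then have le: "l2_dst (mu l) (wt l (F k)) (wt l f) \<le> l2_dst (mu l) (wt l (F k)) \<Phi>" for k
      using l2.dst_triangle[OF fock_wt[OF F[of k]] \<Phi>(1) wf] by simp
    have "(\<lambda>k. l2_dst (mu l) (wt l (F k)) (wt l f)) \<longlonglongrightarrow> 0"
      by (rule Lim_null_comparison[OF _ \<Phi>(2)[unfolded l2.lim_to_def]])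
        (simp add: le l2.dst_ge0 fock_wt[OF F] wf)
    then show "\<exists>f\<in>fock l. (\<lambda>k. l2_dst (mu l) (wt l (F k)) (wt l f)) \<longlonglongrightarrow> 0"
      using ef wf by (auto simp: fock_iff)
  qed
qed

subsection \<open>Gaussian kernels\<close>

text \<open>The reproducing property for \<open>coherent l q\<close> at p, written out as an
  integral. The Gaussian integrals of the symbol calculus are brought to this form.\<close>

lemma gauss_kernel:
  fixes p q :: "complex ^ 'n"
  assumes l: "l > 0"
  shows "integrable (mu l) (\<lambda>w. exp (of_real (l / 2) * (hdot w p + hdot q w - hdot w w)))"
    and "(LINT w|mu l. exp (of_real (l / 2) * (hdot w p + hdot q w - hdot w w)))
      = exp (of_real (l / 2) * hdot q p)"
proof -
  have eq: "exp (of_real (l / 2) * (hdot w p + hdot q w - hdot w w))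
      = wt l (coherent l q) w * cnj (wt l (coherent l p) w)" for w
  proof -
    have "exp (of_real (l / 2) * (hdot w p + hdot q w - hdot w w))
        = coherent l q w * coherent l w p * of_real (exp (- l * (norm w)\<^sup>2 / 2))"
      unfolding gauss_exp coherent_eq by (simp add: exp_add[symmetric] algebra_simps)
    then show ?thesis
      unfolding exp_half[symmetric] by (simp add: wt_def cnj_coherent)
  qed
  show "integrable (mu l) (\<lambda>w. exp (of_real (l / 2) * (hdot w p + hdot q w - hdot w w)))"
    unfolding eq by (intro L2_mult_integrable fock_wt coherent_fock l)
  show "(LINT w|mu l. exp (of_real (l / 2) * (hdot w p + hdot q w - hdot w w)))
      = exp (of_real (l / 2) * hdot q p)"
    using reproducing[OF l coherent_fock[OF l], of q p]
    unfolding eq by (simp add: fock_inner_eq l2_ip_def) (simp add: coherent_eq)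
qed

text \<open>Only the normalisation of \<open>mu\<close> depends on the parameter, so a Gaussian of
  another width is integrated by changing the parameter rather than the variable.\<close>

lemma mu_rescale:
  fixes f :: "complex ^ 'n \<Rightarrow> 'b::{banach,second_countable_topology}"
  assumes "l > 0" "c > 0" and f: "f \<in> borel_measurable borel"
  shows "integrable (mu (c * l)) f \<longleftrightarrow> integrable (mu l) f"
    and "(LINT x|mu (c * l). f x) = c ^ CARD('n) *\<^sub>R (LINT x|mu l. f x)"
  using assms mu_integrable_iff[OF assms(1) f] mu_integrable_iff[of "c * l" f]
  by (simp_all add: power_mult_distrib[symmetric] scaleR_scaleR)

text \<open>Feeds the Chebyshev estimate for mollifiers. With y = \<tau> |u|^2 / 4, y exp(-2y) is at
  most exp(-y), and the Gaussian with half the exponent has integral 2^n.\<close>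

lemma second_moment:
  assumes t: "\<tau> > 0"
  shows "integrable (mu \<tau>) (\<lambda>u :: complex ^ 'n. (norm u)\<^sup>2 * exp (- \<tau> * (norm u)\<^sup>2 / 2))"
    and "(LINT u|mu \<tau>. (norm (u :: complex ^ 'n))\<^sup>2 * exp (- \<tau> * (norm u)\<^sup>2 / 2)) \<le> 4 * 2 ^ CARD('n) / \<tau>"
proof -
  have bd: "(norm u)\<^sup>2 * exp (- \<tau> * (norm u)\<^sup>2 / 2) \<le> 4 / \<tau> * exp (- (\<tau> / 2) * (norm u)\<^sup>2 / 2)"
    for u :: "complex ^ 'n"
  proof -
    let ?y = "\<tau> * (norm u)\<^sup>2 / 4"
    have "?y * exp (- 2 * ?y) \<le> exp ?y * exp (- 2 * ?y)"
      by (rule mult_right_mono) (use exp_ge_add_one_self[of ?y] in linarith, simp)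
    also have "\<dots> = exp (- ?y)" by (simp add: exp_add[symmetric])
    finally have "4 / \<tau> * (?y * exp (- 2 * ?y)) \<le> 4 / \<tau> * exp (- ?y)"
      using t by (intro mult_left_mono) auto
    then show ?thesis using t by simp
  qed
  have g: "integrable (mu \<tau>) (\<lambda>u :: complex ^ 'n. 4 / \<tau> * exp (- (\<tau> / 2) * (norm u)\<^sup>2 / 2))"
    using gaussian_integrable_mu[OF t, of "\<tau> / 2", where 'n = 'n] t by simp
  show i: "integrable (mu \<tau>) (\<lambda>u :: complex ^ 'n. (norm u)\<^sup>2 * exp (- \<tau> * (norm u)\<^sup>2 / 2))"
    by (rule Bochner_Integration.integrable_bound[OF g]) (use bd t in auto)
  have "(LINT u|mu \<tau>. (norm (u :: complex ^ 'n))\<^sup>2 * exp (- \<tau> * (norm u)\<^sup>2 / 2))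
      \<le> (LINT u|mu \<tau>. 4 / \<tau> * exp (- (\<tau> / 2) * (norm (u :: complex ^ 'n))\<^sup>2 / 2))"
    by (rule integral_mono[OF i g bd])
  also have "\<dots> = 4 / \<tau> * (LINT u|mu \<tau>. exp (- (\<tau> / 2) * (norm (u :: complex ^ 'n))\<^sup>2 / 2))"
    by simp
  also have "(LINT u|mu \<tau>. exp (- (\<tau> / 2) * (norm (u :: complex ^ 'n))\<^sup>2 / 2)) = 2 ^ CARD('n)"
    using mu_rescale(2)[of "\<tau> / 2" 2 "\<lambda>u :: complex ^ 'n. exp (- (\<tau> / 2) * (norm u)\<^sup>2 / 2)"]
      gaussian_integral[of "\<tau> / 2", where 'n = 'n] t by simp
  finally show "(LINT u|mu \<tau>. (norm (u :: complex ^ 'n))\<^sup>2 * exp (- \<tau> * (norm u)\<^sup>2 / 2))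
    \<le> 4 * 2 ^ CARD('n) / \<tau>" by simp
qed

text \<open>Gaussians are an approximate identity: near z continuity gives \<epsilon> / 2, and away
  from z the crude bound 2 M is at most 2 M |u|^2 / \<delta>^2, whose integral is a second
  moment.\<close>

lemma gaussian_mollifier_tendsto:
  fixes \<phi> :: "complex ^ 'n \<Rightarrow> complex"
  assumes cont: "continuous_on UNIV \<phi>" and bd: "\<And>x. cmod (\<phi> x) \<le> M"
  shows "(\<lambda>k. LINT u|mu (real (Suc k)). \<phi> (z + u) * of_real (exp (- real (Suc k) * (norm u)\<^sup>2 / 2)))
    \<longlonglongrightarrow> \<phi> z"
proof (rule LIMSEQ_I)
  fix \<epsilon> :: real assume e: "\<epsilon> > 0"
  have [measurable]: "\<phi> \<in> borel_measurable borel" by (rule borel_measurable_continuous_onI[OF cont])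
  have M: "0 \<le> M" using bd[of 0] norm_ge_zero order_trans by blast
  obtain \<delta> where \<delta>: "\<delta> > 0" "\<And>u. norm u < \<delta> \<Longrightarrow> cmod (\<phi> (z + u) - \<phi> z) < \<epsilon> / 2"
  proof -
    have "isCont \<phi> z" using cont by (simp add: continuous_on_eq_continuous_at)
    then obtain d where d: "d > 0" "\<And>x. dist x z < d \<Longrightarrow> dist (\<phi> x) (\<phi> z) < \<epsilon> / 2"
      using e by (metis continuous_at_eps_delta half_gt_zero)
    then show thesis using that[of d] by (simp add: dist_norm)
  qed
  have pt: "cmod (\<phi> (z + u) - \<phi> z) \<le> \<epsilon> / 2 + 2 * M / \<delta>\<^sup>2 * (norm u)\<^sup>2" for u
  proof (cases "norm u < \<delta>")
    case True
    then show ?thesis using \<delta>(2)[OF True] M by (smt (verit) divide_nonneg_nonneg mult_nonneg_nonneg zero_le_power2)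
  next
    case False
    then have "1 \<le> (norm u)\<^sup>2 / \<delta>\<^sup>2" using \<delta>(1) by (simp add: power_mono)
    then have "2 * M * 1 \<le> 2 * M * ((norm u)\<^sup>2 / \<delta>\<^sup>2)" using M by (intro mult_left_mono) auto
    moreover have "cmod (\<phi> (z + u) - \<phi> z) \<le> 2 * M"
      using norm_triangle_ineq4[of "\<phi> (z + u)" "\<phi> z"] bd[of "z + u"] bd[of z] by linarith
    ultimately show ?thesis using e by simp
  qed
  \<comment> \<open>Chosen so that the second moment term, which decays like 1 / \<tau>, stays below
    \<epsilon> / 2.\<close>
  obtain K :: nat where K: "2 * M / \<delta>\<^sup>2 * (4 * 2 ^ CARD('n)) / (\<epsilon> / 2) < real K"
    using reals_Archimedean2 by blast
  have "cmod ((LINT u|mu (real (Suc k)). \<phi> (z + u) * of_real (exp (- real (Suc k) * (norm u)\<^sup>2 / 2))) - \<phi> z) < \<epsilon>"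
    if k: "k \<ge> K" for k
  proof -
    define \<tau> where "\<tau> = real (Suc k)"
    have t: "\<tau> > 0" "real K < \<tau>" using k by (simp_all add: \<tau>_def)
    let ?g = "\<lambda>u :: complex ^ 'n. exp (- \<tau> * (norm u)\<^sup>2 / 2)"
    note gi = gaussian_integrable[OF t(1), where 'n = 'n]
    have i1: "integrable (mu \<tau>) (\<lambda>u. \<phi> (z + u) * of_real (?g u))"
      by (rule Bochner_Integration.integrable_bound[OF integrable_mult_right[OF gi, of M]])
        (use bd M in \<open>auto simp: norm_mult intro!: mult_mono\<close>)
    have i2: "integrable (mu \<tau>) (\<lambda>u. \<phi> z * of_real (?g u))"
      using gi by (intro integrable_mult_right integrable_of_real)
    have "(LINT u|mu \<tau>. \<phi> z * complex_of_real (?g u)) = \<phi> z * complex_of_real (LINT u|mu \<tau>. ?g u)"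
      by (subst integral_mult_right_zero) (simp only: integral_complex_of_real)
    then have "(LINT u|mu \<tau>. \<phi> (z + u) * of_real (?g u)) - \<phi> z
        = (LINT u|mu \<tau>. \<phi> (z + u) * of_real (?g u)) - (LINT u|mu \<tau>. \<phi> z * complex_of_real (?g u))"
      by (simp only: gaussian_integral[OF t(1)]) simp
    also have "\<dots> = (LINT u|mu \<tau>. \<phi> (z + u) * of_real (?g u) - \<phi> z * of_real (?g u))"
      by (rule Bochner_Integration.integral_diff[OF i1 i2, symmetric])
    also have "cmod \<dots> \<le> (LINT u|mu \<tau>. cmod (\<phi> (z + u) * of_real (?g u) - \<phi> z * of_real (?g u)))"
      by (rule integral_norm_bound)
    also have "\<dots> \<le> (LINT u|mu \<tau>. \<epsilon> / 2 * ?g u + 2 * M / \<delta>\<^sup>2 * ((norm u)\<^sup>2 * ?g u))"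
    proof (rule integral_mono)
      show "integrable (mu \<tau>) (\<lambda>u. cmod (\<phi> (z + u) * of_real (?g u) - \<phi> z * of_real (?g u)))"
        by (intro integrable_norm Bochner_Integration.integrable_diff i1 i2)
      show "integrable (mu \<tau>) (\<lambda>u. \<epsilon> / 2 * ?g u + 2 * M / \<delta>\<^sup>2 * ((norm u)\<^sup>2 * ?g u))"
        by (intro Bochner_Integration.integrable_add integrable_mult_right gi second_moment t)
      show "cmod (\<phi> (z + u) * of_real (?g u) - \<phi> z * of_real (?g u))
          \<le> \<epsilon> / 2 * ?g u + 2 * M / \<delta>\<^sup>2 * ((norm u)\<^sup>2 * ?g u)" for u
        using mult_right_mono[OF pt[of u], of "?g u"]
        unfolding left_diff_distrib[symmetric] norm_mult by (simp add: algebra_simps)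
    qed
    also have "\<dots> = \<epsilon> / 2 + 2 * M / \<delta>\<^sup>2 * (LINT u|mu \<tau>. (norm (u :: complex ^ 'n))\<^sup>2 * ?g u)"
      using gi second_moment(1)[OF t(1), where 'n = 'n] gaussian_integral[OF t(1), where 'n = 'n]
      by (subst Bochner_Integration.integral_add) simp_all
    also have "\<dots> \<le> \<epsilon> / 2 + 2 * M / \<delta>\<^sup>2 * (4 * 2 ^ CARD('n) / \<tau>)"
      using M by (intro add_left_mono mult_left_mono second_moment t) auto
    also have "\<dots> < \<epsilon> / 2 + \<epsilon> / 2"
    proof -
      have "2 * M / \<delta>\<^sup>2 * (4 * 2 ^ CARD('n)) / (\<epsilon> / 2) < \<tau>" using K t(2) by linarith
      then have "2 * M / \<delta>\<^sup>2 * (4 * 2 ^ CARD('n)) < \<tau> * (\<epsilon> / 2)" using e by (simp only: pos_divide_less_eq half_gt_zero)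
      then have "2 * M / \<delta>\<^sup>2 * (4 * 2 ^ CARD('n)) / \<tau> < \<epsilon> / 2" using t(1) by (simp only: pos_divide_less_eq mult.commute)
      then show ?thesis by simp
    qed
    finally show ?thesis by (simp add: \<tau>_def)
  qed
  then show "\<exists>N. \<forall>k\<ge>N. norm ((LINT u|mu (real (Suc k)). \<phi> (z + u) * of_real (exp (- real (Suc k) * (norm u)\<^sup>2 / 2))) - \<phi> z) < \<epsilon>"
    by blast
qed

section \<open>Injectivity of the Fourier transform\<close>

lemma pair_mu: "pair_sigma_finite (mu a :: (complex ^ 'n) measure) (mu b :: (complex ^ 'n) measure)"
  by (intro pair_sigma_finite.intro sigma_finite_mu)

lemma measurable_mu_pair: "measurable (mu a \<Otimes>\<^sub>M mu b) N = measurable (borel \<Otimes>\<^sub>M borel) N"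
  by (intro measurable_cong_sets sets_pair_measure_cong) simp_all

text \<open>
  Uniqueness for the Fourier transform, in symplectic form: integrating against a Gaussian in
  \<open>\<zeta>\<close> produces all Gaussian mollifications of \<open>g\<close>.
\<close>

lemma fourier_unique:
  fixes g :: "complex ^ 'n \<Rightarrow> complex"
  assumes l: "l > 0" and g: "integrable (mu l) g"
    and z: "\<And>\<zeta>. (LINT z|mu l. g z * exp (of_real l * (hdot \<zeta> z - hdot z \<zeta>))) = 0"
  shows "AE z in mu l. g z = 0"
proof -
  have [measurable]: "g \<in> borel_measurable borel" using borel_measurable_integrable[OF g] by simp
  have moll: "(LINT z|mu l. g z * of_real (exp (- \<tau> * (norm (z - y))\<^sup>2 / 2))) = 0" if t: "\<tau> > 0" for \<tau> y
  proof -
    \<comment> \<open>The parameter of the Gaussian in \<zeta> whose transform is the Gaussian of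
      parameter \<tau>.\<close>
    define \<sigma> where "\<sigma> = 4 * l\<^sup>2 / \<tau>"
    have s: "\<sigma> > 0" using t l by (simp add: \<sigma>_def)
    interpret pair_sigma_finite "mu \<sigma> :: (complex ^ 'n) measure" "mu l :: (complex ^ 'n) measure"
      by (rule pair_mu)
    define h where "h = (\<lambda>(\<zeta>, z). g z * exp (of_real l * (hdot \<zeta> (z - y) - hdot (z - y) \<zeta>))
        * of_real (exp (- \<sigma> * (norm \<zeta>)\<^sup>2 / 2)))"
    have hm: "h \<in> borel_measurable (mu \<sigma> \<Otimes>\<^sub>M mu l)"
      unfolding measurable_mu_pair h_def by measurable
    have n1: "cmod (exp (of_real l * (hdot \<zeta> x - hdot x \<zeta>))) = 1" for \<zeta> x :: "complex ^ 'n"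
      using arg_cong[OF cnj_hdot[of x \<zeta>], of Re] by (simp add: algebra_simps)
    have nh: "norm (h (\<zeta>, z)) = norm (g z) * exp (- \<sigma> * (norm \<zeta>)\<^sup>2 / 2)" for \<zeta> z
      unfolding h_def by (simp only: prod.case norm_mult n1) simp
    have hi: "integrable (mu l) (\<lambda>z. h (\<zeta>, z))" for \<zeta>
    proof (rule Bochner_Integration.integrable_bound)
      show "integrable (mu l) (\<lambda>z. norm (g z) * exp (- \<sigma> * (norm \<zeta>)\<^sup>2 / 2))"
        by (intro integrable_mult_left integrable_norm g)
      show "(\<lambda>z. h (\<zeta>, z)) \<in> borel_measurable (mu l)" unfolding h_def by simp
    qed (simp add: nh)
    have int: "integrable (mu \<sigma> \<Otimes>\<^sub>M mu l) h"
    proof (rule Fubini_integrable[OF hm])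
      show "integrable (mu \<sigma>) (\<lambda>\<zeta>. LINT z|mu l. norm (h (\<zeta>, z)))"
        unfolding nh using gaussian_integrable[OF s, where 'n = 'n] by simp
    qed (simp add: hi)
    have in1: "(LINT z|mu l. h (\<zeta>, z)) = 0" for \<zeta>
    proof -
      have "h (\<zeta>, z) = (exp (of_real l * (hdot y \<zeta> - hdot \<zeta> y)) * of_real (exp (- \<sigma> * (norm \<zeta>)\<^sup>2 / 2)))
          * (g z * exp (of_real l * (hdot \<zeta> z - hdot z \<zeta>)))" for z
        unfolding h_def by (simp add: hdot_algebra exp_add[symmetric] algebra_simps)
      then show ?thesis by (simp add: z)
    qed
    have in2: "(LINT \<zeta>|mu \<sigma>. h (\<zeta>, z)) = g z * of_real (exp (- \<tau> * (norm (z - y))\<^sup>2 / 2))" for z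
    proof -
      \<comment> \<open>Rescales z - y so that the oscillating exponent takes the form of
        \<open>gauss_kernel\<close> at parameter \<sigma>.\<close>
      define r where "r = 2 * l / \<sigma>"
      have rs: "\<sigma> / 2 * r = l" "\<sigma> / 2 * (r * r) = \<tau> / 2"
        using l t by (simp_all add: r_def \<sigma>_def power2_eq_square)
      have "h (\<zeta>, z) = g z * exp (of_real (\<sigma> / 2) * (hdot \<zeta> (r *\<^sub>R (z - y)) + hdot ((- r) *\<^sub>R (z - y)) \<zeta> - hdot \<zeta> \<zeta>))" for \<zeta>
      proof -
        have "complex_of_real l = of_real (\<sigma> / 2) * of_real r" by (simp only: rs(1) of_real_mult[symmetric])
        then have "of_real (\<sigma> / 2) * (hdot \<zeta> (r *\<^sub>R (z - y)) + hdot ((- r) *\<^sub>R (z - y)) \<zeta> - hdot \<zeta> \<zeta>)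
            = of_real l * (hdot \<zeta> (z - y) - hdot (z - y) \<zeta>) + of_real (- \<sigma> / 2) * hdot \<zeta> \<zeta>"
          by (simp only: hdot_algebra) (simp add: algebra_simps)
        then show ?thesis unfolding h_def gauss_exp by (simp only: prod.case exp_add mult.assoc)
      qed
      then have "(LINT \<zeta>|mu \<sigma>. h (\<zeta>, z)) = g z * exp (of_real (\<sigma> / 2) * hdot ((- r) *\<^sub>R (z - y)) (r *\<^sub>R (z - y)))"
        by (simp only: integral_mult_right_zero gauss_kernel(2)[OF s])
      also have "of_real (\<sigma> / 2) * hdot ((- r) *\<^sub>R (z - y)) (r *\<^sub>R (z - y)) = - of_real (\<sigma> / 2 * (r * r)) * hdot (z - y) (z - y)"
        by (simp only: hdot_algebra(9,10)) simp
      also have "\<dots> = of_real (- \<tau> / 2) * hdot (z - y) (z - y)"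
        unfolding rs by simp
      finally show ?thesis by (simp only: gauss_exp)
    qed
    have "(LINT z|mu l. LINT \<zeta>|mu \<sigma>. h (\<zeta>, z)) = (LINT \<zeta>|mu \<sigma>. LINT z|mu l. h (\<zeta>, z))"
      using Fubini_integral[of "\<lambda>\<zeta> z. h (\<zeta>, z)"] int by simp
    then show ?thesis unfolding in1 in2 by simp
  qed
  \<comment> \<open>A bounded continuous \<phi> is a bounded pointwise limit of its mollifications,
    which are superpositions of the Gaussians treated in \<open>moll\<close>.\<close>
  have bc: "(LINT z|mu l. g z * \<phi> z) = 0"
    if cont: "continuous_on UNIV \<phi>" and bd: "\<And>x. cmod (\<phi> x) \<le> M" for \<phi> :: "complex ^ 'n \<Rightarrow> complex" and M
  proof -
    have [measurable]: "\<phi> \<in> borel_measurable borel" by (rule borel_measurable_continuous_onI[OF cont])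
    have M: "0 \<le> M" using bd[of 0] norm_ge_zero order_trans by blast
    define \<Phi> where "\<Phi> \<tau> z = (LINT u|mu \<tau>. \<phi> (z + u) * of_real (exp (- \<tau> * (norm u)\<^sup>2 / 2)))" for \<tau> z
    have \<Phi>_eq: "\<Phi> \<tau> z = (LINT y|mu \<tau>. \<phi> y * of_real (exp (- \<tau> * (norm (y - z))\<^sup>2 / 2)))" for \<tau> z
      unfolding \<Phi>_def
      using mu_integral_affine(1)[of "\<lambda>u. u" "\<lambda>y. \<phi> y * of_real (exp (- \<tau> * (norm (y - z))\<^sup>2 / 2))" \<tau> z]
      by (simp add: linear_ident add.commute)
    have i1: "integrable (mu \<tau>) (\<lambda>y. of_real (exp (- \<tau> * (norm (y - z))\<^sup>2 / 2)) :: real)"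
      and i1v: "(LINT y|mu \<tau>. exp (- \<tau> * (norm (y - z))\<^sup>2 / 2)) = 1"
      if t: "\<tau> > 0" for \<tau> and z :: "complex ^ 'n"
      using mu_integral_affine[of "\<lambda>u. u" "\<lambda>y. exp (- \<tau> * (norm (y - z))\<^sup>2 / 2)" \<tau> z]
        gaussian_integrable[OF t, where 'n = 'n] gaussian_integral[OF t, where 'n = 'n]
      by (simp_all add: linear_ident)
    have \<Phi>_bd: "cmod (\<Phi> \<tau> z) \<le> M" if t: "\<tau> > 0" for \<tau> z
    proof -
      have "cmod (\<Phi> \<tau> z) \<le> (LINT y|mu \<tau>. norm (\<phi> y * complex_of_real (exp (- \<tau> * (norm (y - z))\<^sup>2 / 2))))"
        unfolding \<Phi>_eq by (rule integral_norm_bound)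
      also have "\<dots> \<le> (LINT y|mu \<tau>. M * exp (- \<tau> * (norm (y - z))\<^sup>2 / 2))"
      proof (rule integral_mono)
        show i: "integrable (mu \<tau>) (\<lambda>y. M * exp (- \<tau> * (norm (y - z))\<^sup>2 / 2))"
          using i1[OF t, of z] by simp
        show "integrable (mu \<tau>) (\<lambda>y. norm (\<phi> y * complex_of_real (exp (- \<tau> * (norm (y - z))\<^sup>2 / 2))))"
          by (rule Bochner_Integration.integrable_bound[OF i])
            (use bd M in \<open>auto simp: norm_mult intro!: mult_mono\<close>)
        show "norm (\<phi> y * complex_of_real (exp (- \<tau> * (norm (y - z))\<^sup>2 / 2))) \<le> M * exp (- \<tau> * (norm (y - z))\<^sup>2 / 2)" for y
          using bd[of y] by (simp add: norm_mult)
      qed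
      also have "\<dots> = M" using i1v[OF t, of z] by simp
      finally show ?thesis .
    qed
    have \<Phi>_meas: "\<Phi> \<tau> \<in> borel_measurable borel" for \<tau>
    proof -
      interpret sigma_finite_measure "mu \<tau> :: (complex ^ 'n) measure" by (rule sigma_finite_mu)
      have "(\<lambda>z. LINT u|mu \<tau>. \<phi> (z + u) * of_real (exp (- \<tau> * (norm u)\<^sup>2 / 2))) \<in> borel_measurable borel"
      proof (rule borel_measurable_lebesgue_integral)
        have "(\<lambda>(z, u). \<phi> (z + u) * complex_of_real (exp (- \<tau> * (norm u)\<^sup>2 / 2))) \<in> borel_measurable (borel \<Otimes>\<^sub>M borel)"
          by measurable
        also have "borel_measurable (borel \<Otimes>\<^sub>M borel) = borel_measurable (borel \<Otimes>\<^sub>M (mu \<tau> :: (complex ^ 'n) measure))"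
          by (intro measurable_cong_sets sets_pair_measure_cong) simp_all
        finally show "(\<lambda>(z, u). \<phi> (z + u) * complex_of_real (exp (- \<tau> * (norm u)\<^sup>2 / 2)))
          \<in> borel_measurable (borel \<Otimes>\<^sub>M mu \<tau>)" .
      qed
      then show ?thesis by (simp add: \<Phi>_def[abs_def])
    qed
    have zero: "(LINT z|mu l. g z * \<Phi> \<tau> z) = 0" if t: "\<tau> > 0" for \<tau>
    proof -
      interpret pair_sigma_finite "mu l :: (complex ^ 'n) measure" "mu \<tau> :: (complex ^ 'n) measure"
        by (rule pair_mu)
      define h where "h = (\<lambda>(z, y). g z * (\<phi> y * of_real (exp (- \<tau> * (norm (y - z))\<^sup>2 / 2))))"
      have hm: "h \<in> borel_measurable (mu l \<Otimes>\<^sub>M mu \<tau>)"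
        unfolding measurable_mu_pair h_def by measurable
      have nh: "norm (h (z, y)) \<le> norm (g z) * (M * exp (- \<tau> * (norm (y - z))\<^sup>2 / 2))" for z y
        using bd[of y] by (simp add: h_def norm_mult mult_left_mono)
      have hi: "integrable (mu \<tau>) (\<lambda>y. h (z, y))" for z
      proof (rule Bochner_Integration.integrable_bound)
        show "integrable (mu \<tau>) (\<lambda>y. norm (g z) * (M * exp (- \<tau> * (norm (y - z))\<^sup>2 / 2)))"
          using i1[OF t, of z] by simp
        show "(\<lambda>y. h (z, y)) \<in> borel_measurable (mu \<tau>)" unfolding h_def by simp
      qed (use nh M in \<open>auto simp: abs_mult\<close>)
      have int: "integrable (mu l \<Otimes>\<^sub>M mu \<tau>) h"
      proof (rule Fubini_integrable[OF hm])
        show "integrable (mu l) (\<lambda>z. LINT y|mu \<tau>. norm (h (z, y)))"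
        proof (rule Bochner_Integration.integrable_bound)
          show "integrable (mu l) (\<lambda>z. norm (g z) * M)" by (intro integrable_mult_left integrable_norm g)
          show "(\<lambda>z. LINT y|mu \<tau>. norm (h (z, y))) \<in> borel_measurable (mu l)"
            by (rule M2.borel_measurable_lebesgue_integral) (use hm in simp)
          show "AE z in mu l. norm (LINT y|mu \<tau>. norm (h (z, y))) \<le> norm (norm (g z) * M)"
          proof (rule AE_I2)
            fix z
            have "(LINT y|mu \<tau>. norm (h (z, y))) \<le> (LINT y|mu \<tau>. norm (g z) * (M * exp (- \<tau> * (norm (y - z))\<^sup>2 / 2)))"
              by (rule integral_mono[OF integrable_norm[OF hi] _ nh]) (use i1[OF t, of z] in simp)
            also have "\<dots> = norm (g z) * M" using i1v[OF t, of z] by simp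
            finally show "norm (LINT y|mu \<tau>. norm (h (z, y))) \<le> norm (norm (g z) * M)"
              using M by simp
          qed
        qed
      qed (simp add: hi)
      have inner: "(LINT z|mu l. h (z, y)) = 0" for y
      proof -
        have "h (z, y) = \<phi> y * (g z * of_real (exp (- \<tau> * (norm (z - y))\<^sup>2 / 2)))" for z
          by (simp add: h_def norm_minus_commute mult_ac)
        then show ?thesis using moll[OF t, of y] by simp
      qed
      have "(LINT z|mu l. g z * \<Phi> \<tau> z) = (LINT z|mu l. LINT y|mu \<tau>. h (z, y))"
        unfolding \<Phi>_eq h_def by simp
      also have "\<dots> = (LINT y|mu \<tau>. LINT z|mu l. h (z, y))"
        using Fubini_integral[of "\<lambda>z y. h (z, y)"] int by simp
      also have "\<dots> = 0" by (simp add: inner)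
      finally show ?thesis .
    qed
    have "(\<lambda>k. LINT z|mu l. g z * \<Phi> (real (Suc k)) z) \<longlonglongrightarrow> (LINT z|mu l. g z * \<phi> z)"
    proof (rule integral_dominated_convergence)
      show "integrable (mu l) (\<lambda>z. norm (g z) * M)" by (intro integrable_mult_left integrable_norm g)
      show "AE z in mu l. (\<lambda>k. g z * \<Phi> (real (Suc k)) z) \<longlonglongrightarrow> g z * \<phi> z"
        unfolding \<Phi>_def by (intro AE_I2 tendsto_mult_left gaussian_mollifier_tendsto[OF cont bd])
      show "AE z in mu l. norm (g z * \<Phi> (real (Suc k)) z) \<le> norm (g z) * M" for k
        using \<Phi>_bd[of "real (Suc k)"] by (intro AE_I2) (simp add: norm_mult mult_left_mono)
    qed (use \<Phi>_meas in simp_all)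
    then show ?thesis using zero[of "real (Suc _)"] LIMSEQ_unique[OF _ tendsto_const] by simp
  qed
  \<comment> \<open>Testing against the conjugate phase of g recovers the L1 norm; this test
    function is only measurable, so it is approximated almost everywhere by continuous ones.\<close>
  define s where "s z = cnj (sgn (g z))" for z
  have gs: "g z * s z = of_real (norm (g z))" for z
    by (simp add: s_def sgn_eq complex_norm_square[symmetric] power2_eq_square del: of_real_power)
  have "s \<in> borel_measurable lborel" unfolding s_def by simp
  then have "s measurable_on UNIV"
    by (intro lebesgue_measurable_imp_measurable_on measurable_completion) simp_all
  then obtain N p where N: "negligible N" and p: "\<And>n. continuous_on UNIV (p n)"
    and lim: "\<And>z. z \<notin> N \<Longrightarrow> (\<lambda>n. p n z) \<longlonglongrightarrow> s z"
    unfolding measurable_on_def by auto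
  \<comment> \<open>Radial retraction onto the closed unit disc: it bounds the approximants and
    fixes the values of s.\<close>
  define c where "c x = x / of_real (max 1 (norm x))" for x :: complex
  have cc: "continuous_on UNIV c" unfolding c_def by (intro continuous_intros) auto
  have c1: "norm (c x) \<le> 1" for x by (simp add: c_def norm_divide divide_simps)
  have cs: "c (s z) = s z" for z by (simp add: c_def s_def norm_sgn)
  have "(\<lambda>n. LINT z|mu l. g z * c (p n z)) \<longlonglongrightarrow> (LINT z|mu l. g z * s z)"
  proof (rule integral_dominated_convergence)
    show "integrable (mu l) (\<lambda>z. norm (g z))" by (rule integrable_norm[OF g])
    show "AE z in mu l. (\<lambda>n. g z * c (p n z)) \<longlonglongrightarrow> g z * s z"
    proof -
      have "AE z in lebesgue. z \<notin> N"
        using N by (simp add: negligible_iff_null_sets AE_not_in)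
      then have "AE z in lborel. z \<notin> N" by (simp add: AE_completion_iff)
      then have "AE z in mu l. z \<notin> N" unfolding mu_def by (subst AE_density) auto
      then show ?thesis
      proof eventually_elim
        case (elim z)
        have "(\<lambda>n. c (p n z)) \<longlonglongrightarrow> c (s z)"
          using cc lim[OF elim] by (intro isCont_tendsto_compose[of _ c]) (simp add: continuous_on_eq_continuous_at)
        then show ?case unfolding cs by (rule tendsto_mult_left)
      qed
    qed
    show "AE z in mu l. norm (g z * c (p n z)) \<le> norm (g z)" for n
      using c1 by (intro AE_I2) (simp add: norm_mult mult_left_le)
    have "(\<lambda>z. c (p n z)) \<in> borel_measurable borel" for n
      by (intro borel_measurable_continuous_onI continuous_on_compose2[OF cc p]) auto
    then show "(\<lambda>z. g z * c (p n z)) \<in> borel_measurable (mu l)" for n by simp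
  qed (simp add: s_def)
  moreover have "(LINT z|mu l. g z * c (p n z)) = 0" for n
    by (rule bc[of _ 1]) (use c1 in \<open>auto intro!: continuous_on_compose2[OF cc p]\<close>)
  ultimately have "(LINT z|mu l. g z * s z) = 0" using LIMSEQ_unique[OF _ tendsto_const] by simp
  then have "(LINT z|mu l. norm (g z)) = 0" unfolding gs by simp
  then show ?thesis
    using integral_nonneg_eq_0_iff_AE[OF integrable_norm[OF g]] by simp
qed

section \<open>The Weyl symbol of Hilbert-Schmidt operators\<close>

lemma (in semi_ip) tendsto_ip:
  assumes f: "\<And>x. f x \<in> V" and g: "\<And>x. g x \<in> V" and uv: "u \<in> V" "v \<in> V"
    and fl: "((\<lambda>x. dst (f x) u) \<longlongrightarrow> 0) F" and gl: "((\<lambda>x. dst (g x) v) \<longlongrightarrow> 0) F"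
  shows "((\<lambda>x. ip (f x) (g x)) \<longlongrightarrow> ip u v) F"
proof (rule Lim_null_comparison[THEN LIM_zero_cancel])
  show "\<forall>\<^sub>F x in F. cmod (ip (f x) (g x) - ip u v) \<le> dst (f x) u * (dst (g x) v + nrm v) + dst (g x) v * nrm u"
  proof (rule always_eventually, rule allI)
    fix x
    have "cmod (ip (f x) (g x) - ip u v) \<le> cmod (ip (f x) (g x) - ip u (g x)) + cmod (ip u (g x) - ip u v)"
      using norm_triangle_ineq[of "ip (f x) (g x) - ip u (g x)" "ip u (g x) - ip u v"] by simp
    moreover have "cmod (ip (f x) (g x) - ip u (g x)) \<le> dst (f x) u * (dst (g x) v + nrm v)"
      using ip_diff_le[OF f uv(1) g, of x x] nrm_le_dst[OF g uv(2), of x] dst_ge0[OF f uv(1), of x]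
      by (meson mult_left_mono order_trans)
    moreover have "cmod (ip u (g x) - ip u v) \<le> dst (g x) v * nrm u"
    proof -
      have "ip u (g x) - ip u v = cnj (ip (g x) u - ip v u)"
        using ip_herm[OF uv(1) g, of x] ip_herm[OF uv] by simp
      then show ?thesis using ip_diff_le[OF g uv(2,1), of x] by (metis complex_mod_cnj)
    qed
    ultimately show "cmod (ip (f x) (g x) - ip u v) \<le> dst (f x) u * (dst (g x) v + nrm v) + dst (g x) v * nrm u"
      by linarith
  qed
  have "((\<lambda>x. dst (f x) u * (dst (g x) v + nrm v) + dst (g x) v * nrm u) \<longlongrightarrow> 0 * (0 + nrm v) + 0 * nrm u) F"
    by (intro tendsto_intros fl gl)
  then show "((\<lambda>x. dst (f x) u * (dst (g x) v + nrm v) + dst (g x) v * nrm u) \<longlongrightarrow> 0) F" by simp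
qed

lemma (in hilbert_fun) hs_nrm_compose_le:
  assumes A: "A \<in> HS" and B: "B \<in> HS"
  shows "hs.nrm (compose H A B) \<le> hs.nrm A * hs.nrm B"
proof -
  have AB: "compose H A B \<in> HS" by (intro compose_HS_left HS_bounded A B)
  have "(hs.nrm (compose H A B))\<^sup>2 \<le> (\<Sum>\<^sub>\<infinity>e\<in>E. (hs.nrm A)\<^sup>2 * (nrm (B e))\<^sup>2)"
    unfolding hs_nrm_sq[OF AB]
  proof (rule infsum_mono[OF HS_summable[OF AB] summable_on_cmult_right[OF HS_summable[OF B]]])
    fix e assume e: "e \<in> E"
    have Be: "B e \<in> H" by (rule HS_in[OF B E_in[OF e]])
    have "(nrm (A (B e)))\<^sup>2 \<le> (hs.nrm A * nrm (B e))\<^sup>2"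
      by (intro power_mono op_le_hs_nrm A Be nrm_ge0[OF HS_in[OF A Be]])
    then show "(nrm (compose H A B e))\<^sup>2 \<le> (hs.nrm A)\<^sup>2 * (nrm (B e))\<^sup>2"
      by (simp add: compose_eq E_in e power_mult_distrib)
  qed
  also have "\<dots> = (hs.nrm A * hs.nrm B)\<^sup>2"
    by (simp add: infsum_cmult_right' hs_nrm_sq[OF B] power_mult_distrib)
  finally show ?thesis
    by (rule power2_le_imp_le) (simp add: hs.nrm_ge0 A B)
qed

lemma (in gram_pair_total) matched_dst:
  assumes "matched v w" "matched v' w'"
  shows "H1.dst v v' = H2.dst w w'"
  using matched_ip[OF matched_lc matched_lc, OF assms assms, of 1 "-1" 1 "-1"]
  by (simp add: H1.dst_def H2.dst_def H1.nrm_def H2.nrm_def)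

text \<open>The argument \<open>ty\<close> fixes the index type, so that \<open>H\<close>,
  \<open>ip\<close> and \<open>M\<close> refer to one dimension throughout.\<close>

locale fock_space =
  fixes l :: real and ty :: "'n::finite itself"
  assumes l: "l > 0"
begin

abbreviation H :: "(complex ^ 'n \<Rightarrow> complex) set" where "H \<equiv> fock l"
abbreviation ip :: "(complex ^ 'n) inner_prod" where "ip \<equiv> fock_inner l"
abbreviation M :: "(complex ^ 'n) measure" where "M \<equiv> mu l"
abbreviation coh :: "complex ^ 'n \<Rightarrow> complex ^ 'n \<Rightarrow> complex" where "coh \<equiv> coherent l"

sublocale hilbert_fun H ip
  by standard (rule fock_hilbert[OF l])

lemma coh_in: "coh a \<in> H" by (rule coherent_fock[OF l])

lemma ip_coh: "f \<in> H \<Longrightarrow> ip f (coh a) = f a" by (rule reproducing[OF l])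

lemma coh_coh: "ip (coh a) (coh b) = exp (of_real (l / 2) * hdot a b)"
  by (simp add: ip_coh coh_in) (simp add: coherent_eq)

lemma op_kernel_eq: "bounded_op H ip A \<Longrightarrow> op_kernel l A z w = A (coh w) z"
  by (simp add: op_kernel_def ip_coh op_in coh_in)

text \<open>The value of \<open>adj A g\<close> at b is \<open>ip g (A (coh b))\<close>, so the
  values on coherent states determine the adjoint pointwise.\<close>

lemma op_eq_coherent:
  assumes A: "bounded_op H ip A" and B: "bounded_op H ip B" and eq: "\<And>b. A (coh b) = B (coh b)"
  shows "A = B"
proof -
  have "adj A g = adj B g" if g: "g \<in> H" for g
  proof
    fix b
    have "adj A g b = ip g (A (coh b))"
      by (simp add: ip_adj_left[OF A g coh_in, symmetric] ip_coh op_in[OF adj_bounded[OF A] g])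
    also have "\<dots> = adj B g b"
      by (simp add: eq ip_adj_left[OF B g coh_in, symmetric] ip_coh op_in[OF adj_bounded[OF B] g])
    finally show "adj A g b = adj B g b" .
  qed
  then show ?thesis
    by (intro op_eqI A B) (simp add: ip_adj[OF A] ip_adj[OF B])
qed

section \<open>The families R and G and their common Gram matrix\<close>

definition R :: "(complex ^ 'n) \<times> (complex ^ 'n) \<Rightarrow> (complex ^ 'n) operator" where
  "R = (\<lambda>(a, b). rank_one (coh a) (coh b))"

text \<open>The complex Weyl symbol of the rank-one operator \<open>R (a, b)\<close>:\<close>

definition G :: "(complex ^ 'n) \<times> (complex ^ 'n) \<Rightarrow> complex ^ 'n \<Rightarrow> complex" where
  "G = (\<lambda>(a, b) z. 2 ^ CARD('n) * exp (of_real l * (hdot z b + hdot a z - hdot z z - hdot a b / 2)))"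

lemma R_HS: "R i \<in> HS"
  by (simp add: R_def case_prod_beta rank_one_HS coh_in)

lemma hs_ip_R: "A \<in> HS \<Longrightarrow> hs_ip A (R (a, b)) = A (coh b) a"
  by (simp add: R_def hs_ip_rank_one coh_in ip_coh HS_in[of A])

lemma R_coh: "R (a, b) (coh w) z = exp (of_real (l / 2) * (hdot w b + hdot a z))"
  by (simp add: R_def rank_one_def coh_in coh_coh fun_lc_def)
    (simp add: coherent_eq exp_add[symmetric] distrib_left add_divide_distrib)

lemma cnj_G: "cnj (G (a, b) z) = G (b, a) z"
  by (simp add: G_def exp_cnj cnj_hdot add.commute)

lemma G_measurable: "G i \<in> borel_measurable borel"
  unfolding G_def by (cases i) simp

text \<open>Each factor carries exp(-l |z|^2), so the product is the integrand of
  \<open>gauss_kernel\<close> at parameter \<open>4 * l\<close>; the prefactor 4^n is the one that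
  \<open>mu_rescale\<close> absorbs.\<close>

lemma G_gauss:
  "G (a, b) z * cnj (G (c, d) z) = 4 ^ CARD('n) * exp (of_real (- l / 2) * (hdot a b + hdot d c))
    * exp (of_real ((4 * l) / 2) * (hdot z ((1 / 2) *\<^sub>R (b + c)) + hdot ((1 / 2) *\<^sub>R (a + d)) z - hdot z z))"
proof -
  have "G (a, b) z * cnj (G (c, d) z)
     = (2 ^ CARD('n) * 2 ^ CARD('n)) * (exp (of_real l * (hdot z b + hdot a z - hdot z z - hdot a b / 2))
       * exp (of_real l * (hdot z c + hdot d z - hdot z z - hdot d c / 2)))"
    unfolding cnj_G by (simp add: G_def)
  also have "exp (of_real l * (hdot z b + hdot a z - hdot z z - hdot a b / 2))
       * exp (of_real l * (hdot z c + hdot d z - hdot z z - hdot d c / 2))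
    = exp (of_real (- l / 2) * (hdot a b + hdot d c)) * exp (of_real ((4 * l) / 2)
      * (hdot z ((1 / 2) *\<^sub>R (b + c)) + hdot ((1 / 2) *\<^sub>R (a + d)) z - hdot z z))"
    by (simp add: exp_add[symmetric] hdot_algebra algebra_simps)
  finally show ?thesis by (simp add: power_mult_distrib[symmetric])
qed

lemma G_product:
  "integrable M (\<lambda>z. G (a, b) z * cnj (G (c, d) z))"
  "l2_ip M (G (a, b)) (G (c, d)) = exp (of_real (l / 2) * (hdot a c + hdot d b))"
proof -
  have l4: "4 * l > 0" using l by simp
  let ?p = "(1 / 2) *\<^sub>R (b + c)" and ?q = "(1 / 2) *\<^sub>R (a + d)"
  let ?g = "\<lambda>z. exp (of_real ((4 * l) / 2) * (hdot z ?p + hdot ?q z - hdot z z))"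
  have m: "?g \<in> borel_measurable borel" by measurable
  have i: "integrable M ?g"
    using gauss_kernel(1)[OF l4, of ?p ?q] mu_rescale(1)[OF l _ m, of 4] by simp
  have "4 ^ CARD('n) *\<^sub>R (LINT z|M. ?g z) = exp (of_real ((4 * l) / 2) * hdot ?q ?p)"
    using gauss_kernel(2)[OF l4, of ?p ?q] mu_rescale(2)[OF l _ m, of 4] by simp
  then have v: "4 ^ CARD('n) * (LINT z|M. ?g z) = exp (of_real ((4 * l) / 2) * hdot ?q ?p)"
    by (simp add: scaleR_conv_of_real)
  show "integrable M (\<lambda>z. G (a, b) z * cnj (G (c, d) z))"
    unfolding G_gauss by (intro integrable_mult_right i)
  have "l2_ip M (G (a, b)) (G (c, d))
      = exp (of_real (- l / 2) * (hdot a b + hdot d c)) * (4 ^ CARD('n) * (LINT z|M. ?g z))"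
    unfolding l2_ip_def G_gauss by (simp only: integral_mult_right_zero mult_ac)
  also have "\<dots> = exp (of_real (l / 2) * (hdot a c + hdot d b))"
    unfolding v by (simp add: exp_add[symmetric] hdot_algebra algebra_simps)
  finally show "l2_ip M (G (a, b)) (G (c, d)) = exp (of_real (l / 2) * (hdot a c + hdot d b))" .
qed

lemma G_L2: "G i \<in> L2 M"
proof -
  obtain a b where i: "i = (a, b)" by (cases i)
  have "integrable M (\<lambda>z. norm (G (a, b) z * cnj (G (a, b) z)))"
    by (rule integrable_norm[OF G_product(1)])
  then show ?thesis
    using G_measurable[of i] by (simp add: i L2_def norm_mult power2_eq_square)
qed

text \<open>\<open>G (- \<zeta>, \<zeta>)\<close> is a constant times \<open>G (0, 0)\<close> times
  a character, so the pairings with G contain the Fourier transform of the integrable function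
  \<open>?g\<close>. Integrability is asked of the product and not of F itself, so that F - 1 is
  covered in \<open>id_not_HS\<close>.\<close>

lemma symbol_total:
  assumes F: "F \<in> borel_measurable borel" and int: "integrable M (\<lambda>z. F z * cnj (G (0, 0) z))"
    and z: "\<And>a b. (LINT z|M. F z * cnj (G (a, b) z)) = 0"
  shows "AE z in M. F z = 0"
proof -
  let ?g = "\<lambda>z. F z * cnj (G (0, 0) z)"
  have "(LINT z|M. ?g z * exp (of_real l * (hdot \<zeta> z - hdot z \<zeta>))) = 0" for \<zeta>
  proof -
    have "?g z * exp (of_real l * (hdot \<zeta> z - hdot z \<zeta>))
        = exp (- of_real (l / 2) * hdot \<zeta> \<zeta>) * (F z * cnj (G (- \<zeta>, \<zeta>) z))" for z
      unfolding cnj_G by (simp add: G_def hdot_algebra exp_add[symmetric] algebra_simps)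
    then show ?thesis by (simp only: integral_mult_right_zero z) simp
  qed
  then have "AE z in M. ?g z = 0" by (rule fourier_unique[OF l int])
  then show ?thesis by eventually_elim (simp add: G_def)
qed

sublocale gram_pair_total HS "lincomb_op H" hs_ip "L2 M" fun_lc "l2_ip M" R G
proof
  show "hs_ip (R i) (R j) = l2_ip M (G i) (G j)" for i j
  proof -
    obtain a b c d where ij: "i = (a, b)" "j = (c, d)" by (metis surj_pair)
    show ?thesis unfolding ij hs_ip_R[OF R_HS] R_coh G_product(2) by (simp add: add.commute)
  qed
  show "hs.nrm A = 0" if A: "A \<in> HS" and z: "\<And>i. hs_ip A (R i) = 0" for A
  proof -
    have b: "bounded_op H ip A" by (rule HS_bounded[OF A])
    \<comment> \<open>The zero operator, written as a combination.\<close>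
    let ?Z = "lincomb_op H 0 A 0 A"
    have "A = ?Z"
    proof (rule op_eq_coherent[OF b])
      show "bounded_op H ip ?Z" by (intro lincomb_bounded b)
      show "A (coh w) = ?Z (coh w)" for w
        using z[of "(_, w)"] by (auto simp: hs_ip_R[OF A] lincomb_apply coh_in fun_lc_def fun_eq_iff)
    qed
    moreover have "hs.nrm ?Z \<le> 0" using hs.nrm_lc_le[OF A A, of 0 0] by simp
    ultimately show ?thesis using hs.nrm_ge0[OF A] by simp
  qed
  show "l2_nrm M w = 0" if w: "w \<in> L2 M" and z: "\<And>i. l2_ip M w (G i) = 0" for w
    unfolding l2_nrm_eq_0_iff[OF w]
    using L2_measurable[OF w] L2_mult_integrable(2)[OF w G_L2] z
    by (intro symbol_total) (auto simp: l2_ip_def)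
qed (fact R_HS G_L2)+

lemma matched_iff:
  "matched A F \<longleftrightarrow> A \<in> HS \<and> F \<in> L2 M \<and> (\<forall>a b. l2_ip M F (G (a, b)) = A (coh b) a)"
  by (auto simp: matched_def hs_ip_R)

lemma matched_cong_AE:
  assumes "matched A F" "f \<in> borel_measurable borel" "AE z in M. F z = f z"
  shows "matched A f"
proof -
  have F: "F \<in> L2 M" using assms(1) by (simp add: matched_def)
  have f: "f \<in> L2 M" by (rule L2_cong_AE[OF F _ assms(3)]) (simp add: assms(2))
  have "l2_ip M f g = l2_ip M F g" if "g \<in> L2 M" for g
    using L2_measurable[OF that] L2_measurable[OF F] assms(2,3)
    unfolding l2_ip_def by (intro integral_cong_AE) auto
  then show ?thesis using assms(1) f G_L2 by (simp add: matched_def)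
qed

subsection \<open>The integral formula on trace class operators\<close>

definition integrand :: "(complex ^ 'n) operator \<Rightarrow> complex ^ 'n \<Rightarrow> complex ^ 'n \<Rightarrow> complex" where
  "integrand A z w = A (coh (z - w)) (z + w) *
     exp (of_real (l / 2) * (- hdot z z - hdot w w + hdot w z - hdot z w))"

lemma weyl_integral_eq:
  "bounded_op H ip A \<Longrightarrow> weyl_integral l A z = 2 ^ CARD('n) * (LINT w|M. integrand A z w)"
  by (simp add: weyl_integral_def integrand_def op_kernel_eq cdot_conjv)

lemma integrand_R:
  "integrand (R (a, b)) z w = exp (of_real (l / 2) * (hdot z b + hdot a z - hdot z z))
    * exp (of_real (l / 2) * (hdot w (z - b) + hdot (a - z) w - hdot w w))"
  unfolding integrand_def R_coh by (simp add: exp_add[symmetric] hdot_algebra algebra_simps)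

lemma integrand_lincomb:
  "integrand (lincomb_op H a A b B) z w = a * integrand A z w + b * integrand B z w"
  by (simp add: integrand_def lincomb_apply coh_in fun_lc_def algebra_simps)

text \<open>On \<open>R (a, b)\<close> the integral over w is \<open>gauss_kernel\<close> with p = z
  - b and q = a - z. Integrability belongs to the induction because additivity of the integral
  depends on it.\<close>

lemma pairs_integral:
  assumes "pairs p"
  shows "(\<forall>z. integrable M (integrand (fst p) z)) \<and> weyl_integral l (fst p) = snd p"
  using assms
proof (induction rule: lin_span.induct)
  case (base p)
  then obtain a b where p: "p = (R (a, b), G (a, b))" by auto
  have "integrable M (integrand (R (a, b)) z)" for z
    unfolding integrand_R by (intro integrable_mult_right gauss_kernel l)
  moreover have "weyl_integral l (R (a, b)) z = G (a, b) z" for z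
  proof -
    have "weyl_integral l (R (a, b)) z = 2 ^ CARD('n)
      * (exp (of_real (l / 2) * (hdot z b + hdot a z - hdot z z)) * exp (of_real (l / 2) * hdot (a - z) (z - b)))"
      unfolding weyl_integral_eq[OF HS_bounded[OF R_HS]] integrand_R integral_mult_right_zero
        gauss_kernel(2)[OF l] ..
    then show ?thesis
      unfolding exp_add[symmetric] by (simp add: G_def hdot_algebra algebra_simps)
  qed
  ultimately show ?case by (auto simp: p)
next
  case (comb p q a b)
  have V: "bounded_op H ip (fst p)" "bounded_op H ip (fst q)"
    using pairs_in[OF comb.hyps(1)] pairs_in[OF comb.hyps(2)] HS_bounded by auto
  have i: "integrable M (integrand (fst p) z)" "integrable M (integrand (fst q) z)" for z
    using comb.IH by auto
  have "weyl_integral l (lincomb_op H a (fst p) b (fst q)) z = fun_lc a (snd p) b (snd q) z" for z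
  proof -
    have "weyl_integral l (lincomb_op H a (fst p) b (fst q)) z
        = a * weyl_integral l (fst p) z + b * weyl_integral l (fst q) z"
      unfolding weyl_integral_eq[OF lincomb_bounded[OF V]] weyl_integral_eq[OF V(1)]
        weyl_integral_eq[OF V(2)] integrand_lincomb
      using i[of z] by (simp add: algebra_simps)
    then show ?thesis using comb.IH by (simp add: fun_lc_def)
  qed
  moreover have "integrable M (integrand (lincomb_op H a (fst p) b (fst q)) z)" for z
    using i[of z] by (subst integrand_lincomb[abs_def]) simp
  ultimately show ?case by auto
qed

text \<open>The product of \<open>R (a, b)\<close> and \<open>R (c, d)\<close> is
  \<open>ip (coh c) (coh b)\<close> times \<open>R (a, d)\<close>, so the span of R is closed under
  composition. Approximants of B and C thereby give approximants of their product with known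
  symbols.\<close>

lemma pairs_compose:
  assumes "pairs p" "pairs q"
  shows "\<exists>t. pairs (compose H (fst p) (fst q), t)"
  using assms(1)
proof (induction rule: lin_span.induct)
  case (base p)
  then obtain a b where p: "p = (R (a, b), G (a, b))" by auto
  show ?case using assms(2)
  proof (induction rule: lin_span.induct)
    case (base q)
    then obtain c d where q: "q = (R (c, d), G (c, d))" by auto
    let ?k = "ip (coh c) (coh b)"
    have "compose H (R (a, b)) (R (c, d)) = lincomb_op H ?k (R (a, d)) 0 (R (a, d))"
    proof
      fix f show "compose H (R (a, b)) (R (c, d)) f = lincomb_op H ?k (R (a, d)) 0 (R (a, d)) f"
        by (cases "f \<in> H")
          (simp_all add: compose_def lincomb_op_def R_def rank_one_def coh_in lc_in ip_lc, simp add: fun_lc_def mult_ac)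
    qed
    moreover have "pairs (R (a, d), G (a, d))" by (intro lin_span.base) auto
    from lin_span.comb[OF this this, of ?k 0]
    have "pairs (lincomb_op H ?k (R (a, d)) 0 (R (a, d)), fun_lc ?k (G (a, d)) 0 (G (a, d)))" by simp
    ultimately show ?case by (auto simp: p q)
  next
    case (comb q q' x y)
    then obtain t t' where "pairs (compose H (fst p) (fst q), t)" "pairs (compose H (fst p) (fst q'), t')" by auto
    from lin_span.comb[OF this, of x y]
    have "pairs (lincomb_op H x (compose H (fst p) (fst q)) y (compose H (fst p) (fst q')), fun_lc x t y t')" by simp
    moreover have "compose H (fst p) (lincomb_op H x (fst q) y (fst q'))
      = lincomb_op H x (compose H (fst p) (fst q)) y (compose H (fst p) (fst q'))"
    proof
      fix f
      have V: "fst q \<in> HS" "fst q' \<in> HS"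
        using pairs_in[OF comb.hyps(1)] pairs_in[OF comb.hyps(2)] by auto
      show "compose H (fst p) (lincomb_op H x (fst q) y (fst q')) f
        = lincomb_op H x (compose H (fst p) (fst q)) y (compose H (fst p) (fst q')) f"
        by (cases "f \<in> H")
          (simp_all add: compose_def lincomb_apply op_lc[OF HS_bounded[OF R_HS]] p HS_in[OF V(1)] HS_in[OF V(2)],
            simp add: lincomb_op_def)
    qed
    ultimately show ?case by auto
  qed
next
  case (comb p p' x y)
  then obtain t t' where "pairs (compose H (fst p) (fst q), t)" "pairs (compose H (fst p') (fst q), t')" by auto
  from lin_span.comb[OF this, of x y]
  have "pairs (lincomb_op H x (compose H (fst p) (fst q)) y (compose H (fst p') (fst q)), fun_lc x t y t')" by simp
  moreover have "compose H (lincomb_op H x (fst p) y (fst p')) (fst q)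
    = lincomb_op H x (compose H (fst p) (fst q)) y (compose H (fst p') (fst q))"
  proof
    fix f
    have V: "fst q \<in> HS" using pairs_in[OF assms(2)] by auto
    show "compose H (lincomb_op H x (fst p) y (fst p')) (fst q) f
      = lincomb_op H x (compose H (fst p) (fst q)) y (compose H (fst p') (fst q)) f"
      by (cases "f \<in> H") (simp_all add: compose_def lincomb_op_def HS_in[OF V])
  qed
  ultimately show ?case by auto
qed

section \<open>Norm continuity of coherent states; Hilbert-Schmidt norms as integrals\<close>

lemma coh_tendsto: "((\<lambda>w. dst (coh w) (coh v)) \<longlongrightarrow> 0) (at v)"
proof -
  have eq: "dst (coh w) (coh v) = sqrt (Re (exp (of_real (l / 2) * hdot w w)) + Re (exp (of_real (l / 2) * hdot v v))
      - 2 * Re (exp (of_real (l / 2) * hdot w v)))" for w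
    using dst_sq[OF coh_in coh_in, of w v] dst_ge0[OF coh_in coh_in, of w v]
    by (simp only: nrm_sq coh_in coh_coh real_sqrt_unique[symmetric])
  have "continuous_on UNIV (\<lambda>w. dst (coh w) (coh v))"
    unfolding eq by (intro continuous_intros)
  then have "((\<lambda>w. dst (coh w) (coh v)) \<longlongrightarrow> dst (coh v) (coh v)) (at v)"
    unfolding continuous_on_def by simp
  then show ?thesis by (simp only: dst_self[OF coh_in])
qed

lemma op_coh_tendsto:
  assumes A: "bounded_op H ip A"
  shows "((\<lambda>w. dst (A (coh w)) (A (coh v))) \<longlongrightarrow> 0) (at v)"
proof -
  obtain C where C: "C \<ge> 0" "\<And>f. f \<in> H \<Longrightarrow> nrm (A f) \<le> C * nrm f"
    using bounded_op_bound[OF A] by auto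
  have "dst (A (coh w)) (A (coh v)) \<le> C * dst (coh w) (coh v)" for w
    using C(2)[OF lc_in[OF coh_in coh_in], of 1 w "-1" v] by (simp add: dst_def op_lc[OF A coh_in coh_in])
  then show ?thesis
    by (intro Lim_null_comparison[OF _ tendsto_mult_right_zero[OF coh_tendsto, of C]])
      (simp add: dst_ge0 op_in[OF A] coh_in)
qed

lemma op_coh_nrm_continuous:
  assumes A: "bounded_op H ip A"
  shows "continuous_on UNIV (\<lambda>w. nrm (A (coh w)))"
proof -
  have "((\<lambda>w. nrm (A (coh w))) \<longlongrightarrow> nrm (A (coh v))) (at v)" for v
    by (rule LIM_zero_cancel, rule Lim_null_comparison[OF _ op_coh_tendsto[OF A]])
      (simp add: nrm_diff_le op_in[OF A] coh_in)
  then show ?thesis by (simp add: continuous_on_def)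
qed

text \<open>The kernel is an inner product of two vectors that depend continuously in norm on w,
  hence it is continuous.\<close>

lemma integrand_measurable:
  assumes A: "bounded_op H ip A"
  shows "integrand A z \<in> borel_measurable borel"
proof -
  have "((\<lambda>w. ip (A (coh (z - w))) (coh (z + w))) \<longlongrightarrow> ip (A (coh (z - v))) (coh (z + v))) (at v)" for v
  proof (rule tendsto_ip)
    have lim: "filterlim (\<lambda>w. z - w) (at (z - v)) (at v)" "filterlim (\<lambda>w. z + w) (at (z + v)) (at v)"
      by (auto simp: filterlim_at eventually_at_filter intro!: tendsto_intros)
    show "((\<lambda>w. dst (A (coh (z - w))) (A (coh (z - v)))) \<longlongrightarrow> 0) (at v)"
      by (rule filterlim_compose[OF op_coh_tendsto[OF A] lim(1)])
    show "((\<lambda>w. dst (coh (z + w)) (coh (z + v))) \<longlongrightarrow> 0) (at v)"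
      by (rule filterlim_compose[OF coh_tendsto lim(2)])
  qed (simp_all add: op_in[OF A] coh_in)
  then have "continuous_on UNIV (\<lambda>w. A (coh (z - w)) (z + w))"
    by (simp add: continuous_on_def ip_coh op_in[OF A] coh_in)
  from borel_measurable_continuous_onI[OF this] show ?thesis
    unfolding integrand_def[abs_def] by measurable
qed

lemma span_HS: "lin_span (lincomb_op H) (range R) D \<Longrightarrow> D \<in> HS"
  by (rule hs.lin_span_in) (use R_HS in blast)+

text \<open>Resolution of the identity: weighted coherent states act as a continuous orthonormal
  basis. For rank-one operators this is \<open>gauss_kernel\<close>, and sesquilinearity does the
  rest.\<close>

lemma span_hs_integral:
  assumes "lin_span (lincomb_op H) (range R) C" "lin_span (lincomb_op H) (range R) D"
  shows "integrable M (\<lambda>w. ip (C (coh w)) (D (coh w)) * of_real (exp (- l * (norm w)\<^sup>2 / 2)))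
    \<and> (LINT w|M. ip (C (coh w)) (D (coh w)) * of_real (exp (- l * (norm w)\<^sup>2 / 2))) = hs_ip C D"
  using assms(1)
proof (induction rule: lin_span.induct)
  case (base C)
  then obtain a b where C: "C = R (a, b)" by auto
  show ?case using assms(2)
  proof (induction rule: lin_span.induct)
    case (base D)
    then obtain c d where D: "D = R (c, d)" by auto
    have eq: "ip (C (coh w)) (D (coh w)) * of_real (exp (- l * (norm w)\<^sup>2 / 2))
      = ip (coh a) (coh c) * exp (of_real (l / 2) * (hdot w b + hdot d w - hdot w w))" for w
    proof -
      have "ip (C (coh w)) (D (coh w)) = ip (coh w) (coh b) * (cnj (ip (coh w) (coh d)) * ip (coh a) (coh c))"
        by (simp add: C D R_def rank_one_def coh_in ip_lc ip_lc_right lc_in)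
      moreover have "ip (coh w) (coh b) * cnj (ip (coh w) (coh d)) * of_real (exp (- l * (norm w)\<^sup>2 / 2))
        = exp (of_real (l / 2) * (hdot w b + hdot d w - hdot w w))"
        unfolding gauss_exp coh_coh
        by (simp add: exp_cnj cnj_hdot exp_add[symmetric] algebra_simps)
      ultimately show ?thesis by (simp add: mult_ac)
    qed
    show ?case
      unfolding eq
    proof
      show "integrable M (\<lambda>w. ip (coh a) (coh c) * exp (of_real (l / 2) * (hdot w b + hdot d w - hdot w w)))"
        by (intro integrable_mult_right gauss_kernel l)
      have "hs_ip C D = ip (coh a) (coh c) * exp (of_real (l / 2) * hdot d b)"
        unfolding C D hs_ip_R[OF R_HS] R_coh coh_coh by (simp add: exp_add[symmetric] algebra_simps)
      then show "(LINT w|M. ip (coh a) (coh c) * exp (of_real (l / 2) * (hdot w b + hdot d w - hdot w w))) = hs_ip C D"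
        by (simp only: integral_mult_right_zero gauss_kernel(2)[OF l])
    qed
  next
    case (comb D D' x y)
    have V: "C \<in> HS" "D \<in> HS" "D' \<in> HS"
      using span_HS[OF comb.hyps(1)] span_HS[OF comb.hyps(2)] by (simp_all add: C R_HS)
    have "ip (C (coh w)) (lincomb_op H x D y D' (coh w)) * of_real (exp (- l * (norm w)\<^sup>2 / 2))
      = cnj x * (ip (C (coh w)) (D (coh w)) * of_real (exp (- l * (norm w)\<^sup>2 / 2)))
      + cnj y * (ip (C (coh w)) (D' (coh w)) * of_real (exp (- l * (norm w)\<^sup>2 / 2)))" for w
      by (simp add: lincomb_apply coh_in ip_lc_right HS_in[OF V(1)] HS_in[OF V(2)] HS_in[OF V(3)] algebra_simps)
    then show ?case using comb.IH by (simp add: hs.ip_lc_right V)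
  qed
next
  case (comb C C' x y)
  have V: "C \<in> HS" "C' \<in> HS" "D \<in> HS"
    using span_HS[OF comb.hyps(1)] span_HS[OF comb.hyps(2)] span_HS[OF assms(2)] by simp_all
  have "ip (lincomb_op H x C y C' (coh w)) (D (coh w)) * of_real (exp (- l * (norm w)\<^sup>2 / 2))
    = x * (ip (C (coh w)) (D (coh w)) * of_real (exp (- l * (norm w)\<^sup>2 / 2)))
    + y * (ip (C' (coh w)) (D (coh w)) * of_real (exp (- l * (norm w)\<^sup>2 / 2)))" for w
    by (simp add: lincomb_apply coh_in ip_lc HS_in[OF V(1)] HS_in[OF V(2)] HS_in[OF V(3)] algebra_simps)
  then show ?case using comb.IH by (simp add: hs.ip_lc V)
qed

text \<open>A nonnegative quantity, made complex-valued so as to lie in \<open>L2\<close>.\<close>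

definition weighted_nrm :: "(complex ^ 'n) operator \<Rightarrow> complex ^ 'n \<Rightarrow> complex" where
  "weighted_nrm C w = of_real (nrm (C (coh w)) * exp (- l * (norm w)\<^sup>2 / 4))"

lemma cmod_weighted_nrm_sq:
  assumes "bounded_op H ip C"
  shows "(cmod (weighted_nrm C w))\<^sup>2 = Re (ip (C (coh w)) (C (coh w)) * of_real (exp (- l * (norm w)\<^sup>2 / 2)))"
  unfolding exp_half[symmetric] weighted_nrm_def
  by (simp add: norm_mult power_mult_distrib nrm_sq op_in[OF assms] coh_in) (simp add: power2_eq_square)

lemma weighted_nrm_measurable: "bounded_op H ip C \<Longrightarrow> weighted_nrm C \<in> borel_measurable borel"
  unfolding weighted_nrm_def[abs_def]
  using borel_measurable_continuous_onI[OF op_coh_nrm_continuous] by measurable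

text \<open>On the span of R the norms are equal by \<open>span_hs_integral\<close>; Fatou's lemma
  carries the inequality to limits, and the bound on symbols uses just that.\<close>

lemma weighted_nrm_L2:
  assumes C: "C \<in> HS"
  shows "weighted_nrm C \<in> L2 M" and "l2_nrm M (weighted_nrm C) \<le> hs.nrm C"
proof -
  have span: "weighted_nrm D \<in> L2 M \<and> l2_nrm M (weighted_nrm D) = hs.nrm D"
    if D: "lin_span (lincomb_op H) (range R) D" for D
  proof -
    have b: "bounded_op H ip D" by (rule HS_bounded[OF span_HS[OF D]])
    note i = span_hs_integral[OF D D]
    have int: "integrable M (\<lambda>w. (cmod (weighted_nrm D w))\<^sup>2)"
      unfolding cmod_weighted_nrm_sq[OF b] using i by (intro integrable_Re) simp
    have "(LINT w|M. (cmod (weighted_nrm D w))\<^sup>2) = Re (hs_ip D D)"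
      unfolding cmod_weighted_nrm_sq[OF b] using i by (subst integral_Re) simp_all
    then show ?thesis
      using int weighted_nrm_measurable[OF b] by (simp add: L2_def l2_nrm_eq hs.nrm_def)
  qed
  obtain s t where st: "\<And>k. pairs (s k, t k)" and lim: "hs.lim_to s C" using approx[OF C] by auto
  have sspan: "lin_span (lincomb_op H) (range R) (s k)" for k
  proof -
    have "lin_span (lincomb_op H) (range R) (fst p)" if "pairs p" for p
      using that by (induction rule: lin_span.induct) (auto intro: lin_span.base lin_span.comb)
    from this[OF st] show ?thesis by simp
  qed
  have sV: "s k \<in> HS" for k using pairs_in[OF st] by simp
  have pt: "(\<lambda>k. weighted_nrm (s k) w) \<longlonglongrightarrow> weighted_nrm C w" for w
  proof -
    have "(\<lambda>k. nrm (s k (coh w))) \<longlonglongrightarrow> nrm (C (coh w))"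
    proof (rule Lim_null_comparison[THEN LIM_zero_cancel])
      show "\<forall>\<^sub>F k in sequentially. norm (nrm (s k (coh w)) - nrm (C (coh w))) \<le> hs.dst (s k) C * nrm (coh w)"
      proof (rule always_eventually, rule allI)
        fix k
        have "dst (s k (coh w)) (C (coh w)) \<le> hs.dst (s k) C * nrm (coh w)"
          using op_le_hs_nrm[OF HS_lincomb[OF sV C] coh_in, of 1 k "-1" w]
          by (simp add: dst_def hs.dst_def lincomb_apply coh_in)
        then show "norm (nrm (s k (coh w)) - nrm (C (coh w))) \<le> hs.dst (s k) C * nrm (coh w)"
          using nrm_diff_le[OF HS_in[OF sV coh_in] HS_in[OF C coh_in], of k w w] by simp
      qed
      show "(\<lambda>k. hs.dst (s k) C * nrm (coh w)) \<longlonglongrightarrow> 0"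
        using lim by (simp add: hs.lim_to_def tendsto_mult_left_zero)
    qed
    then show ?thesis unfolding weighted_nrm_def by (intro tendsto_intros)
  qed
  have *: "weighted_nrm C \<in> L2 M \<and> l2_nrm M (weighted_nrm C) \<le> hs.nrm C + \<epsilon>" if e: "\<epsilon> > 0" for \<epsilon>
  proof -
    obtain N where N: "\<And>k. k \<ge> N \<Longrightarrow> hs.dst (s k) C < \<epsilon>"
      using LIMSEQ_D[OF lim[unfolded hs.lim_to_def] e] by (auto simp: hs.dst_ge0 sV C)
    show ?thesis
    proof (rule L2_fatou[where s = "\<lambda>k. weighted_nrm (s k)" and N = N])
      show "l2_nrm M (weighted_nrm (s k)) \<le> hs.nrm C + \<epsilon>" if "k \<ge> N" for k
        using span[OF sspan[of k]] hs.nrm_le_dst[OF sV C, of k] N[OF that] by simp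
    qed (use span[OF sspan] pt weighted_nrm_measurable[OF HS_bounded[OF C]] in auto)
  qed
  from *[of 1] show "weighted_nrm C \<in> L2 M" by simp
  show "l2_nrm M (weighted_nrm C) \<le> hs.nrm C"
    by (rule field_le_epsilon) (use * in blast)
qed

text \<open>By the parallelogram law the modulus splits into the square roots of the weights at z -
  w and z + w, one for each coherent state in the kernel.\<close>

lemma integrand_phase:
  "cmod (exp (of_real (l / 2) * (- hdot z z - hdot w w + hdot w z - hdot z w)))
    = exp (- l * (norm (z - w))\<^sup>2 / 4) * exp (- l * (norm (z + w))\<^sup>2 / 4)"
proof -
  have "Re (hdot w z) = Re (hdot z w)" using arg_cong[OF cnj_hdot[of w z], of Re] by simp
  then show ?thesis
    by (simp add: norm_sq_add norm_sq_diff exp_add[symmetric] hdot_self algebra_simps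
        add_divide_distrib diff_divide_distrib)
qed

lemma L2_affine:
  fixes T :: "complex ^ 'n \<Rightarrow> complex ^ 'n"
  assumes "linear T" "\<And>x. norm (T x) = norm x" and f: "f \<in> L2 M"
  shows "(\<lambda>x. f (T x + a)) \<in> L2 M" "l2_nrm M (\<lambda>x. f (T x + a)) = l2_nrm M f"
proof -
  have [measurable]: "T \<in> borel_measurable borel"
    using linear_continuous_on[of T UNIV] assms
    by (simp add: linear_conv_bounded_linear borel_measurable_continuous_onI)
  have fm [measurable]: "f \<in> borel_measurable borel" using L2_measurable[OF f] by simp
  have m: "(\<lambda>x. (cmod (f x))\<^sup>2) \<in> borel_measurable borel" by measurable
  show "(\<lambda>x. f (T x + a)) \<in> L2 M"
    using mu_integral_affine(2)[OF assms(1,2) m, of l a] L2_integrable[OF f] by (simp add: L2_def)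
  show "l2_nrm M (\<lambda>x. f (T x + a)) = l2_nrm M f"
    using mu_integral_affine(1)[OF assms(1,2) m, of l a] by (simp add: l2_nrm_eq)
qed

text \<open>Moving B to the other side turns the kernel into the inner product of
  \<open>C (coh (z - w))\<close> and \<open>adj B (coh (z + w))\<close>. Cauchy-Schwarz in H and
  then in w leaves two weighted norms, whose L2 norms are invariant under reflection and translation
  of w.\<close>

lemma compose_integrand:
  assumes B: "B \<in> HS" and C: "C \<in> HS"
  shows "integrable M (integrand (compose H B C) z)"
    and "cmod (weyl_integral l (compose H B C) z) \<le> 2 ^ CARD('n) * (hs.nrm B * hs.nrm C)"
proof -
  have BC: "bounded_op H ip (compose H B C)" by (intro compose_bounded HS_bounded B C)
  note aB = adj_HS(1)[OF B]
  let ?P = "\<lambda>w. weighted_nrm C (- w + z)" and ?Q = "\<lambda>w. weighted_nrm (adj B) (w + z)"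
  have P: "?P \<in> L2 M" "l2_nrm M ?P \<le> hs.nrm C"
    using L2_affine[of uminus "weighted_nrm C" z] weighted_nrm_L2[OF C] by (simp_all add: module_hom_uminus linear_uminus)
  have Q: "?Q \<in> L2 M" "l2_nrm M ?Q \<le> hs.nrm B"
    using L2_affine[of "\<lambda>w. w" "weighted_nrm (adj B)" z] weighted_nrm_L2[OF aB] hs_nrm_adj[OF B]
    by (simp_all add: linear_ident)
  have pt: "cmod (integrand (compose H B C) z w) \<le> Re (?P w * cnj (?Q w))" for w
  proof -
    have CV: "C (coh (z - w)) \<in> H" by (rule HS_in[OF C coh_in])
    have "compose H B C (coh (z - w)) (z + w) = ip (B (C (coh (z - w)))) (coh (z + w))"
      by (simp add: compose_eq coh_in ip_coh HS_in[OF B CV])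
    also have "\<dots> = ip (C (coh (z - w))) (adj B (coh (z + w)))"
      by (rule ip_adj[OF HS_bounded[OF B] CV coh_in])
    finally have "cmod (compose H B C (coh (z - w)) (z + w))
        \<le> nrm (C (coh (z - w))) * nrm (adj B (coh (z + w)))"
      using cauchy_schwarz[OF CV HS_in[OF aB coh_in]] by simp
    then have "cmod (integrand (compose H B C) z w) \<le> (nrm (C (coh (z - w))) * nrm (adj B (coh (z + w))))
        * (exp (- l * (norm (z - w))\<^sup>2 / 4) * exp (- l * (norm (z + w))\<^sup>2 / 4))"
      unfolding integrand_def norm_mult[of "compose H B C _ _"] integrand_phase
      by (rule mult_right_mono) simp
    also have "\<dots> = Re (?P w * cnj (?Q w))"
      by (simp add: weighted_nrm_def add.commute)
    finally show ?thesis .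
  qed
  have iPQ: "integrable M (\<lambda>w. Re (?P w * cnj (?Q w)))"
    by (intro integrable_Re L2_mult_integrable P Q)
  show int: "integrable M (integrand (compose H B C) z)"
    by (rule Bochner_Integration.integrable_bound[OF iPQ])
      (use pt integrand_measurable[OF BC] in \<open>auto intro: order_trans[OF _ abs_ge_self]\<close>)
  have "cmod (LINT w|M. integrand (compose H B C) z w) \<le> (LINT w|M. cmod (integrand (compose H B C) z w))"
    by (rule integral_norm_bound)
  also have "\<dots> \<le> (LINT w|M. Re (?P w * cnj (?Q w)))"
    by (rule integral_mono[OF integrable_norm[OF int] iPQ pt])
  also have "\<dots> = Re (l2_ip M ?P ?Q)"
    unfolding l2_ip_def by (rule integral_Re) (intro L2_mult_integrable P Q)
  also have "\<dots> \<le> l2_nrm M ?P * l2_nrm M ?Q"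
    using l2.cauchy_schwarz[OF P(1) Q(1)] complex_Re_le_cmod order_trans by blast
  also have "\<dots> \<le> hs.nrm C * hs.nrm B"
    by (intro mult_mono P Q hs.nrm_ge0 C l2.nrm_ge0)
  finally show "cmod (weyl_integral l (compose H B C) z) \<le> 2 ^ CARD('n) * (hs.nrm B * hs.nrm C)"
    unfolding weyl_integral_eq[OF BC] by (simp add: norm_mult norm_power mult.commute)
qed

text \<open>From A B - A' B' = (A - A') B + A' (B - B'), for norms and symbols alike.\<close>

lemma compose_dst:
  assumes V: "A \<in> HS" "B \<in> HS" "A' \<in> HS" "B' \<in> HS"
  shows "hs.dst (compose H A B) (compose H A' B') \<le> hs.dst A A' * hs.nrm B + hs.nrm A' * hs.dst B B'"
    and "cmod (weyl_integral l (compose H A B) z - weyl_integral l (compose H A' B') z)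
      \<le> 2 ^ CARD('n) * (hs.dst A A' * hs.nrm B + hs.nrm A' * hs.dst B B')"
proof -
  let ?D = "lincomb_op H 1 A (-1) A'" and ?F = "lincomb_op H 1 B (-1) B'"
  have D: "?D \<in> HS" and F: "?F \<in> HS" by (intro HS_lincomb V)+
  let ?X = "compose H ?D B" and ?Y = "compose H A' ?F"
  have X: "?X \<in> HS" and Y: "?Y \<in> HS" by (intro compose_HS_left HS_bounded D F V)+
  note c = compose_HS_left[OF HS_bounded[OF V(1)] V(2)] compose_HS_left[OF HS_bounded[OF V(3)] V(4)]
  have eq: "lincomb_op H 1 (compose H A B) (-1) (compose H A' B') = lincomb_op H 1 ?X 1 ?Y"
  proof
    fix f show "lincomb_op H 1 (compose H A B) (-1) (compose H A' B') f = lincomb_op H 1 ?X 1 ?Y f"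
    proof (cases "f \<in> H")
      case True
      have "A' (fun_lc 1 (B f) (-1) (B' f)) = fun_lc 1 (A' (B f)) (-1) (A' (B' f))"
        by (rule op_lc[OF HS_bounded[OF V(3)] HS_in[OF V(2) True] HS_in[OF V(4) True]])
      with True show ?thesis
        by (simp add: compose_eq lincomb_apply HS_in[OF V(2) True]) (simp add: fun_lc_def)
    qed (simp add: lincomb_op_def)
  qed
  have "hs.dst (compose H A B) (compose H A' B') \<le> hs.nrm ?X + hs.nrm ?Y"
    unfolding hs.dst_def eq using hs.nrm_lc_le[OF X Y, of 1 1] by simp
  also have "\<dots> \<le> hs.dst A A' * hs.nrm B + hs.nrm A' * hs.dst B B'"
    unfolding hs.dst_def by (intro add_mono hs_nrm_compose_le D F V)
  finally show "hs.dst (compose H A B) (compose H A' B') \<le> hs.dst A A' * hs.nrm B + hs.nrm A' * hs.dst B B'" .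
  have i1: "integrable M (integrand (compose H A B) z)" by (rule compose_integrand(1)[OF V(1,2)])
  have i2: "integrable M (integrand (compose H A' B') z)" by (rule compose_integrand(1)[OF V(3,4)])
  have iX: "integrable M (integrand ?X z)" by (rule compose_integrand(1)[OF D V(2)])
  have iY: "integrable M (integrand ?Y z)" by (rule compose_integrand(1)[OF V(3) F])
  have "integrand (compose H A B) z w - integrand (compose H A' B') z w = integrand ?X z w + integrand ?Y z w" for w
    using integrand_lincomb[of 1 "compose H A B" "-1" "compose H A' B'" z w]
      integrand_lincomb[of 1 ?X 1 ?Y z w] unfolding eq by simp
  then have "(LINT w|M. integrand (compose H A B) z w) - (LINT w|M. integrand (compose H A' B') z w)
      = (LINT w|M. integrand ?X z w) + (LINT w|M. integrand ?Y z w)"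
    using i1 i2 iX iY by (metis (mono_tags, lifting) Bochner_Integration.integral_add
        Bochner_Integration.integral_cong Bochner_Integration.integral_diff)
  then have W: "weyl_integral l (compose H A B) z - weyl_integral l (compose H A' B') z
      = weyl_integral l ?X z + weyl_integral l ?Y z"
    unfolding weyl_integral_eq[OF HS_bounded[OF c(1)]] weyl_integral_eq[OF HS_bounded[OF c(2)]]
      weyl_integral_eq[OF HS_bounded[OF X]] weyl_integral_eq[OF HS_bounded[OF Y]]
    by (simp add: right_diff_distrib[symmetric] distrib_left[symmetric])
  show "cmod (weyl_integral l (compose H A B) z - weyl_integral l (compose H A' B') z)
      \<le> 2 ^ CARD('n) * (hs.dst A A' * hs.nrm B + hs.nrm A' * hs.dst B B')"
    unfolding hs.dst_def distrib_left W
    by (rule order_trans[OF norm_triangle_ineq]) (intro add_mono compose_integrand D F V)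
qed

text \<open>The approximants \<open>W k\<close> converge in L2 to the partner of T and pointwise to
  the integral formula; \<open>L2_lim_pointwise\<close> identifies the two limits.\<close>

lemma trace_class_matched:
  assumes "T \<in> trace_class H ip"
  shows "matched T (weyl_integral l T)"
proof -
  obtain B C where T: "T = compose H B C" and V: "B \<in> HS" "C \<in> HS"
    using assms by (auto simp: trace_class_def)
  have THS: "T \<in> HS" by (rule trace_class_HS[OF assms])
  obtain b b' where b: "\<And>k. pairs (b k, b' k)" and bl: "hs.lim_to b B" using approx[OF V(1)] by auto
  obtain c c' where c: "\<And>k. pairs (c k, c' k)" and cl: "hs.lim_to c C" using approx[OF V(2)] by auto
  have bV: "b k \<in> HS" and cV: "c k \<in> HS" for k using pairs_in[OF b] pairs_in[OF c] by simp_all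
  have "\<forall>k. \<exists>t. pairs (compose H (b k) (c k), t)" using pairs_compose[OF b c] by simp
  then obtain W where W: "\<forall>k. pairs (compose H (b k) (c k), W k)" by (rule choice[THEN exE])
  have Wint: "weyl_integral l (compose H (b k) (c k)) = W k" for k
    using pairs_integral[OF W[rule_format]] by simp
  have WL: "W k \<in> L2 M" for k using pairs_in[OF W[rule_format]] by simp
  have zero: "(\<lambda>k. r * (hs.dst (b k) B * hs.nrm (c k) + hs.nrm B * hs.dst (c k) C)) \<longlonglongrightarrow> 0" for r
  proof -
    have "(\<lambda>k. r * (hs.dst (b k) B * hs.nrm (c k) + hs.nrm B * hs.dst (c k) C))
      \<longlonglongrightarrow> r * (0 * hs.nrm C + hs.nrm B * 0)"
      using bl cl by (intro tendsto_intros hs.lim_to_nrm cV V) (simp_all add: hs.lim_to_def)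
    then show ?thesis by simp
  qed
  have pt: "(\<lambda>k. W k z) \<longlonglongrightarrow> weyl_integral l T z" for z
  proof (rule Lim_null_comparison[THEN LIM_zero_cancel])
    show "\<forall>\<^sub>F k in sequentially. cmod (W k z - weyl_integral l T z)
      \<le> 2 ^ CARD('n) * (hs.dst (b k) B * hs.nrm (c k) + hs.nrm B * hs.dst (c k) C)"
      unfolding Wint[symmetric] T by (intro always_eventually allI compose_dst bV cV V)
  qed (rule zero)
  obtain F where F: "matched T F" using matched_exists_ip[OF THS] by auto
  have FL: "F \<in> L2 M" using F by (simp add: matched_def)
  have "l2_dst M (W k) F \<le> 1 * (hs.dst (b k) B * hs.nrm (c k) + hs.nrm B * hs.dst (c k) C)" for k
    using matched_dst[OF pairs_matched[OF W[rule_format]] F, of k] compose_dst(1)[OF bV cV V, of k k]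
    by (simp add: T)
  then have lim: "l2.lim_to M W F"
    unfolding l2.lim_to_def by (intro Lim_null_comparison[OF _ zero[of 1]]) (simp add: l2.dst_ge0 WL FL)
  have m: "weyl_integral l T \<in> borel_measurable borel"
    by (rule borel_measurable_LIMSEQ_metric[OF _ pt]) (use L2_measurable[OF WL] in simp)
  have "AE z in M. F z = weyl_integral l T z"
    by (rule L2_lim_pointwise[OF WL FL _ lim AE_I2[OF pt]]) (simp add: m)
  from matched_cong_AE[OF F m this] show ?thesis .
qed

text \<open>A partner of A has the property by which \<open>weyl_extension\<close> is chosen, so the
  chosen function has it too. Since some trace class sequence does converge to A, both are limits of
  the same symbols and have equal inner products with every g.\<close>

lemma weyl_extension_matched:
  assumes A: "A \<in> HS"
  shows "matched A (weyl_extension l A)"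
proof -
  let ?lim = "\<lambda>T. (\<forall>k::nat. T k \<in> trace_class H ip) \<and>
    (\<lambda>k. hs_norm H ip (lincomb_op H 1 (T k) (- 1) A)) \<longlonglongrightarrow> 0"
  let ?P = "\<lambda>F. F \<in> L2 M \<and> (\<forall>T. ?lim T \<longrightarrow> (\<forall>k. weyl_integral l (T k) \<in> L2 M) \<and>
    (\<lambda>k. L2_dist M (weyl_integral l (T k)) F) \<longlonglongrightarrow> 0)"
  obtain F0 where F0: "matched A F0" using matched_exists_ip[OF A] by auto
  have lim_iff: "?lim T \<longleftrightarrow> (\<forall>k. T k \<in> trace_class H ip) \<and> hs.lim_to T A" for T
    by (auto simp: hs.lim_to_def hs.dst_def hs_norm_eq HS_lincomb trace_class_HS A)
  have dst0: "L2_dist M (weyl_integral l T) F0 = hs.dst T A" if "T \<in> trace_class H ip" for T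
    using matched_dst[OF trace_class_matched[OF that] F0] by (simp add: L2_dist_eq)
  have PF0: "?P F0"
    unfolding lim_iff using trace_class_matched F0 dst0
    by (auto simp: matched_def hs.lim_to_def)
  have P: "?P (weyl_extension l A)"
    unfolding weyl_extension_def by (rule someI[of ?P F0, OF PF0])
  obtain T where "(\<forall>k. T k \<in> trace_class H ip) \<and> hs.lim_to T A" using trace_class_dense[OF A] by blast
  then have T: "\<And>k. T k \<in> trace_class H ip" and limT: "hs.lim_to T A" by auto
  have F: "weyl_extension l A \<in> L2 M" using P by simp
  have l1: "(\<lambda>k. l2_dst M (weyl_integral l (T k)) (weyl_extension l A)) \<longlonglongrightarrow> 0"
    using P T limT unfolding lim_iff L2_dist_eq by blast
  have WL: "weyl_integral l (T k) \<in> L2 M" for k using trace_class_matched[OF T] by (simp add: matched_def)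
  have F0L: "F0 \<in> L2 M" using F0 by (simp add: matched_def)
  have "l2_ip M (weyl_extension l A) g = l2_ip M F0 g" if g: "g \<in> L2 M" for g
  proof (rule LIMSEQ_unique)
    show "(\<lambda>k. l2_ip M (weyl_integral l (T k)) g) \<longlonglongrightarrow> l2_ip M (weyl_extension l A) g"
      using l1 by (intro l2.lim_to_ip_left[OF WL F g]) (simp add: l2.lim_to_def)
    show "(\<lambda>k. l2_ip M (weyl_integral l (T k)) g) \<longlonglongrightarrow> l2_ip M F0 g"
      using limT dst0[OF T] by (intro l2.lim_to_ip_left[OF WL F0L g]) (simp add: l2.lim_to_def hs.lim_to_def L2_dist_eq)
  qed
  then show ?thesis using F0 F G_L2 by (simp add: matched_def)
qed

lemma weyl_symbol_matched: "A \<in> HS \<Longrightarrow> matched A (weyl_symbol l A)"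
  by (simp add: weyl_symbol_def weyl_extension_matched)

end

section \<open>The diamond group and its representation\<close>

text \<open>Bijectivity comes from the group inverse. \<open>BijGroup\<close> contains extensional
  maps only, hence the assumption \<open>ext\<close>.\<close>

lemma group_actionI:
  assumes G: "group G"
    and ext: "\<And>g. g \<in> carrier G \<Longrightarrow> \<phi> g \<in> extensional X"
    and closed: "\<And>g x. g \<in> carrier G \<Longrightarrow> x \<in> X \<Longrightarrow> \<phi> g x \<in> X"
    and one: "\<And>x. x \<in> X \<Longrightarrow> \<phi> \<one>\<^bsub>G\<^esub> x = x"
    and mult: "\<And>g h x. g \<in> carrier G \<Longrightarrow> h \<in> carrier G \<Longrightarrow> x \<in> X \<Longrightarrow> \<phi> (g \<otimes>\<^bsub>G\<^esub> h) x = \<phi> g (\<phi> h x)"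
  shows "group_action G X \<phi>"
proof -
  interpret group G by fact
  have bij: "\<phi> g \<in> Bij X" if g: "g \<in> carrier G" for g
  proof -
    have "bij_betw (\<phi> g) X X"
    proof (rule bij_betw_byWitness[where f' = "\<phi> (inv\<^bsub>G\<^esub> g)"])
      show "\<forall>x\<in>X. \<phi> (inv\<^bsub>G\<^esub> g) (\<phi> g x) = x" "\<forall>x\<in>X. \<phi> g (\<phi> (inv\<^bsub>G\<^esub> g) x) = x"
        using g by (simp_all add: mult[symmetric] one)
    qed (use closed g in auto)
    then show ?thesis using ext[OF g] by (simp add: Bij_def)
  qed
  show ?thesis
  proof (intro group_action.intro group_hom.intro group_hom_axioms.intro homI)
    show "\<phi> (g \<otimes>\<^bsub>G\<^esub> h) = \<phi> g \<otimes>\<^bsub>BijGroup X\<^esub> \<phi> h" if "g \<in> carrier G" "h \<in> carrier G" for g h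
    proof
      fix x show "\<phi> (g \<otimes>\<^bsub>G\<^esub> h) x = (\<phi> g \<otimes>\<^bsub>BijGroup X\<^esub> \<phi> h) x"
        using that bij ext[of "g \<otimes>\<^bsub>G\<^esub> h"]
        by (cases "x \<in> X") (simp_all add: BijGroup_def compose_def mult extensional_def)
    qed
  qed (simp_all add: G group_BijGroup, simp add: BijGroup_def bij)
qed

section \<open>The diamond group, its topology and its action on the plane of z\<close>

context
  fixes \<alpha> :: "'n::finite \<Rightarrow> (real ^ 'm::finite) \<Rightarrow>\<^sub>L real"
begin

lemma T_nth: "torus_act \<alpha> t z $ k = exp (\<i> * of_real (blinfun_apply (\<alpha> k) t)) * z $ k"
  by (simp add: torus_act_def)

lemma T_zero: "torus_act \<alpha> 0 z = z"
  by (simp add: vec_eq_iff T_nth blinfun.zero_right)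

lemma T_plus: "torus_act \<alpha> (s + t) z = torus_act \<alpha> s (torus_act \<alpha> t z)"
  by (simp add: vec_eq_iff T_nth blinfun.add_right exp_add distrib_left)

lemma T_inverse: "torus_act \<alpha> (- t) (torus_act \<alpha> t z) = z" "torus_act \<alpha> t (torus_act \<alpha> (- t) z) = z"
  by (simp_all add: T_plus[symmetric] T_zero)

lemma T_algebra: "torus_act \<alpha> t (z + w) = torus_act \<alpha> t z + torus_act \<alpha> t w" "torus_act \<alpha> t (z - w) = torus_act \<alpha> t z - torus_act \<alpha> t w" "torus_act \<alpha> t (- z) = - torus_act \<alpha> t z"
  "torus_act \<alpha> t (c *s z) = c *s torus_act \<alpha> t z" "torus_act \<alpha> t (r *\<^sub>R z) = r *\<^sub>R torus_act \<alpha> t z" "torus_act \<alpha> t 0 = 0"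
  by (simp_all add: vec_eq_iff T_nth algebra_simps)

lemma hdot_T: "hdot (torus_act \<alpha> t z) (torus_act \<alpha> t w) = hdot z w"
proof -
  have "cnj (exp (\<i> * of_real x)) * exp (\<i> * of_real x) = 1" for x
    by (simp add: exp_cnj exp_add[symmetric])
  moreover have "cnj (e * u) * (e * v) = (cnj e * e) * (cnj u * v)" for e u v :: complex
    by (simp add: mult_ac)
  ultimately have "cnj (exp (\<i> * of_real x) * u) * (exp (\<i> * of_real x) * v) = cnj u * v" for x u v
    by (simp only: mult_1)
  then show ?thesis unfolding hdot_eq T_nth by (simp only:)
qed

lemma hdot_T_minus: "hdot a (torus_act \<alpha> (- t) z) = hdot (torus_act \<alpha> t a) z"
  using hdot_T[of t a "torus_act \<alpha> (- t) z"] by (simp add: T_inverse)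

lemma norm_T: "norm (torus_act \<alpha> t z) = norm z"
  by (rule power2_eq_imp_eq) (simp_all add: norm_sq_hdot hdot_T)

lemma linear_T: "linear (torus_act \<alpha> t)"
  by (rule linearI) (simp_all add: T_algebra)

lemma bounded_linear_T: "bounded_linear (torus_act \<alpha> t)"
  using linear_T by (simp add: linear_conv_bounded_linear)

lemma continuous_on_T [continuous_intros]:
  assumes "continuous_on S f" "continuous_on S g"
  shows "continuous_on S (\<lambda>x. torus_act \<alpha> (f x) (g x))"
  unfolding torus_act_def using assms
  by (intro continuous_intros blinfun.continuous_on) auto

lemma rsymp_eq: "rsymp z w = Im (hdot z w)"
  using arg_cong[OF cnj_hdot[of z w], of Im] by (simp add: rsymp_def symp_def cdot_conjv)

lemma carrier_GG: "carrier (diamond_group \<alpha>) = UNIV"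
  by (simp add: diamond_group_def)

lemma one_GG: "\<one>\<^bsub>diamond_group \<alpha>\<^esub> = (0, 0, 0)"
  by (simp add: diamond_group_def)

lemma mult_GG: "(t, z, c) \<otimes>\<^bsub>diamond_group \<alpha>\<^esub> (t', z', c') = (t + t', z + torus_act \<alpha> t z', c + c' + Im (hdot z (torus_act \<alpha> t z')) / 2)"
  by (simp add: diamond_group_def rsymp_eq)

lemma group_GG: "group (diamond_group \<alpha>)"
proof (rule groupI)
  fix x y z :: "('m, 'n) diamond"
  assume "x \<in> carrier (diamond_group \<alpha>)" "y \<in> carrier (diamond_group \<alpha>)" "z \<in> carrier (diamond_group \<alpha>)"
  obtain t1 z1 c1 t2 z2 c2 t3 z3 c3 where xyz: "x = (t1, z1, c1)" "y = (t2, z2, c2)" "z = (t3, z3, c3)"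
    by (metis surj_pair)
  \<comment> \<open>In the central coordinate this rests on invariance of the pairing under the
    torus.\<close>
  show "x \<otimes>\<^bsub>diamond_group \<alpha>\<^esub> y \<otimes>\<^bsub>diamond_group \<alpha>\<^esub> z = x \<otimes>\<^bsub>diamond_group \<alpha>\<^esub> (y \<otimes>\<^bsub>diamond_group \<alpha>\<^esub> z)"
    by (simp add: xyz mult_GG T_plus T_algebra hdot_algebra hdot_T add_divide_distrib)
next
  fix x :: "('m, 'n) diamond"
  assume "x \<in> carrier (diamond_group \<alpha>)"
  obtain t z c where x: "x = (t, z, c)" by (metis surj_pair)
  show "\<one>\<^bsub>diamond_group \<alpha>\<^esub> \<otimes>\<^bsub>diamond_group \<alpha>\<^esub> x = x" by (simp add: x one_GG mult_GG T_zero hdot_algebra)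
  have "(- t, - torus_act \<alpha> (- t) z, - c) \<otimes>\<^bsub>diamond_group \<alpha>\<^esub> x = \<one>\<^bsub>diamond_group \<alpha>\<^esub>"
    by (simp add: x one_GG mult_GG hdot_algebra hdot_self)
  then show "\<exists>y\<in>carrier (diamond_group \<alpha>). y \<otimes>\<^bsub>diamond_group \<alpha>\<^esub> x = \<one>\<^bsub>diamond_group \<alpha>\<^esub>" by (auto simp: carrier_GG)
qed (simp_all add: carrier_GG)

lemma inv_GG: "inv\<^bsub>diamond_group \<alpha>\<^esub> (t, z, c) = (- t, - torus_act \<alpha> (- t) z, - c)"
proof -
  have "(- t, - torus_act \<alpha> (- t) z, - c) \<otimes>\<^bsub>diamond_group \<alpha>\<^esub> (t, z, c) = \<one>\<^bsub>diamond_group \<alpha>\<^esub>"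
    by (simp add: one_GG mult_GG hdot_algebra hdot_self)
  then show ?thesis by (intro group.inv_equality[OF group_GG]) (simp_all add: carrier_GG)
qed

lemma topological_GG: "topological_grp (diamond_group \<alpha>)"
  unfolding topological_grp_def carrier_GG
proof (intro conjI group_GG)
  have "(\<lambda>(g, h). g \<otimes>\<^bsub>diamond_group \<alpha>\<^esub> h) = (\<lambda>p. (fst (fst p) + fst (snd p), fst (snd (fst p)) + torus_act \<alpha> (fst (fst p)) (fst (snd (snd p))),
    snd (snd (fst p)) + snd (snd (snd p)) + Im (hdot (fst (snd (fst p))) (torus_act \<alpha> (fst (fst p)) (fst (snd (snd p))))) / 2))"
    by (auto simp: mult_GG fun_eq_iff)
  then show "continuous_on (UNIV \<times> UNIV) (\<lambda>(g, h). g \<otimes>\<^bsub>diamond_group \<alpha>\<^esub> h)"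
    by (simp only:) (intro continuous_intros; simp)
  have "m_inv (diamond_group \<alpha>) = (\<lambda>g. (- fst g, - torus_act \<alpha> (- fst g) (fst (snd g)), - snd (snd g)))"
    by (auto simp: inv_GG fun_eq_iff)
  then show "continuous_on UNIV (m_inv (diamond_group \<alpha>))"
    by (simp only:) (intro continuous_intros)
qed

lemma act_eq: "diamond_act \<alpha> (t, z0, c0) z = torus_act \<alpha> t z + z0"
  by (simp add: diamond_act_def)

lemma act_mult: "diamond_act \<alpha> (g \<otimes>\<^bsub>diamond_group \<alpha>\<^esub> h) z = diamond_act \<alpha> g (diamond_act \<alpha> h z)"
  by (cases g; cases h) (simp add: mult_GG act_eq T_plus T_algebra add_ac)

lemma act_one: "diamond_act \<alpha> \<one>\<^bsub>diamond_group \<alpha>\<^esub> z = z"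
  by (simp add: one_GG act_eq T_zero)

lemma act_distr: "distr (mu l) (mu l) (diamond_act \<alpha> g) = mu l"
  using mu_distr_affine[OF linear_T norm_T] by (cases g) (simp add: act_eq[abs_def])

lemma homogeneous: "homogeneous_space (diamond_group \<alpha>) (mu l) (diamond_act \<alpha>)"
  unfolding homogeneous_space_def
proof (intro conjI ballI)
  show "transitive_action (diamond_group \<alpha>) (space (mu l)) (diamond_act \<alpha>)"
  proof (intro transitive_action.intro transitive_action_axioms.intro)
    show "group_action (diamond_group \<alpha>) (space (mu l)) (diamond_act \<alpha>)"
      by (rule group_actionI[OF group_GG]) (simp_all add: act_one act_mult)
    fix x y :: "complex ^ 'n"
    have "diamond_act \<alpha> (0, y - x, 0) x = y" by (simp add: act_eq T_zero)
    then show "\<exists>g\<in>carrier (diamond_group \<alpha>). diamond_act \<alpha> g x = y" by (auto simp: carrier_GG)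
  qed
  have *: "(\<lambda>(g, x). diamond_act \<alpha> g x) = (\<lambda>p. torus_act \<alpha> (fst (fst p)) (snd p) + fst (snd (fst p)))"
    by (auto simp: act_eq fun_eq_iff)
  show "continuous_on (carrier (diamond_group \<alpha>) \<times> space (mu l)) (\<lambda>(g, x). diamond_act \<alpha> g x)"
    unfolding * by (intro continuous_intros)
  fix g
  have "continuous_on UNIV (diamond_act \<alpha> g)"
    by (cases g) (auto simp: act_eq[abs_def] intro!: continuous_intros)
  then show "diamond_act \<alpha> g \<in> measurable (mu l) (mu l)" by (simp add: borel_measurable_continuous_onI)
  show "distr (mu l) (mu l) (diamond_act \<alpha> g) = mu l" by (rule act_distr)
qed simp_all

end

section \<open>The unitary representation\<close>

locale diamond = fock_space l ty for l and ty :: "'n::finite itself" +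
  fixes \<alpha> :: "'n \<Rightarrow> (real ^ 'm::finite) \<Rightarrow>\<^sub>L real" and \<kappa> :: "real ^ 'm \<Rightarrow> complex"
  assumes \<kappa>: "unitary_character \<kappa>"
begin

abbreviation "GG \<equiv> diamond_group \<alpha>"
abbreviation "act \<equiv> diamond_act \<alpha>"
abbreviation "T \<equiv> torus_act \<alpha>"
abbreviation "\<pi> \<equiv> diamond_rep \<alpha> \<kappa> l"

lemma \<kappa>_props: "continuous_on UNIV \<kappa>" "\<kappa> (s + t) = \<kappa> s * \<kappa> t" "cmod (\<kappa> t) = 1" "\<kappa> 0 = 1"
proof -
  show "continuous_on UNIV \<kappa>" and a: "\<kappa> (s + t) = \<kappa> s * \<kappa> t" and n: "cmod (\<kappa> t) = 1" for s t
    using \<kappa> by (auto simp: unitary_character_def)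
  have "\<kappa> 0 * \<kappa> 0 = \<kappa> 0" using a[of 0 0] by simp
  moreover have "\<kappa> 0 \<noteq> 0" using n[of 0] by auto
  ultimately show "\<kappa> 0 = 1" by simp
qed

text \<open>The multiplier of the representation, with |z0|^2 written as a pairing so that exponents
  can be compared by bilinearity.\<close>

definition mult_factor :: "('m, 'n) diamond \<Rightarrow> complex ^ 'n \<Rightarrow> complex" where
  "mult_factor = (\<lambda>(t, z0, c0) z. \<kappa> t * exp (\<i> * of_real (l * c0) + of_real (l / 2) * hdot z0 z
     - of_real (l / 4) * hdot z0 z0))"

lemma rep_eq: "f \<in> H \<Longrightarrow> \<pi> (t, z0, c0) f z = mult_factor (t, z0, c0) z * f (T (- t) (z - z0))"
  by (simp add: diamond_rep_def mult_factor_def hdot_self)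

lemma rep_ext: "f \<notin> H \<Longrightarrow> \<pi> g f = undefined"
  by (cases g) (simp add: diamond_rep_def)

text \<open>The multiplier carries the weight at z to the weight at z - z0, which is the source of
  unitarity.\<close>

lemma cmod_mult_factor:
  "cmod (mult_factor (t, z0, c0) z) * exp (- l * (norm z)\<^sup>2 / 4) = exp (- l * (norm (z - z0))\<^sup>2 / 4)"
  by (simp add: mult_factor_def norm_mult \<kappa>_props norm_sq_diff hdot_self exp_add[symmetric] algebra_simps
      add_divide_distrib diff_divide_distrib)

lemma wt_rep:
  assumes f: "f \<in> H" and h: "h \<in> H"
  shows "wt l (\<pi> (t, z0, c0) f) z * cnj (wt l (\<pi> (t, z0, c0) h) z)
    = wt l f (T (- t) z + - T (- t) z0) * cnj (wt l h (T (- t) z + - T (- t) z0))"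
proof -
  let ?m = "mult_factor (t, z0, c0) z" and ?u = "T (- t) (z - z0)"
  have u: "T (- t) z + - T (- t) z0 = ?u" by (simp add: T_algebra)
  have "(?m * complex_of_real (exp (- l * (norm z)\<^sup>2 / 4))) * cnj (?m * complex_of_real (exp (- l * (norm z)\<^sup>2 / 4)))
      = of_real ((cmod ?m * exp (- l * (norm z)\<^sup>2 / 4))\<^sup>2)"
    by (subst complex_norm_square[symmetric]) (simp add: norm_mult)
  also have "\<dots> = complex_of_real (exp (- l * (norm ?u)\<^sup>2 / 4)) * complex_of_real (exp (- l * (norm ?u)\<^sup>2 / 4))"
    unfolding cmod_mult_factor norm_T by (simp add: power2_eq_square)
  finally have "(?m * complex_of_real (exp (- l * (norm z)\<^sup>2 / 4))) * cnj (?m * complex_of_real (exp (- l * (norm z)\<^sup>2 / 4)))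
      * (f ?u * cnj (h ?u)) = complex_of_real (exp (- l * (norm ?u)\<^sup>2 / 4)) * complex_of_real (exp (- l * (norm ?u)\<^sup>2 / 4))
      * (f ?u * cnj (h ?u))" by simp
  then show ?thesis
    unfolding wt_def rep_eq[OF f] rep_eq[OF h] u by (simp add: mult_ac)
qed

lemma rep_in:
  assumes f: "f \<in> H" shows "\<pi> g f \<in> H"
proof -
  obtain t z0 c0 where g: "g = (t, z0, c0)" by (metis surj_pair)
  have "entire (\<lambda>z. f (T (- t) z + - T (- t) z0))"
    by (rule entire_compose_affine[OF fock_entire[OF f] bounded_linear_T]) (simp add: T_algebra)
  moreover have "entire (\<lambda>z. \<kappa> t * exp (of_real (l / 2) * hdot z0 z + (\<i> * of_real (l * c0) - of_real (l / 4) * hdot z0 z0)))"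
    by (intro entire_mult entire_const entire_exp_hdot)
  ultimately have "entire (\<lambda>z. (\<kappa> t * exp (of_real (l / 2) * hdot z0 z + (\<i> * of_real (l * c0) - of_real (l / 4) * hdot z0 z0)))
      * f (T (- t) z + - T (- t) z0))" by (rule entire_mult[rotated])
  also have "(\<lambda>z. (\<kappa> t * exp (of_real (l / 2) * hdot z0 z + (\<i> * of_real (l * c0) - of_real (l / 4) * hdot z0 z0)))
      * f (T (- t) z + - T (- t) z0)) = \<pi> g f"
    unfolding g rep_eq[OF f] fun_eq_iff by (simp add: mult_factor_def T_algebra add_diff_eq add.commute)
  finally have e: "entire (\<pi> g f)" .
  have sq: "(cmod u)\<^sup>2 = Re (u * cnj u)" for u
    using complex_norm_square[of u] by (metis Re_complex_of_real)
  have "(\<lambda>z. wt l f (T (- t) z + - T (- t) z0)) \<in> L2 M"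
    by (rule L2_affine[OF linear_T norm_T fock_wt[OF f]])
  then have "integrable M (\<lambda>z. (cmod (wt l (\<pi> g f) z))\<^sup>2)"
    unfolding sq g wt_rep[OF f f] by (simp only: L2_def sq mem_Collect_eq)
  then show ?thesis
    using e entire_measurable[OF e] by (simp add: fock_iff L2_def)
qed

lemma rep_ip:
  assumes f: "f \<in> H" and h: "h \<in> H" shows "ip (\<pi> g f) (\<pi> g h) = ip f h"
proof -
  obtain t z0 c0 where g: "g = (t, z0, c0)" by (metis surj_pair)
  have m: "(\<lambda>z. wt l f z * cnj (wt l h z)) \<in> borel_measurable borel"
    using L2_measurable[OF fock_wt[OF f]] L2_measurable[OF fock_wt[OF h]] by simp
  show ?thesis
    unfolding fock_inner_eq l2_ip_def g wt_rep[OF f h]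
    by (rule mu_integral_affine(1)[OF linear_T norm_T m])
qed

lemma rep_lc: "f \<in> H \<Longrightarrow> h \<in> H \<Longrightarrow> \<pi> g (fun_lc a f b h) = fun_lc a (\<pi> g f) b (\<pi> g h)"
  by (cases g) (simp add: fun_eq_iff rep_eq lc_in, simp add: rep_eq fun_lc_def algebra_simps)

lemma rep_mult: "f \<in> H \<Longrightarrow> \<pi> (g \<otimes>\<^bsub>GG\<^esub> g') f = \<pi> g (\<pi> g' f)"
proof -
  assume f: "f \<in> H"
  obtain t z0 c0 t' z0' c0' where g: "g = (t, z0, c0)" "g' = (t', z0', c0')" by (metis surj_pair)
  show ?thesis
  proof
    fix z
    let ?w = "T t z0'"
    have arg: "T (- (t + t')) (z - (z0 + ?w)) = T (- t') (T (- t) (z - z0) - z0')"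
    proof -
      have "T (- (t + t')) x = T (- t') (T (- t) x)" for x
        by (simp add: T_plus[symmetric] add.commute)
      then show ?thesis by (simp add: T_algebra T_inverse)
    qed
    have h1: "hdot z0' (T (- t) (z - z0)) = hdot ?w (z - z0)" by (rule hdot_T_minus)
    have h2: "hdot z0' z0' = hdot ?w ?w" by (simp add: hdot_T)
    \<comment> \<open>2 i Im x = x - cnj x expresses the cocycle of the group law through the
      pairings in the exponents.\<close>
    have im: "\<i> * complex_of_real (l * (c0 + c0' + Im (hdot z0 ?w) / 2))
      = \<i> * of_real (l * c0) + \<i> * of_real (l * c0') + of_real (l / 4) * (hdot z0 ?w - hdot ?w z0)"
    proof -
      have d: "hdot z0 ?w - hdot ?w z0 = of_real (2 * Im (hdot z0 ?w)) * \<i>"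
        using complex_diff_cnj[of "hdot z0 ?w"] by (simp add: cnj_hdot)
      show ?thesis unfolding d by (simp add: algebra_simps)
    qed
    have ex: "\<i> * complex_of_real (l * (c0 + c0' + Im (hdot z0 ?w) / 2)) + of_real (l / 2) * hdot (z0 + ?w) z
        - of_real (l / 4) * hdot (z0 + ?w) (z0 + ?w)
      = (\<i> * of_real (l * c0) + of_real (l / 2) * hdot z0 z - of_real (l / 4) * hdot z0 z0)
        + (\<i> * of_real (l * c0') + of_real (l / 2) * hdot ?w (z - z0) - of_real (l / 4) * hdot ?w ?w)"
      unfolding im by (simp add: hdot_algebra algebra_simps)
    have "mult_factor (t + t', z0 + ?w, c0 + c0' + Im (hdot z0 ?w) / 2) z
      = mult_factor (t, z0, c0) z * mult_factor (t', z0', c0') (T (- t) (z - z0))"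
      unfolding mult_factor_def prod.case h1 h2 ex exp_add \<kappa>_props(2) by (simp only: mult_ac)
    then show "\<pi> (g \<otimes>\<^bsub>GG\<^esub> g') f z = \<pi> g (\<pi> g' f) z"
      unfolding g mult_GG rep_eq[OF f] rep_eq[OF rep_in[OF f]] arg by (simp only: mult.assoc)
  qed
qed

lemma rep_one: "f \<in> H \<Longrightarrow> \<pi> \<one>\<^bsub>GG\<^esub> f = f"
  by (simp add: one_GG fun_eq_iff rep_eq mult_factor_def \<kappa>_props T_zero hdot_algebra)

lemma rep_inv: "f \<in> H \<Longrightarrow> \<pi> (inv\<^bsub>GG\<^esub> g) (\<pi> g f) = f" "f \<in> H \<Longrightarrow> \<pi> g (\<pi> (inv\<^bsub>GG\<^esub> g) f) = f"
  using group.l_inv[OF group_GG, of g] group.r_inv[OF group_GG, of g]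
  by (simp_all add: rep_mult[symmetric] rep_one carrier_GG)

lemma rep_nrm: "f \<in> H \<Longrightarrow> nrm (\<pi> g f) = nrm f"
  by (simp add: nrm_def rep_ip)

lemma rep_bounded: "bounded_op H ip (\<pi> g)"
  by (rule bounded_opI[where C = 1]) (simp_all add: rep_in rep_ext rep_lc rep_nrm)

lemma rep_ip_inv: "f \<in> H \<Longrightarrow> h \<in> H \<Longrightarrow> ip (\<pi> g f) h = ip f (\<pi> (inv\<^bsub>GG\<^esub> g) h)"
  using rep_ip[of f "\<pi> (inv\<^bsub>GG\<^esub> g) h" g] by (simp add: rep_inv rep_in)

text \<open>The group permutes coherent states up to scalars, and this is the scalar between the
  image of \<open>coh a\<close> and \<open>coh (act g a)\<close>.\<close>

definition coh_factor :: "('m, 'n) diamond \<Rightarrow> complex ^ 'n \<Rightarrow> complex" where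
  "coh_factor = (\<lambda>(t, z0, c0) a. \<kappa> t * exp (\<i> * of_real (l * c0) - of_real (l / 4) * hdot z0 z0
     - of_real (l / 2) * hdot (T t a) z0))"

lemma rep_coh: "\<pi> g (coh a) = fun_lc (coh_factor g a) (coh (act g a)) 0 (coh a)"
proof -
  obtain t z0 c0 where g: "g = (t, z0, c0)" by (metis surj_pair)
  have eq: "\<i> * of_real (l * c0) + of_real (l / 2) * hdot z0 z - of_real (l / 4) * hdot z0 z0
      + of_real (l / 2) * hdot a (T (- t) (z - z0))
    = (\<i> * of_real (l * c0) - of_real (l / 4) * hdot z0 z0 - of_real (l / 2) * hdot (T t a) z0)
      + of_real (l / 2) * hdot (T t a + z0) z" for z
    unfolding hdot_T_minus by (simp add: hdot_algebra algebra_simps)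
  have "mult_factor g z * coh a (T (- t) (z - z0)) = coh_factor g a * coh (act g a) z" for z
    unfolding g mult_factor_def coh_factor_def coherent_eq prod.case act_eq mult.assoc exp_add[symmetric] eq ..
  then show ?thesis
    unfolding g by (simp add: fun_eq_iff rep_eq coh_in fun_lc_def)
qed

text \<open>By unitarity only the inner product in the squared distance varies with g. As
  \<open>\<pi> g0 (coh a)\<close> is a multiple of a coherent state, that inner product is a point
  evaluation, given by an explicit continuous formula.\<close>

lemma rep_coh_continuous: "((\<lambda>g. dst (\<pi> g (coh a)) (\<pi> g0 (coh a))) \<longlongrightarrow> 0) (at g0)"
proof -
  let ?c = "coh_factor g0 a" and ?u = "act g0 a"
  have ipc: "ip (\<pi> g (coh a)) (\<pi> g0 (coh a)) = cnj ?c * \<pi> g (coh a) ?u" for g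
    by (simp only: rep_coh[of g0] ip_lc_right coh_in rep_in ip_coh) simp
  have "continuous_on UNIV (\<lambda>g. \<pi> g (coh a) ?u)"
  proof -
    have eq: "(\<lambda>g. \<pi> g (coh a) ?u) = (\<lambda>g. (\<kappa> (fst g) * exp (\<i> * of_real (l * snd (snd g)) + of_real (l / 2) * hdot (fst (snd g)) ?u
      - of_real (l / 4) * hdot (fst (snd g)) (fst (snd g)))) * exp (of_real (l / 2) * hdot a (T (- fst g) (?u - fst (snd g)))))"
    proof
      fix g :: "('m, 'n) diamond"
      obtain t z0 c0 where g: "g = (t, z0, c0)" by (metis surj_pair)
      show "\<pi> g (coh a) ?u = (\<kappa> (fst g) * exp (\<i> * of_real (l * snd (snd g)) + of_real (l / 2) * hdot (fst (snd g)) ?u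
        - of_real (l / 4) * hdot (fst (snd g)) (fst (snd g)))) * exp (of_real (l / 2) * hdot a (T (- fst g) (?u - fst (snd g))))"
        unfolding g rep_eq[OF coh_in] unfolding mult_factor_def coherent_eq prod.case fst_conv snd_conv ..
    qed
    have "continuous_on UNIV (\<lambda>g :: ('m, 'n) diamond. \<kappa> (fst g))"
      by (rule continuous_on_compose2[OF \<kappa>_props(1)]) (auto intro: continuous_intros)
    then show ?thesis unfolding eq by (intro continuous_intros)
  qed
  then have lim: "((\<lambda>g. \<pi> g (coh a) ?u) \<longlongrightarrow> \<pi> g0 (coh a) ?u) (at g0)"
    unfolding continuous_on_def by (rule bspec) (rule UNIV_I)
  have "((\<lambda>g. (dst (\<pi> g (coh a)) (\<pi> g0 (coh a)))\<^sup>2) \<longlongrightarrow>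
      (nrm (coh a))\<^sup>2 + (nrm (coh a))\<^sup>2 - 2 * Re (cnj ?c * \<pi> g0 (coh a) ?u)) (at g0)"
    unfolding dst_sq[OF rep_in[OF coh_in] rep_in[OF coh_in]] rep_nrm[OF coh_in] ipc
    by (intro tendsto_intros lim)
  also have "(nrm (coh a))\<^sup>2 + (nrm (coh a))\<^sup>2 - 2 * Re (cnj ?c * \<pi> g0 (coh a) ?u) = 0"
    unfolding ipc[symmetric] by (simp add: rep_ip coh_in nrm_sq)
  finally have "((\<lambda>g. sqrt ((dst (\<pi> g (coh a)) (\<pi> g0 (coh a)))\<^sup>2)) \<longlongrightarrow> sqrt 0) (at g0)"
    by (rule tendsto_real_sqrt)
  then show ?thesis by (simp add: dst_ge0 rep_in coh_in)
qed

text \<open>Coherent states are total and each \<open>\<pi> g\<close> is isometric, so continuity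
  passes to all vectors by an \<epsilon> / 3 argument.\<close>

lemma rep_continuous:
  assumes f: "f \<in> H"
  shows "((\<lambda>g. dst (\<pi> g f) (\<pi> g0 f)) \<longlongrightarrow> 0) (at g0)"
proof -
  have span: "s \<in> H \<and> ((\<lambda>g. dst (\<pi> g s) (\<pi> g0 s)) \<longlongrightarrow> 0) (at g0)" if "lin_span fun_lc (range coh) s" for s
    using that
  proof (induction rule: lin_span.induct)
    case (base s)
    then obtain a where s: "s = coh a" by auto
    show ?case unfolding s using rep_coh_continuous[of a g0] coh_in[of a] by blast
  next
    case (comb s t a b)
    then have V: "s \<in> H" "t \<in> H" by auto
    have le: "dst (\<pi> g (fun_lc a s b t)) (\<pi> g0 (fun_lc a s b t))
        \<le> cmod a * dst (\<pi> g s) (\<pi> g0 s) + cmod b * dst (\<pi> g t) (\<pi> g0 t)" for g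
    proof -
      have "dst (\<pi> g (fun_lc a s b t)) (\<pi> g0 (fun_lc a s b t))
          = nrm (fun_lc a (fun_lc 1 (\<pi> g s) (-1) (\<pi> g0 s)) b (fun_lc 1 (\<pi> g t) (-1) (\<pi> g0 t)))"
        unfolding dst_def rep_lc[OF V] by (rule arg_cong[of _ _ nrm]) (simp add: fun_lc_def algebra_simps)
      also have "\<dots> \<le> cmod a * dst (\<pi> g s) (\<pi> g0 s) + cmod b * dst (\<pi> g t) (\<pi> g0 t)"
        unfolding dst_def by (intro nrm_lc_le lc_in rep_in V)
      finally show ?thesis .
    qed
    have "((\<lambda>g. cmod a * dst (\<pi> g s) (\<pi> g0 s) + cmod b * dst (\<pi> g t) (\<pi> g0 t)) \<longlongrightarrow> cmod a * 0 + cmod b * 0) (at g0)"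
      using comb.IH by (intro tendsto_intros) blast+
    then have lim: "((\<lambda>g. cmod a * dst (\<pi> g s) (\<pi> g0 s) + cmod b * dst (\<pi> g t) (\<pi> g0 t)) \<longlongrightarrow> 0) (at g0)"
      unfolding mult_zero_right add_0 .
    have "((\<lambda>g. dst (\<pi> g (fun_lc a s b t)) (\<pi> g0 (fun_lc a s b t))) \<longlongrightarrow> 0) (at g0)"
    proof (rule Lim_null_comparison[OF always_eventually lim], rule allI)
      fix g
      show "norm (dst (\<pi> g (fun_lc a s b t)) (\<pi> g0 (fun_lc a s b t)))
        \<le> cmod a * dst (\<pi> g s) (\<pi> g0 s) + cmod b * dst (\<pi> g t) (\<pi> g0 t)"
        using le[of g] dst_ge0[OF rep_in[OF lc_in[OF V]] rep_in[OF lc_in[OF V]]] by (metis abs_of_nonneg real_norm_def)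
    qed
    then show ?case using lc_in[OF V] by blast
  qed
  have "\<exists>u. (\<forall>k. lin_span fun_lc (range coh) (u k)) \<and> lim_to u f"
  proof (rule span_dense)
    show "nrm v = 0" if v: "v \<in> H" and z: "\<And>s. s \<in> range coh \<Longrightarrow> ip v s = 0" for v
    proof -
      have "v x = 0" for x using z[of "coh x"] ip_coh[OF v, of x] by simp
      then have "v = (\<lambda>_. 0)" by (simp add: fun_eq_iff)
      then show ?thesis using nrm_scale[OF v, of 0] by (simp add: fun_lc_def)
    qed
  qed (use f coh_in in auto)
  then obtain u where u: "\<forall>k. lin_span fun_lc (range coh) (u k)" "lim_to u f" by (elim exE conjE)
  have uH: "u k \<in> H" for k using span u(1) by blast
  show ?thesis
  proof (rule tendstoI)
    fix e :: real assume e: "e > 0"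
    obtain k where k: "dst (u k) f < e / 3"
      using LIMSEQ_D[OF u(2)[unfolded lim_to_def], of "e/3"] e dst_ge0[OF uH f] by force
    have "((\<lambda>g. dst (\<pi> g (u k)) (\<pi> g0 (u k))) \<longlongrightarrow> 0) (at g0)" using span u(1) by blast
    then have "\<forall>\<^sub>F g in at g0. dist (dst (\<pi> g (u k)) (\<pi> g0 (u k))) 0 < e / 3"
      using e by (intro tendstoD) auto
    then show "\<forall>\<^sub>F g in at g0. dist (dst (\<pi> g f) (\<pi> g0 f)) 0 < e"
    proof eventually_elim
      case (elim g)
      have d: "dst (\<pi> h (u k)) (\<pi> h f) = dst (u k) f" for h
        unfolding dst_def rep_lc[OF uH f, symmetric] by (rule rep_nrm[OF lc_in[OF uH f]])
      have "dst (\<pi> g f) (\<pi> g0 f) \<le> dst (\<pi> g f) (\<pi> g (u k)) + (dst (\<pi> g (u k)) (\<pi> g0 (u k)) + dst (\<pi> g0 (u k)) (\<pi> g0 f))"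
        using dst_triangle[OF rep_in[OF f, of g] rep_in[OF uH[of k], of g] rep_in[OF f, of g0]]
          dst_triangle[OF rep_in[OF uH[of k], of g] rep_in[OF uH[of k], of g0] rep_in[OF f, of g0]] by linarith
      then show ?case
        using elim k d[of g] d[of g0] dst_sym[OF rep_in[OF f, of g] rep_in[OF uH[of k], of g]]
        by (simp add: dst_ge0 rep_in f uH)
    qed
  qed
qed

lemma unitary: "unitary_rep GG H ip \<pi>"
  unfolding unitary_rep_def
proof (intro conjI ballI)
  show "group_action GG H \<pi>"
    by (rule group_actionI[OF group_GG]) (simp_all add: rep_in rep_one rep_mult rep_ext extensional_def)
  show "linear_op H (\<pi> g)" for g using rep_bounded by (simp add: bounded_op_def)
  show "ip (\<pi> g f) (\<pi> g h) = ip f h" if "f \<in> H" "h \<in> H" for g f h by (rule rep_ip[OF that])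
  show "((\<lambda>h. hnorm ip (\<lambda>x. \<pi> h f x - \<pi> g f x)) \<longlongrightarrow> 0) (at g within carrier GG)" if "f \<in> H" for f g
    using rep_continuous[OF that] by (simp add: hnorm_diff carrier_GG)
qed

subsection \<open>The four properties\<close>

lemma matched_AE:
  assumes "matched A F" "matched A F'"
  shows "AE z in M. F z = F' z"
  using matched_unique[OF assms] assms by (simp add: l2_dst_eq_0_iff matched_def)

text \<open>Taking adjoints exchanges a and b in \<open>R (a, b)\<close>, and by
  \<open>cnj_G\<close> conjugation does the same in \<open>G (a, b)\<close>.\<close>

lemma matched_adjoint:
  assumes m: "matched A F"
  shows "matched (adj A) (\<lambda>z. cnj (F z))"
proof -
  have A: "A \<in> HS" and F: "F \<in> L2 M" using m by (auto simp: matched_def)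
  have b: "bounded_op H ip A" by (rule HS_bounded[OF A])
  have "l2_ip M (\<lambda>z. cnj (F z)) (G (x, y)) = adj A (coh y) x" for x y
  proof -
    have "l2_ip M (\<lambda>z. cnj (F z)) (G (x, y)) = (LINT z|M. cnj (F z * cnj (G (y, x) z)))"
      unfolding l2_ip_def by (simp add: cnj_G)
    also have "\<dots> = cnj (A (coh x) y)"
      using m by (simp add: matched_iff l2_ip_def del: complex_cnj_mult)
    also have "\<dots> = cnj (ip (A (coh x)) (coh y))" by (simp add: ip_coh HS_in[OF A coh_in])
    also have "\<dots> = ip (adj A (coh y)) (coh x)"
      by (simp add: ip_adj_left[OF b coh_in coh_in] ip_herm[OF HS_in[OF A coh_in] coh_in, symmetric])
    finally show ?thesis by (simp add: ip_coh op_in[OF adj_bounded[OF b] coh_in])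
  qed
  moreover have "(\<lambda>z. cnj (F z)) \<in> L2 M" using F by (auto simp: L2_def)
  ultimately show ?thesis using adj_HS(1)[OF A] by (simp add: matched_iff)
qed

text \<open>The symbol side of \<open>rep_coh\<close>: conjugating \<open>R (a, b)\<close> by
  \<open>\<pi> h\<close> gives \<open>R (act h a, act h b)\<close> with this same scalar.\<close>

lemma G_act: "G (a, b) z = coh_factor h a * cnj (coh_factor h b) * G (act h a, act h b) (act h z)"
proof -
  obtain t d c where h: "h = (t, d, c)" by (metis surj_pair)
  let ?x = "T t z" and ?y = "T t b" and ?w = "T t a"
  have kk: "\<kappa> t * cnj (\<kappa> t) = 1" using complex_norm_square[of "\<kappa> t"] \<kappa>_props(3) by simp
  have "coh_factor h a * cnj (coh_factor h b)
      = (\<kappa> t * cnj (\<kappa> t)) * (exp (\<i> * of_real (l * c) - of_real (l / 4) * hdot d d - of_real (l / 2) * hdot ?w d)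
        * exp (- \<i> * of_real (l * c) - of_real (l / 4) * hdot d d - of_real (l / 2) * hdot d ?y))"
    by (simp add: h coh_factor_def exp_cnj cnj_hdot mult_ac)
  also have "\<dots> = exp (of_real (- l / 2) * (hdot d d + hdot ?w d + hdot d ?y))"
    unfolding kk exp_add[symmetric] by (simp add: algebra_simps add_divide_distrib[symmetric])
  finally have c: "coh_factor h a * cnj (coh_factor h b)
      = exp (of_real (- l / 2) * (hdot d d + hdot ?w d + hdot d ?y))" .
  have eq: "hdot (?x + d) (?y + d) + hdot (?w + d) (?x + d) - hdot (?x + d) (?x + d) - hdot (?w + d) (?y + d) / 2
      = (hdot z b + hdot a z - hdot z z - hdot a b / 2) + (hdot d d + hdot ?w d + hdot d ?y) / 2"
    by (simp add: hdot_algebra hdot_T add_divide_distrib diff_divide_distrib)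
  have dist: "of_real l * (u + v / 2) = of_real l * u + of_real (l / 2) * v" for u v :: complex
    by (simp add: distrib_left)
  have "G (act h a, act h b) (act h z) = G (a, b) z * exp (of_real (l / 2) * (hdot d d + hdot ?w d + hdot d ?y))"
    unfolding h act_eq G_def prod.case eq dist exp_add mult.assoc ..
  then show ?thesis
    unfolding c by (simp add: exp_add[symmetric])
qed

text \<open>Invariance of the measure turns the pairing with \<open>G (a, b)\<close> into one with
  \<open>G (act ?h a, act ?h b)\<close>; the scalars coming from \<open>G_act\<close> are those that
  \<open>rep_coh\<close> produces on the operator side.\<close>

lemma matched_covariant:
  assumes m: "matched A F"
  shows "matched (compose H (\<pi> g) (compose H A (\<pi> (inv\<^bsub>GG\<^esub> g)))) (\<lambda>z. F (act (inv\<^bsub>GG\<^esub> g) z))"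
proof -
  let ?h = "inv\<^bsub>GG\<^esub> g" and ?A = "compose H (\<pi> g) (compose H A (\<pi> (inv\<^bsub>GG\<^esub> g)))"
  have A: "A \<in> HS" and F: "F \<in> L2 M" using m by (auto simp: matched_def)
  have A': "?A \<in> HS" by (intro compose_HS_left compose_HS_right rep_bounded A)
  obtain t d c where h: "?h = (t, d, c)" by (metis surj_pair)
  have F': "(\<lambda>z. F (act ?h z)) \<in> L2 M"
    unfolding h act_eq by (rule L2_affine[OF linear_T norm_T F])
  have "l2_ip M (\<lambda>z. F (act ?h z)) (G (a, b)) = ?A (coh b) a" for a b
  proof -
    let ?k = "cnj (coh_factor ?h a) * coh_factor ?h b"
    have mb: "(\<lambda>z. F z * cnj (G (act ?h a, act ?h b) z)) \<in> borel_measurable borel"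
      using L2_measurable[OF F] G_measurable by simp
    have "l2_ip M (\<lambda>z. F (act ?h z)) (G (a, b))
        = (LINT z|M. ?k * (F (act ?h z) * cnj (G (act ?h a, act ?h b) (act ?h z))))"
      unfolding l2_ip_def by (subst G_act[of a b _ ?h]) (simp add: mult_ac)
    also have "\<dots> = ?k * (LINT z|M. F (act ?h z) * cnj (G (act ?h a, act ?h b) (act ?h z)))"
      by (rule integral_mult_right_zero)
    also have "(LINT z|M. F (act ?h z) * cnj (G (act ?h a, act ?h b) (act ?h z)))
        = (LINT z|M. F z * cnj (G (act ?h a, act ?h b) z))"
    proof -
      have "act ?h z = T t z + d" for z by (simp add: h act_eq)
      then show ?thesis using mu_integral_affine(1)[OF linear_T norm_T mb, of l \<alpha> t d] by simp
    qed
    also have "\<dots> = A (coh (act ?h b)) (act ?h a)"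
      using m by (simp add: matched_iff l2_ip_def)
    also have "?k * \<dots> = ip (A (\<pi> ?h (coh b))) (\<pi> ?h (coh a))"
    proof -
      have "ip (A (\<pi> ?h (coh b))) (\<pi> ?h (coh a))
          = coh_factor ?h b * (cnj (coh_factor ?h a) * ip (A (coh (act ?h b))) (coh (act ?h a)))"
        by (simp add: rep_coh op_lc[OF HS_bounded[OF A]] coh_in ip_lc ip_lc_right lc_in HS_in[OF A])
      then show ?thesis by (simp add: ip_coh HS_in[OF A coh_in])
    qed
    also have "\<dots> = ip (\<pi> g (A (\<pi> ?h (coh b)))) (coh a)"
      by (rule rep_ip_inv[OF HS_in[OF A rep_in[OF coh_in]] coh_in, symmetric])
    also have "\<dots> = ?A (coh b) a"
      by (simp add: compose_eq coh_in rep_in ip_coh HS_in[OF A])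
    finally show ?thesis .
  qed
  then show ?thesis using A' F' by (simp add: matched_iff)
qed

section \<open>The symbol of the identity and the verification on the plane\<close>

lemma id_bounded: "bounded_op H ip (id_op H)"
  by (rule bounded_opI[where C = 1]) (simp_all add: id_op_def lc_in)

text \<open>The value is the trace of \<open>R (a, b)\<close>, as it must be if the constant 1 is to
  be the symbol of the identity.\<close>

lemma G_integral:
  "integrable M (G (a, b))" "(LINT z|M. G (a, b) z) = exp (of_real (l / 2) * hdot a b)"
proof -
  have l2: "2 * l > 0" using l by simp
  let ?g = "\<lambda>z. exp (of_real ((2 * l) / 2) * (hdot z b + hdot a z - hdot z z))"
  have m: "?g \<in> borel_measurable borel" by measurable
  have eq: "G (a, b) = (\<lambda>z. 2 ^ CARD('n) * (exp (of_real (- l / 2) * hdot a b) * ?g z))"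
    unfolding exp_add[symmetric] by (auto simp: G_def fun_eq_iff algebra_simps)
  have i: "integrable M ?g"
    using gauss_kernel(1)[OF l2, of b a] mu_rescale(1)[OF l _ m, of 2] by simp
  then show "integrable M (G (a, b))" unfolding eq by (intro integrable_mult_right)
  have "2 ^ CARD('n) *\<^sub>R (LINT z|M. ?g z) = exp (of_real ((2 * l) / 2) * hdot a b)"
    using gauss_kernel(2)[OF l2, of b a] mu_rescale(2)[OF l _ m, of 2] by simp
  then have v: "2 ^ CARD('n) * (LINT z|M. ?g z) = exp (of_real ((2 * l) / 2) * hdot a b)"
    by (simp add: scaleR_conv_of_real)
  have "(LINT z|M. G (a, b) z) = exp (of_real (- l / 2) * hdot a b) * (2 ^ CARD('n) * (LINT z|M. ?g z))"
    unfolding eq by (simp only: integral_mult_right_zero mult_ac)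
  also have "\<dots> = exp (of_real (l / 2) * hdot a b)"
    unfolding v exp_add[symmetric] by (simp add: algebra_simps)
  finally show "(LINT z|M. G (a, b) z) = exp (of_real (l / 2) * hdot a b)" .
qed

text \<open>If the identity were Hilbert-Schmidt, its symbol would be the non-integrable constant \<open>1\<close>.\<close>

lemma id_not_HS: "id_op H \<notin> HS"
proof
  assume I: "id_op H \<in> HS"
  obtain F where F: "matched (id_op H) F" using matched_exists_ip[OF I] by auto
  have FL: "F \<in> L2 M" using F by (simp add: matched_def)
  have [measurable]: "F \<in> borel_measurable borel" using L2_measurable[OF FL] by simp
  have i: "integrable M (\<lambda>z. F z * cnj (G (a, b) z))" for a b by (rule L2_mult_integrable[OF FL G_L2])
  have i1: "integrable M (\<lambda>z. cnj (G (a, b) z))" for a b unfolding cnj_G using G_integral(1)[of b a] by simp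
  have e: "(F z - 1) * cnj (G (a, b) z) = F z * cnj (G (a, b) z) - cnj (G (a, b) z)" for a b z
    by (simp add: algebra_simps)
  \<comment> \<open>F and 1 have the same pairings with every \<open>G (a, b)\<close>, although 1 is
    not square integrable.\<close>
  have "AE z in M. F z - 1 = 0"
  proof (rule symbol_total)
    show "integrable M (\<lambda>z. (F z - 1) * cnj (G (0, 0) z))"
      unfolding e by (intro Bochner_Integration.integrable_diff i i1)
    fix a b
    have "(LINT z|M. (F z - 1) * cnj (G (a, b) z)) = (LINT z|M. F z * cnj (G (a, b) z)) - (LINT z|M. cnj (G (a, b) z))"
      unfolding e by (rule Bochner_Integration.integral_diff[OF i i1])
    also have "(LINT z|M. cnj (G (a, b) z)) = coh b a"
      unfolding cnj_G using G_integral(2)[of b a] by (simp add: coherent_eq)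
    also have "(LINT z|M. F z * cnj (G (a, b) z)) = coh b a"
      using F by (simp add: matched_iff l2_ip_def id_op_def coh_in)
    finally show "(LINT z|M. (F z - 1) * cnj (G (a, b) z)) = 0" by simp
  qed simp
  then have "AE z in M. (cmod (F z))\<^sup>2 = (1 :: real)" by eventually_elim simp
  then have "integrable M (\<lambda>z. 1 :: real)"
    using L2_integrable[OF FL] by (subst integrable_cong_AE[of _ _ "\<lambda>z. (cmod (F z))\<^sup>2"]) (auto elim: eventually_mono)
  then have "integrable (lborel :: (complex ^ 'n) measure) (\<lambda>z. 1 :: real)"
    by (subst (asm) mu_integrable_iff[OF l]) auto
  then have "emeasure (lborel :: (complex ^ 'n) measure) UNIV < \<infinity>"
    using integrable_iff_bounded[of lborel "\<lambda>z :: complex ^ 'n. 1 :: real"] by simp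
  then show False by simp
qed

text \<open>By \<open>id_not_HS\<close> the symbol is given by the integral formula. The kernel
  \<open>coh (z - w) (z + w)\<close> cancels every term in z and leaves exp(-l |w|^2), whose
  integral 2^-n the prefactor compensates.\<close>

lemma weyl_id: "weyl_symbol l (id_op H) z = 1"
proof -
  have l2: "2 * l > 0" using l by simp
  let ?g = "\<lambda>w :: complex ^ 'n. exp (of_real ((2 * l) / 2) * (hdot w 0 + hdot 0 w - hdot w w))"
  have m: "?g \<in> borel_measurable borel" by measurable
  have "integrand (id_op H) z w = ?g w" for w
  proof -
    have "id_op H (coh (z - w)) (z + w) = exp (of_real (l / 2) * hdot (z - w) (z + w))"
      unfolding id_op_def restrict_apply'[OF coh_in] by (simp only: coherent_eq)
    then show ?thesis
      unfolding integrand_def by (simp only: exp_add[symmetric]) (simp add: hdot_algebra algebra_simps)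
  qed
  then have "weyl_integral l (id_op H) z = 2 ^ CARD('n) *\<^sub>R (LINT w|M. ?g w)"
    by (simp only: weyl_integral_eq[OF id_bounded]) (simp add: scaleR_conv_of_real)
  also have "\<dots> = (LINT w|mu (2 * l). ?g w)"
    using mu_rescale(2)[OF l _ m, of 2] by simp
  also have "\<dots> = 1" using gauss_kernel(2)[OF l2, of 0 0] by (simp add: hdot_algebra)
  finally show ?thesis by (simp add: weyl_symbol_def id_not_HS)
qed

lemma stratonovich_weyl_fock: "stratonovich_weyl GG H ip \<pi> M act (weyl_symbol l)"
proof -
  let ?W = "weyl_symbol l"
  note m = weyl_symbol_matched
  have WL: "?W A \<in> L2 M" if "A \<in> HS" for A using m[OF that] by (simp add: matched_def)
  show ?thesis
    unfolding stratonovich_weyl_def Let_def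
  proof (intro conjI ballI allI impI)
    show "topological_grp GG" by (rule topological_GG)
    show "hilbert_space H ip" by (rule hilbert)
    show "unitary_rep GG H ip \<pi>" by (rule unitary)
    show "homogeneous_space GG M act" by (rule homogeneous)
    show "?W A \<in> L2 M" if "A \<in> HS" for A by (rule WL[OF that])
    show "AE x in M. ?W (lincomb_op H a A b B) x = a * ?W A x + b * ?W B x" if "A \<in> HS" "B \<in> HS" for A B a b
      using matched_AE[OF m[OF HS_lincomb[OF that]] matched_lc[OF m[OF that(1)] m[OF that(2)]], of a b]
      by (simp add: fun_lc_def)
    show "A = B" if AB: "A \<in> HS" "B \<in> HS" and ae: "AE x in M. ?W A x = ?W B x" for A B
    proof -
      have "matched A (?W B)"
        by (rule matched_cong_AE[OF m[OF AB(1)] _ ae]) (use L2_measurable[OF WL[OF AB(2)]] in simp)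
      then have "A (coh b) a = B (coh b) a" for a b using m[OF AB(2)] by (simp add: matched_iff)
      then show ?thesis by (intro op_eq_coherent HS_bounded AB) (simp add: fun_eq_iff)
    qed
    show "\<exists>A\<in>HS. AE x in M. ?W A x = F x" if F: "F \<in> L2 M" for F
    proof -
      obtain A where A: "matched A F" using matched_exists_rev[OF F] by auto
      then have "A \<in> HS" by (simp add: matched_def)
      with matched_AE[OF m A] show ?thesis by blast
    qed
    show "AE x in M. ?W (id_op H) x = 1" by (simp add: weyl_id)
    show "AE x in M. ?W (adjoint_op H ip A) x = cnj (?W A x)" if A: "A \<in> HS" for A
      by (rule matched_AE[OF m[OF adj_HS(1)[OF A]] matched_adjoint[OF m[OF A]]])
    show "AE x in M. ?W (compose H (\<pi> g) (compose H A (\<pi> (inv\<^bsub>GG\<^esub> g)))) x = ?W A (act (inv\<^bsub>GG\<^esub> g) x)"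
      if A: "A \<in> HS" for g A
      using matched_AE[OF m matched_covariant[OF m[OF A], of g]] matched_covariant[OF m[OF A], of g]
      by (simp add: matched_def)
    show "integrable M (\<lambda>x. ?W A x * ?W B x)" if "A \<in> HS" "B \<in> HS" for A B
      by (intro L2_mult_integrable WL that)
    \<comment> \<open>The product has no conjugation, so the symbol of B is paired with that of
      \<open>adj A\<close>, whose conjugate is the symbol of A.\<close>
    show "(LINT x|M. ?W A x * ?W B x) = op_trace H ip (compose H A B)" if AB: "A \<in> HS" "B \<in> HS" for A B
      using matched_ip[OF m[OF AB(2)] matched_adjoint[OF m[OF AB(1)]]]
      by (simp add: op_trace_compose[OF AB] l2_ip_def mult.commute)
  qed
qed

end

section \<open>The coadjoint orbit\<close>

text \<open>Every clause is pulled back along the inverse of \<psi>. Continuity of the inverse on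
  the image makes it measurable, so almost-everywhere statements pass in both directions, and it
  also makes the transported action jointly continuous.\<close>

lemma stratonovich_weyl_transport:
  fixes M :: "('x::topological_space) measure" and \<psi> :: "'x \<Rightarrow> 'p::topological_space"
    and G :: "('g::topological_space) monoid"
  assumes sw: "stratonovich_weyl G H ip \<pi> M act W" and sp: "space M = UNIV"
    and inj: "inj \<psi>" and cont: "continuous_on UNIV \<psi>" and cont_inv: "continuous_on (range \<psi>) (inv_into UNIV \<psi>)"
    and ext: "\<And>g. g \<in> carrier G \<Longrightarrow> act' g \<in> extensional (range \<psi>)"
    and equiv: "\<And>g x. g \<in> carrier G \<Longrightarrow> act' g (\<psi> x) = \<psi> (act g x)"
  shows "stratonovich_weyl G H ip \<pi> (distr M (restrict_space borel (range \<psi>)) \<psi>) act' (\<lambda>A. W A \<circ> inv_into UNIV \<psi>)"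
proof -
  let ?R = "restrict_space borel (range \<psi>)" and ?N = "distr M (restrict_space borel (range \<psi>)) \<psi>"
  have hs: "homogeneous_space G M act" and tg: "topological_grp G"
    and hb: "hilbert_space H ip" and ur: "unitary_rep G H ip \<pi>"
    using sw by (simp_all add: stratonovich_weyl_def)
  have setsM: "sets M = sets borel" and ta: "transitive_action G UNIV act"
    and ca: "continuous_on (carrier G \<times> UNIV) (\<lambda>(g, x). act g x)"
    and ma: "\<And>g. g \<in> carrier G \<Longrightarrow> act g \<in> measurable M M"
    and da: "\<And>g. g \<in> carrier G \<Longrightarrow> distr M M (act g) = M"
    using hs by (simp_all add: homogeneous_space_def sp)
  have invp: "inv_into UNIV \<psi> (\<psi> x) = x" for x using inj by simp
  have pinv: "\<psi> (inv_into UNIV \<psi> y) = y" if "y \<in> range \<psi>" for y using that by (simp add: f_inv_into_f)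
  have spR: "space ?R = range \<psi>" by (simp add: space_restrict_space)
  have mp: "\<psi> \<in> measurable M ?R"
  proof (rule measurable_restrict_space2)
    have "\<psi> \<in> borel_measurable borel" by (rule borel_measurable_continuous_onI[OF cont])
    then show "\<psi> \<in> borel_measurable M" using measurable_cong_sets[OF setsM refl] by blast
  qed simp
  have mi: "inv_into UNIV \<psi> \<in> measurable ?R M"
  proof -
    have "inv_into UNIV \<psi> \<in> borel_measurable ?R" by (rule borel_measurable_continuous_on_restrict[OF cont_inv])
    then show ?thesis using measurable_cong_sets[OF refl setsM, of ?R] by blast
  qed
  have miN: "inv_into UNIV \<psi> \<in> measurable ?N M" using mi by simp
  have distr_inv: "distr ?N M (inv_into UNIV \<psi>) = M"
    using distr_distr[OF mi mp] invp by (simp add: o_def)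
  have AEN: "AE y in ?N. P (inv_into UNIV \<psi> y)" if "AE x in M. P x" for P
  proof -
    have "AE x in distr ?N M (inv_into UNIV \<psi>). P x" unfolding distr_inv by (rule that)
    then show ?thesis by (rule AE_distrD[OF miN])
  qed
  have AEM: "AE x in M. P (\<psi> x)" if "AE y in ?N. P y" for P
    using AE_distrD[OF mp that] .
  have int: "integrable ?N (\<lambda>y. f (inv_into UNIV \<psi> y)) \<longleftrightarrow> integrable M f"
    "(LINT y|?N. f (inv_into UNIV \<psi> y)) = (LINT x|M. f x)"
    if f: "f \<in> borel_measurable M" for f :: "'x \<Rightarrow> 'b::{banach,second_countable_topology}"
    using integrable_distr_eq[OF mp, of "\<lambda>y. f (inv_into UNIV \<psi> y)"] integral_distr[OF mp, of "\<lambda>y. f (inv_into UNIV \<psi> y)"]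
      measurable_compose[OF mi f] invp by simp_all
  have L2N: "(F \<circ> inv_into UNIV \<psi>) \<in> L2 ?N" if F: "F \<in> L2 M" for F
  proof -
    have m: "F \<in> borel_measurable M" "(\<lambda>x. (cmod (F x))\<^sup>2) \<in> borel_measurable M"
      and i: "integrable M (\<lambda>x. (cmod (F x))\<^sup>2)" using F by (auto simp: L2_def)
    show ?thesis
      using measurable_compose[OF mi m(1)] int(1)[OF m(2)] i by (simp add: L2_def o_def)
  qed
  have homog: "homogeneous_space G ?N act'"
    unfolding homogeneous_space_def space_distr sets_distr spR
  proof (intro conjI ballI)
    interpret transitive_action G UNIV act by (rule ta)
    have grp: "group G" using tg by (simp add: topological_grp_def)
    have act1: "act \<one>\<^bsub>G\<^esub> x = x" for x using id_eq_one by (metis UNIV_I restrict_apply')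
    have actm: "act (g \<otimes>\<^bsub>G\<^esub> h) x = act g (act h x)" if "g \<in> carrier G" "h \<in> carrier G" for g h x
      using composition_rule[of x g h] that by simp
    show "transitive_action G (range \<psi>) act'"
    proof (intro transitive_action.intro transitive_action_axioms.intro)
      show "group_action G (range \<psi>) act'"
        by (rule group_actionI[OF grp])
          (auto simp: ext equiv act1 actm group.is_monoid[OF grp] monoid.one_closed monoid.m_closed)
      fix x y assume "x \<in> range \<psi>" "y \<in> range \<psi>"
      then obtain u v where uv: "x = \<psi> u" "y = \<psi> v" by auto
      obtain g where "g \<in> carrier G" "act g u = v" using unique_orbit[of u v] by auto
      then show "\<exists>g\<in>carrier G. act' g x = y" using equiv uv by blast
    qed
    have "continuous_on (carrier G \<times> range \<psi>) (\<lambda>p. \<psi> (act (fst p) (inv_into UNIV \<psi> (snd p))))"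
    proof (rule continuous_on_compose2[OF cont])
      have "continuous_on (carrier G \<times> range \<psi>) (\<lambda>p. (\<lambda>(g, x). act g x) (fst p, inv_into UNIV \<psi> (snd p)))"
      proof (rule continuous_on_compose2[OF ca])
        show "continuous_on (carrier G \<times> range \<psi>) (\<lambda>p. (fst p, inv_into UNIV \<psi> (snd p)))"
          by (intro continuous_on_Pair continuous_on_fst continuous_on_compose2[OF cont_inv] continuous_on_snd continuous_on_id) auto
      qed auto
      then show "continuous_on (carrier G \<times> range \<psi>) (\<lambda>p. act (fst p) (inv_into UNIV \<psi> (snd p)))" by simp
    qed simp
    then show "continuous_on (carrier G \<times> range \<psi>) (\<lambda>(g, y). act' g y)"
      by (rule continuous_on_eq) (auto simp: equiv invp)
    fix g assume g: "g \<in> carrier G"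
    have eq: "act' g y = \<psi> (act g (inv_into UNIV \<psi> y))" if "y \<in> range \<psi>" for y
      using equiv[OF g, of "inv_into UNIV \<psi> y"] pinv[OF that] by simp
    have "(\<lambda>y. \<psi> (act g (inv_into UNIV \<psi> y))) \<in> measurable ?R ?R"
      by (intro measurable_compose[OF mi] measurable_compose[OF ma[OF g] mp])
    then have mR: "act' g \<in> measurable ?R ?R"
      by (subst measurable_cong[of _ _ "\<lambda>y. \<psi> (act g (inv_into UNIV \<psi> y))"]) (simp_all add: spR eq)
    then show "act' g \<in> measurable ?N ?N" by simp
    have "distr ?N ?N (act' g) = distr M ?R (act' g \<circ> \<psi>)"
      using distr_distr[OF mR mp] by (simp cong: distr_cong)
    also have "\<dots> = distr (distr M M (act g)) ?R \<psi>"
      using distr_distr[OF mp ma[OF g]] by (simp add: o_def equiv[OF g])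
    finally show "distr ?N ?N (act' g) = ?N" by (simp add: da[OF g])
  qed simp_all
  note S = sw[unfolded stratonovich_weyl_def Let_def]
  show ?thesis
    unfolding stratonovich_weyl_def Let_def
  proof (intro conjI ballI allI impI)
    fix A assume A: "A \<in> hilbert_schmidt H ip"
    have WA: "W A \<in> L2 M" using S A by blast
    show "W A \<circ> inv_into UNIV \<psi> \<in> L2 ?N" by (rule L2N[OF WA])
    show "AE x in ?N. (W (adjoint_op H ip A) \<circ> inv_into UNIV \<psi>) x = cnj ((W A \<circ> inv_into UNIV \<psi>) x)"
      using AEN[of "\<lambda>x. W (adjoint_op H ip A) x = cnj (W A x)"] S A by simp
    fix B assume B: "B \<in> hilbert_schmidt H ip"
    have WB: "W B \<in> L2 M" using S B by blast
    show "AE x in ?N. (W (lincomb_op H a A b B) \<circ> inv_into UNIV \<psi>) x = a * (W A \<circ> inv_into UNIV \<psi>) x + b * (W B \<circ> inv_into UNIV \<psi>) x" for a b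
      using AEN[of "\<lambda>x. W (lincomb_op H a A b B) x = a * W A x + b * W B x"] S A B by simp
    show "A = B" if "AE x in ?N. (W A \<circ> inv_into UNIV \<psi>) x = (W B \<circ> inv_into UNIV \<psi>) x"
    proof -
      have "AE x in M. W A x = W B x" using AEM[OF that] by (simp add: invp)
      with S A B show ?thesis by blast
    qed
    have m: "(\<lambda>x. W A x * W B x) \<in> borel_measurable M"
      using WA WB by (auto simp: L2_def)
    show "integrable ?N (\<lambda>x. (W A \<circ> inv_into UNIV \<psi>) x * (W B \<circ> inv_into UNIV \<psi>) x)"
      using int(1)[OF m] S A B by simp
    show "(LINT x|?N. (W A \<circ> inv_into UNIV \<psi>) x * (W B \<circ> inv_into UNIV \<psi>) x) = op_trace H ip (compose H A B)"
      using int(2)[OF m] S A B by simp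
  next
    fix F assume F: "F \<in> L2 ?N"
    then have Fm: "F \<in> borel_measurable ?R" and Fi: "integrable ?N (\<lambda>x. (cmod (F x))\<^sup>2)"
      by (auto simp: L2_def)
    have "(\<lambda>x. F (\<psi> x)) \<in> borel_measurable M" by (rule measurable_compose[OF mp Fm])
    moreover have "integrable M (\<lambda>x. (cmod (F (\<psi> x)))\<^sup>2)"
      using integrable_distr_eq[OF mp, of "\<lambda>x. (cmod (F x))\<^sup>2"] Fm Fi by simp
    ultimately have "(\<lambda>x. F (\<psi> x)) \<in> L2 M" by (simp add: L2_def)
    moreover have "\<forall>F\<in>L2 M. \<exists>A\<in>hilbert_schmidt H ip. AE x in M. W A x = F x" using S by blast
    ultimately obtain A where A: "A \<in> hilbert_schmidt H ip" "AE x in M. W A x = F (\<psi> x)" by auto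
    have "AE y in ?N. W A (inv_into UNIV \<psi> y) = F (\<psi> (inv_into UNIV \<psi> y))" using AEN[OF A(2)] .
    then have "AE y in ?N. (W A \<circ> inv_into UNIV \<psi>) y = F y"
      using AE_space[of ?N] by eventually_elim (simp add: spR pinv)
    with A(1) show "\<exists>A\<in>hilbert_schmidt H ip. AE x in ?N. (W A \<circ> inv_into UNIV \<psi>) x = F x" by blast
  next
    show "AE x in ?N. (W (id_op H) \<circ> inv_into UNIV \<psi>) x = 1"
      using AEN[of "\<lambda>x. W (id_op H) x = 1"] S by simp
  next
    fix g A assume g: "g \<in> carrier G" and A: "A \<in> hilbert_schmidt H ip"
    let ?h = "inv\<^bsub>G\<^esub> g"
    have h: "?h \<in> carrier G" using g tg by (simp add: topological_grp_def)
    have "AE x in M. W (compose H (\<pi> g) (compose H A (\<pi> ?h))) x = W A (act ?h x)"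
      using S g A by blast
    then have "AE y in ?N. W (compose H (\<pi> g) (compose H A (\<pi> ?h))) (inv_into UNIV \<psi> y) = W A (act ?h (inv_into UNIV \<psi> y))"
      by (rule AEN)
    then show "AE y in ?N. (W (compose H (\<pi> g) (compose H A (\<pi> ?h))) \<circ> inv_into UNIV \<psi>) y = (W A \<circ> inv_into UNIV \<psi>) (act' ?h y)"
      using AE_space[of ?N]
    proof eventually_elim
      case (elim y)
      then have "y \<in> range \<psi>" by (simp add: spR)
      then have "inv_into UNIV \<psi> (act' ?h y) = act ?h (inv_into UNIV \<psi> y)"
        using equiv[OF h, of "inv_into UNIV \<psi> y"] by (simp add: pinv invp)
      with elim show ?case by simp
    qed
  qed (fact tg hb ur homog)+
qed

lemma bounded_bilinear_hdot: "bounded_bilinear hdot"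
proof
  show "\<exists>K. \<forall>a b :: complex ^ 'n. norm (hdot a b) \<le> norm a * norm b * K"
    by (intro exI[of _ 1] allI) (simp add: hdot_cauchy_schwarz)
qed (simp_all add: hdot_algebra scaleR_conv_of_real[where 'a = complex])

context diamond
begin

section \<open>The coadjoint action along psi\<close>

abbreviation \<Psi> where "\<Psi> \<equiv> psi \<alpha> \<kappa> l"

text \<open>The infinitesimal action of the torus.\<close>

definition D :: "real ^ 'm \<Rightarrow> complex ^ 'n \<Rightarrow> complex ^ 'n" where
  "D S d = (\<chi> k. \<i> * of_real (blinfun_apply (\<alpha> k) S) * d $ k)"

lemma T_has_derivative: "((\<lambda>s. T s d) has_derivative (\<lambda>S. D S d)) (at 0)"
proof -
  have bl: "bounded_linear (\<lambda>h. h *s (axis k 1 :: complex ^ 'n))" for k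
    by (rule bounded_linear_intro[where K = "norm (axis k 1 :: complex ^ 'n)"])
      (simp_all add: norm_smult vector_sadd_rdistrib vec_eq_iff)
  have e: "((\<lambda>s. exp (\<i> * of_real (blinfun_apply (\<alpha> k) s)) * d $ k) has_derivative
      (\<lambda>S. \<i> * of_real (blinfun_apply (\<alpha> k) S) * d $ k)) (at 0)" for k
  proof -
    have "((\<lambda>s. \<i> * complex_of_real (blinfun_apply (\<alpha> k) s)) has_derivative
        (\<lambda>S. \<i> * of_real (blinfun_apply (\<alpha> k) S))) (at 0)"
      by (intro has_derivative_mult_right has_derivative_of_real bounded_linear_imp_has_derivative blinfun.bounded_linear_right)
    from has_derivative_mult_left[OF has_derivative_compose[OF this DERIV_exp[unfolded has_field_derivative_def]], of "d $ k"]
    show ?thesis by (simp add: blinfun.zero_right)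
  qed
  \<comment> \<open>Differentiation is componentwise, through the expansion in the standard
    basis.\<close>
  have "((\<lambda>s. \<Sum>k\<in>UNIV. (exp (\<i> * of_real (blinfun_apply (\<alpha> k) s)) * d $ k) *s (axis k 1 :: complex ^ 'n)) has_derivative
      (\<lambda>S. \<Sum>k\<in>UNIV. (\<i> * of_real (blinfun_apply (\<alpha> k) S) * d $ k) *s axis k 1)) (at 0)"
    by (intro has_derivative_sum bounded_linear.has_derivative[OF bl] e)
  moreover have "(\<Sum>k\<in>UNIV. (exp (\<i> * of_real (blinfun_apply (\<alpha> k) s)) * d $ k) *s (axis k 1 :: complex ^ 'n)) = T s d" for s
    using basis_expansion[of "T s d"] by (simp add: T_nth)
  moreover have "(\<Sum>k\<in>UNIV. (\<i> * of_real (blinfun_apply (\<alpha> k) S) * d $ k) *s (axis k 1 :: complex ^ 'n)) = D S d" for S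
    using basis_expansion[of "D S d"] by (simp add: D_def)
  ultimately show ?thesis by simp
qed

lemma D_T: "D S (T t d) = T t (D S d)" and D_minus: "D S (- d) = - D S d"
  by (simp_all add: D_def vec_eq_iff T_nth)

lemma Im_hdot_D: "Im (hdot w (D S d)) = (\<Sum>k\<in>UNIV. blinfun_apply (\<alpha> k) S * Re (cnj (w $ k) * d $ k))"
  unfolding hdot_eq Im_sum by (intro sum.cong refl) (simp add: D_def algebra_simps)

lemma Ad_derivative:
  "((\<lambda>h. (t, d, c) \<otimes>\<^bsub>GG\<^esub> h \<otimes>\<^bsub>GG\<^esub> inv\<^bsub>GG\<^esub> (t, d, c)) has_derivative
    (\<lambda>X. (fst X, T t (fst (snd X)) - D (fst X) d,
      snd (snd X) + Im (hdot d (T t (fst (snd X)))) - Im (hdot d (D (fst X) d)) / 2))) (at \<one>\<^bsub>GG\<^esub>)"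
proof -
  let ?u = "\<lambda>p :: ('m, 'n) diamond. fst (snd p)"
  \<comment> \<open>The central parameter c cancels against that of the inverse, and T (t + s)
    composed with T (-t) leaves T s.\<close>
  have eq: "(\<lambda>h. (t, d, c) \<otimes>\<^bsub>GG\<^esub> h \<otimes>\<^bsub>GG\<^esub> inv\<^bsub>GG\<^esub> (t, d, c))
    = (\<lambda>p. (fst p, d + T t (?u p) - T (fst p) d,
       snd (snd p) + Im (hdot d (T t (?u p))) / 2 - Im (hdot (d + T t (?u p)) (T (fst p) d)) / 2))"
  proof
    fix p :: "('m, 'n) diamond"
    obtain s u x where p: "p = (s, u, x)" by (metis surj_pair)
    have "T (t + s) (T (- t) d) = T s d" by (simp add: T_plus[symmetric])
    then show "(t, d, c) \<otimes>\<^bsub>GG\<^esub> p \<otimes>\<^bsub>GG\<^esub> inv\<^bsub>GG\<^esub> (t, d, c) = (fst p, d + T t (?u p) - T (fst p) d,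
       snd (snd p) + Im (hdot d (T t (?u p))) / 2 - Im (hdot (d + T t (?u p)) (T (fst p) d)) / 2)"
      by (simp add: p inv_GG mult_GG T_algebra hdot_algebra add_divide_distrib)
  qed
  let ?z = "\<one>\<^bsub>GG\<^esub> :: ('m, 'n) diamond"
  have z: "fst ?z = 0" "?u ?z = 0" by (simp_all add: one_GG)
  have du: "((\<lambda>p. T t (?u p)) has_derivative (\<lambda>X. T t (?u X))) (at ?z)"
    by (intro bounded_linear.has_derivative[OF bounded_linear_T] has_derivative_fst has_derivative_snd has_derivative_ident)
  have dT: "((\<lambda>p :: ('m, 'n) diamond. T (fst p) d) has_derivative (\<lambda>X. D (fst X) d)) (at ?z)"
    by (rule has_derivative_compose[OF has_derivative_fst[OF has_derivative_ident]]) (simp only: z T_has_derivative)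
  have dd: "((\<lambda>p. d + T t (?u p)) has_derivative (\<lambda>X. T t (?u X))) (at ?z)"
    using has_derivative_add[OF has_derivative_const[of d] du] by simp
  have h1: "((\<lambda>p. Im (hdot d (T t (?u p)))) has_derivative (\<lambda>X. Im (hdot d (T t (?u X))))) (at ?z)"
    by (intro bounded_linear.has_derivative[OF bounded_linear_Im] bounded_linear.has_derivative[OF bounded_linear_hdot] du)
  have h2: "((\<lambda>p. Im (hdot (d + T t (?u p)) (T (fst p) d))) has_derivative
     (\<lambda>X. Im (hdot (d + T t (?u ?z)) (D (fst X) d) + hdot (T t (?u X)) (T (fst ?z) d)))) (at ?z)"
    by (intro bounded_linear.has_derivative[OF bounded_linear_Im] bounded_bilinear.FDERIV[OF bounded_bilinear_hdot] dd dT)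
  have "((\<lambda>p. (fst p, d + T t (?u p) - T (fst p) d,
       snd (snd p) + Im (hdot d (T t (?u p))) / 2 - Im (hdot (d + T t (?u p)) (T (fst p) d)) / 2)) has_derivative
     (\<lambda>X. (fst X, T t (?u X) - D (fst X) d, snd (snd X) + Im (hdot d (T t (?u X))) / 2
       - Im (hdot (d + T t (?u ?z)) (D (fst X) d) + hdot (T t (?u X)) (T (fst ?z) d)) / 2))) (at ?z)"
    by (intro has_derivative_Pair has_derivative_fst has_derivative_snd has_derivative_ident has_derivative_add
        has_derivative_diff bounded_linear.has_derivative[OF bounded_linear_divide] dd dT h1 h2)
  moreover have "Im (hdot (T t u) d) = - Im (hdot d (T t u))" for u
    using arg_cong[OF cnj_hdot[of d "T t u"], of Im] by simp
  moreover have "x + a / 2 - (b - a) / 2 = x + a - b / 2" for x a b :: real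
    by (simp add: field_simps)
  ultimately show ?thesis
    unfolding eq z T_zero T_algebra by simp
qed

lemma Ad_eq: "Ad \<alpha> (t, d, c) = (\<lambda>X. (fst X, T t (fst (snd X)) - D (fst X) d,
      snd (snd X) + Im (hdot d (T t (fst (snd X)))) - Im (hdot d (D (fst X) d)) / 2))"
  unfolding Ad_def Let_def by (rule frechet_derivative_at[OF Ad_derivative, symmetric])

lemma bounded_linear_Ad: "bounded_linear (Ad \<alpha> g)"
  using has_derivative_bounded_linear[OF Ad_derivative] by (cases g) (simp add: Ad_eq)

lemma dual_triple_apply:
  fixes s :: "(real ^ 'm) \<Rightarrow>\<^sub>L real" and v u :: "complex ^ 'n"
  shows "blinfun_apply (dual_triple s v e) (t, u, c) = blinfun_apply s t + Im (hdot v u) + c * e"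
proof -
  have "bounded_linear (\<lambda>X :: ('m, 'n) diamond. blinfun_apply s (fst X) + Im (hdot v (fst (snd X))) + snd (snd X) * e)"
    by (intro bounded_linear_add bounded_linear_compose[OF blinfun.bounded_linear_right bounded_linear_fst]
        bounded_linear_compose[OF bounded_linear_Im] bounded_linear_compose[OF bounded_linear_hdot]
        bounded_linear_compose[OF bounded_linear_fst] bounded_linear_compose[OF bounded_linear_mult_left]
        bounded_linear_compose[OF bounded_linear_snd] bounded_linear_snd)
  then have "bounded_linear (\<lambda>(t, u, c). blinfun_apply s t + rsymp v u + c * e)"
    by (simp add: case_prod_beta' rsymp_eq)
  then show ?thesis by (simp add: dual_triple_def bounded_linear_Blinfun_apply rsymp_eq)
qed

lemma \<Psi>_apply: "blinfun_apply (\<Psi> z) (t, u, c) = blinfun_apply (char_form \<kappa>) t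
    + (1 / 2) * (\<Sum>k\<in>UNIV. (1 - l * (cmod (z $ k))\<^sup>2) * blinfun_apply (\<alpha> k) t) - l * Im (hdot z u) + c * l"
  by (simp add: psi_def dual_triple_apply blinfun.add_left blinfun.scaleR_left blinfun.sum_left hdot_algebra)

text \<open>The terms in \<open>\<alpha> k\<close> that Ad produces are linear and quadratic in the
  translation d; they complete |z_k|^2 to the squared modulus of the k-th coordinate of T t z + d.
  This accounts for the quadratic first component of \<open>psi\<close>.\<close>

lemma coAd_\<Psi>: "coAd \<alpha> g (\<Psi> z) = \<Psi> (act g z)"
proof -
  obtain t d c where g: "g = (t, d, c)" by (metis surj_pair)
  have bl: "bounded_linear (\<lambda>X. blinfun_apply (\<Psi> z) (Ad \<alpha> (inv\<^bsub>GG\<^esub> g) X))"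
    by (rule bounded_linear_compose[OF blinfun.bounded_linear_right bounded_linear_Ad])
  show ?thesis
  proof (rule blinfun_eqI)
    fix X :: "('m, 'n) diamond"
    obtain S U C where X: "X = (S, U, C)" by (metis surj_pair)
    let ?w = "T t z"
    have tm: "hdot z (T (- t) v) = hdot ?w v" for v by (rule hdot_T_minus)
    have "Ad \<alpha> (inv\<^bsub>GG\<^esub> g) X = (S, T (- t) U + T (- t) (D S d), C - Im (hdot d U) - Im (hdot d (D S d)) / 2)"
      by (simp add: g X inv_GG Ad_eq D_minus D_T hdot_algebra hdot_T)
    then have "blinfun_apply (coAd \<alpha> g (\<Psi> z)) X = blinfun_apply (char_form \<kappa>) S
      + (1 / 2) * (\<Sum>k\<in>UNIV. (1 - l * (cmod (z $ k))\<^sup>2) * blinfun_apply (\<alpha> k) S)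
      - l * (Im (hdot ?w U) + Im (hdot ?w (D S d))) + (C - Im (hdot d U) - Im (hdot d (D S d)) / 2) * l"
      by (simp add: coAd_def bounded_linear_Blinfun_apply[OF bl] \<Psi>_apply hdot_algebra tm)
    also have "\<dots> = blinfun_apply (char_form \<kappa>) S
      + ((1 / 2) * (\<Sum>k\<in>UNIV. (1 - l * (cmod (z $ k))\<^sup>2) * blinfun_apply (\<alpha> k) S)
        - l * Im (hdot ?w (D S d)) - l / 2 * Im (hdot d (D S d))) - l * Im (hdot (?w + d) U) + C * l"
      by (simp add: hdot_algebra algebra_simps)
    also have "(1 / 2) * (\<Sum>k\<in>UNIV. (1 - l * (cmod (z $ k))\<^sup>2) * blinfun_apply (\<alpha> k) S)
        - l * Im (hdot ?w (D S d)) - l / 2 * Im (hdot d (D S d))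
      = (1 / 2) * (\<Sum>k\<in>UNIV. (1 - l * (cmod ((?w + d) $ k))\<^sup>2) * blinfun_apply (\<alpha> k) S)"
    proof -
      have n: "(cmod (x + y))\<^sup>2 = (cmod x)\<^sup>2 + (cmod y)\<^sup>2 + 2 * Re (cnj x * y)" for x y
        by (simp add: cmod_power2 power2_sum algebra_simps)
      have nw: "cmod (?w $ k) = cmod (z $ k)" for k by (simp add: T_nth norm_mult)
      have nd: "Re (cnj (d $ k) * d $ k) = (cmod (d $ k))\<^sup>2" for k
        by (simp add: cmod_power2) (simp add: power2_eq_square)
      have "(1 - l * (cmod ((?w + d) $ k))\<^sup>2) * blinfun_apply (\<alpha> k) S
        = (1 - l * (cmod (z $ k))\<^sup>2) * blinfun_apply (\<alpha> k) S
          - 2 * l * (blinfun_apply (\<alpha> k) S * Re (cnj (?w $ k) * d $ k))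
          - l * (blinfun_apply (\<alpha> k) S * Re (cnj (d $ k) * d $ k))" for k
        unfolding vector_add_component n nw nd by (simp only: ring_distribs) (simp add: algebra_simps)
      then show ?thesis
        unfolding Im_hdot_D by (simp only: sum_subtractf sum_distrib_left[symmetric]) (simp add: algebra_simps)
    qed
    also have "blinfun_apply (char_form \<kappa>) S
      + (1 / 2) * (\<Sum>k\<in>UNIV. (1 - l * (cmod ((?w + d) $ k))\<^sup>2) * blinfun_apply (\<alpha> k) S)
      - l * Im (hdot (?w + d) U) + C * l = blinfun_apply (\<Psi> (act g z)) X"
      by (simp only: g X act_eq \<Psi>_apply)
    finally show "blinfun_apply (coAd \<alpha> g (\<Psi> z)) X = blinfun_apply (\<Psi> (act g z)) X" .
  qed
qed

text \<open>The translations (0, z, 0) alone reach every \<open>\<Psi> z\<close> from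
  \<open>\<Psi> 0\<close>.\<close>

lemma orbit_eq: "coadjoint_orbit \<alpha> \<kappa> l = range \<Psi>"
proof -
  have "\<Psi> z \<in> orbit GG (coAd \<alpha>) (\<Psi> 0)" for z
  proof -
    have "coAd \<alpha> (0, z, 0) (\<Psi> 0) = \<Psi> z" by (simp add: coAd_\<Psi> act_eq T_algebra)
    then show ?thesis by (auto simp: orbit_def carrier_GG intro!: exI[of _ 0] exI[of _ z])
  qed
  then show ?thesis by (auto simp: coadjoint_orbit_def orbit_def coAd_\<Psi>)
qed

section \<open>The map psi as a homeomorphism onto the orbit\<close>

lemma \<Psi>_continuous: "continuous_on UNIV \<Psi>"
proof (rule continuous_on_blinfun_componentwise)
  fix X :: "('m, 'n) diamond"
  obtain S U C where X: "X = (S, U, C)" by (metis surj_pair)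
  show "continuous_on UNIV (\<lambda>z. blinfun_apply (\<Psi> z) X)"
    unfolding X \<Psi>_apply by (intro continuous_intros)
qed

text \<open>A continuous left inverse of \<Psi>: on \<open>(0, axis k c, 0)\<close> the functional
  \<open>\<Psi> z\<close> takes the value \<open>- l * Im (cnj (z $ k) * c)\<close>, so c = \<i>
  yields the real part and c = 1 the imaginary part of the coordinate.\<close>

definition chart :: "(('m, 'n) diamond \<Rightarrow>\<^sub>L real) \<Rightarrow> complex ^ 'n" where
  "chart \<xi> = (\<chi> k. of_real (- blinfun_apply \<xi> (0, axis k \<i>, 0) / l) + \<i> * of_real (blinfun_apply \<xi> (0, axis k 1, 0) / l))"

lemma hdot_axis: "hdot z (axis k c) = cnj (z $ k) * c"
proof -
  have "hdot z (axis k c) = (\<Sum>j\<in>UNIV. if j = k then cnj (z $ k) * c else 0)"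
    unfolding hdot_eq by (intro sum.cong) (auto simp: axis_def)
  then show ?thesis by simp
qed

lemma chart_\<Psi>: "chart (\<Psi> z) = z"
proof -
  have "blinfun_apply (\<Psi> z) (0, axis k c, 0) = - l * Im (cnj (z $ k) * c)" for k c
    by (simp add: \<Psi>_apply blinfun.zero_right hdot_axis)
  then show ?thesis using l by (simp add: chart_def vec_eq_iff complex_eq_iff)
qed

lemma chart_continuous: "continuous_on S chart"
  unfolding chart_def using l by (intro continuous_intros) auto

lemma stratonovich_weyl_orbit:
  "stratonovich_weyl GG H ip \<pi> (nu \<alpha> \<kappa> l) (coadjoint_act \<alpha> \<kappa> l) (weyl_symbol_orbit \<alpha> \<kappa> l)"
proof -
  have inj: "inj \<Psi>" by (rule inj_on_inverseI) (rule chart_\<Psi>)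
  have "continuous_on (range \<Psi>) (inv_into UNIV \<Psi>)"
    by (rule continuous_on_eq[OF chart_continuous]) (auto simp: chart_\<Psi> inj)
  then have "stratonovich_weyl GG H ip \<pi> (distr M (restrict_space borel (range \<Psi>)) \<Psi>) (coadjoint_act \<alpha> \<kappa> l)
      (\<lambda>A. weyl_symbol l A \<circ> inv_into UNIV \<Psi>)"
    by (intro stratonovich_weyl_transport[OF stratonovich_weyl_fock] inj \<Psi>_continuous)
      (simp_all add: coadjoint_act_def orbit_eq coAd_\<Psi>)
  then show ?thesis
    by (simp add: nu_def orbit_eq weyl_symbol_orbit_def[abs_def])
qed

end

theorem proposition7p2:
  fixes \<alpha> :: "'n::finite \<Rightarrow> (real ^ 'm::finite) \<Rightarrow>\<^sub>L real"
    and \<kappa> :: "real ^ 'm \<Rightarrow> complex"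
    and l :: real
  assumes "l > 0" and "unitary_character \<kappa>"
  shows "stratonovich_weyl (diamond_group \<alpha>) (fock l) (fock_inner l) (diamond_rep \<alpha> \<kappa> l)
           (mu l) (diamond_act \<alpha>) (weyl_symbol l)
       \<and> stratonovich_weyl (diamond_group \<alpha>) (fock l) (fock_inner l) (diamond_rep \<alpha> \<kappa> l)
           (nu \<alpha> \<kappa> l) (coadjoint_act \<alpha> \<kappa> l) (weyl_symbol_orbit \<alpha> \<kappa> l)"
proof -
  interpret diamond l "TYPE('n)" \<alpha> \<kappa>
    using assms by unfold_locales
  show ?thesis using stratonovich_weyl_fock stratonovich_weyl_orbit by (rule conjI)
qed

end
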